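(* Let $p,q$ be probability densities on $\mathbb{R}^d$ whose probability measures satisfy $P\ll Q$, let $f:\mathbb{R}_+^2\to\mathbb{R}$, and let $(a,b,\tilde a,\tilde b)\in\mathbb{R}^4$. Let $k,l\in\mathbb{N}$ be fixed with $k>-a$ and $l>-\tilde a$, and suppose that the estimator function $\phi_{kl}$ of $f$ with parameters $(k,l)$ exists and satisfies $|\phi_{kl}(u,v)|\le C\psi_{a,b}(u)\psi_{\tilde a,\tilde b}(v)$ for all $u,v>0$ and some constant $C$. Suppose that each density $g\in\{p,q\}$ satisfies the following: (i) there exists $0<C_g<\infty$ with $g(x)\le C_g$ for almost every $x$; (ii) there exists $c_g>0$ with $g(x)\ge c_g$ for $x\in\operatorname{supp}(g)$; (iii) $\operatorname{supp}(g)$ is bounded; (iv) there exists $r>0$ such that $\displaystyle\inf_{x\in\operatorname{supp}(g)}\inf_{r'\in(0,r]}\frac{\mathrm{Leb}(B(x,r')\cap\operatorname{supp}(g))}{\mathrm{Leb}(B(x,r'))}>0$; (v) $g$ is $\sigma_g$-Hölder continuous over the interior of $\operatorname{supp}(g)$ for some $\sigma_g\in(0,2]$; (vi) the boundary of $\operatorname{supp}(g)$ has finite $(d-1)$-dimensional Hausdorff measure. Then, as $m,n\to\infty$, $$\bigl|\mathbb{E}[\hat T_f^{(k,l)}(X_1,\ldots,X_m,Y_1,\ldots,Y_n)]-T_f(p,q)\bigr|=\tilde O\bigl(m^{-\lambda(\sigma_p,a,k)}+n^{-\lambda(\sigma_q,\tilde a,l)}\bigr),$$ where $$\lambda(\sigma,a,k)=\begin{cases}\frac1d(\sigma\wedge1)\frac{k+a}{k-1}&\text{if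 }a\le-\frac{\sigma}{d}-1,\\[2pt]\frac1d\bigl(\sigma\wedge\frac{k+a}{k-1}\bigr)&\text{if }-\frac{\sigma}{d}-1<a\le-1,\\[2pt]\frac1d(\sigma\wedge1)&\text{if }a>-1.\end{cases}$$
   Context: $\mathrm{Leb}$ is Lebesgue measure on $\mathbb{R}^d$ with Euclidean norm $\|\cdot\|$; $B(x,r)=\{y:\|x-y\|<r\}$. For a density $g$ with probability measure $G$, $\operatorname{supp}(g)=\{x:G(B(x,r))>0\ \forall r>0\}$. $X_1,X_2,\ldots$ are i.i.d. with density $p$ and $Y_1,Y_2,\ldots$ are i.i.d. with density $q$, independent of the $X_i$. For a finite set $A$, $r_k(x|A)$ is the distance from $x$ to its $k$-th nearest neighbor in $A$ (ties broken arbitrarily). $s\wedge t=\min\{s,t\}$. $\tilde O$ denotes $O$ up to polylogarithmic factors: $F=\tilde O(G)$ means $F=O(G(\ln G)^c)$ for some $c\in\mathbb{R}$ (applied to each of the summands in $m$ and $n$). Functional: $T_f(p,q)=\int f(p(x),q(x))p(x)\,dx$. Estimator function: $\phi_{kl}(u,v)=\frac{\Gamma(k)\Gamma(l)}{u^{k-1}v^{l-1}}\mathcal{L}^{-1}\{f(p,q)/(p^kq^l)\}(u,v)$ (two-dimensional inverse Laplace transform); that is, $\phi_{kl}:(0,\infty)^2\to\mathbb{R}$ is a function with $\int_0^\infty\!\int_0^\infty u^{k-1}v^{l-1}\phi_{kl}(u,v)e^{-su-tv}\,du\,dv=\Gamma(k)\Gamma(l)f(s,t)/(s^kt^l)$ for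 all $s,t>0$. Estimator: for $m\ge k+1$ and $n\ge l$, $U_{km}(X_i)=(m-1)\mathrm{Leb}\bigl(B(X_i,r_k(X_i|\{X_j:j\ne i\}))\bigr)$, $V_{ln}(X_i)=n\,\mathrm{Leb}\bigl(B(X_i,r_l(X_i|\{Y_1,\ldots,Y_n\}))\bigr)$, and $\hat T_f^{(k,l)}=\frac1m\sum_{i=1}^m\phi_{kl}(U_{km}(X_i),V_{ln}(X_i))$. Polynomial envelope: $\psi_{a,b}(u)=u^a$ for $0<u\le1$ and $\psi_{a,b}(u)=u^b$ for $u>1$. Hölder continuity: for $\sigma>0$, $g:\mathbb{R}^d\to\mathbb{R}$ is $\sigma$-Hölder continuous over an open set $\Omega$ if $g$ is continuously differentiable over $\Omega$ up to order $\kappa=\lceil\sigma\rceil-1$ and $\sup_{|\mathbf{r}|=\kappa}\sup_{y\ne z\in\Omega}\frac{|\partial^{\mathbf{r}}g(y)-\partial^{\mathbf{r}}g(z)|}{\|y-z\|^{\sigma-\kappa}}<\infty$, where $\mathbf{r}$ ranges over multi-indices in $\mathbb{Z}_+^d$. *)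

theory Defs
  imports "HOL-Probability.Probability" "HOL-Library.Landau_Symbols"
begin

section \<open>Densities and their supports\<close>

text \<open>The Euclidean space \<open>\<real>\<^sup>d\<close> is an arbitrary \<^class>\<open>euclidean_space\<close>, with
  \<open>d\<close> its dimension \<open>DIM('a)\<close>.\<close>

definition prob_density :: "('a::euclidean_space \<Rightarrow> real) \<Rightarrow> bool" where
  "prob_density g \<longleftrightarrow>
     g \<in> borel_measurable borel \<and> (\<forall>x. 0 \<le> g x) \<and> (\<integral>\<^sup>+ x. ennreal (g x) \<partial>lborel) = 1"

definition prob_of :: "('a::euclidean_space \<Rightarrow> real) \<Rightarrow> 'a measure" where
  "prob_of g = density lborel (\<lambda>x. ennreal (g x))"

definition supp :: "('a::euclidean_space \<Rightarrow> real) \<Rightarrow> 'a set" where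
  "supp g = {x. \<forall>r>0. emeasure (prob_of g) (ball x r) > 0}"

section \<open>Hoelder continuity\<close>

definition partial_deriv :: "'a \<Rightarrow> ('a::euclidean_space \<Rightarrow> real) \<Rightarrow> 'a \<Rightarrow> real" where
  "partial_deriv b g x = frechet_derivative g (at x) b"

text \<open>A multi-index of order \<open>j\<close> is given as a list of \<open>j\<close> basis vectors, whose entry \<open>r\<^sub>b\<close> is the
  multiplicity of \<open>b\<close>. For a \<open>j\<close> times continuously differentiable function the order of the list
  is irrelevant.\<close>

primrec iter_partial :: "'a list \<Rightarrow> ('a::euclidean_space \<Rightarrow> real) \<Rightarrow> 'a \<Rightarrow> real" where
  "iter_partial [] g = g"
| "iter_partial (b # bs) g = iter_partial bs (partial_deriv b g)"

primrec cont_differentiable_on :: "nat \<Rightarrow> ('a::euclidean_space \<Rightarrow> real) \<Rightarrow> 'a set \<Rightarrow> bool" where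
  "cont_differentiable_on 0 g \<Omega> \<longleftrightarrow> continuous_on \<Omega> g"
| "cont_differentiable_on (Suc j) g \<Omega> \<longleftrightarrow>
     (\<forall>x\<in>\<Omega>. g differentiable (at x)) \<and>
     (\<forall>b\<in>Basis. cont_differentiable_on j (partial_deriv b g) \<Omega>)"

definition holder_order :: "real \<Rightarrow> nat" where
  "holder_order \<sigma> = nat (\<lceil>\<sigma>\<rceil> - 1)"

definition holder_continuous_on :: "real \<Rightarrow> ('a::euclidean_space \<Rightarrow> real) \<Rightarrow> 'a set \<Rightarrow> bool" where
  "holder_continuous_on \<sigma> g \<Omega> \<longleftrightarrow>
     cont_differentiable_on (holder_order \<sigma>) g \<Omega> \<and>
     bdd_above {\<bar>iter_partial bs g y - iter_partial bs g z\<bar>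
                  / norm (y - z) powr (\<sigma> - real (holder_order \<sigma>)) | bs y z.
                set bs \<subseteq> Basis \<and> length bs = holder_order \<sigma> \<and> y \<in> \<Omega> \<and> z \<in> \<Omega> \<and> y \<noteq> z}"

section \<open>Hausdorff measure\<close>

text \<open>The empty set is given weight 0 separately, since for \<open>s = 0\<close> the factor \<open>0 ^ 0\<close> is 1 (as it
  should be for singletons). The covering sets must be bounded, as \<^const>\<open>diameter\<close> is
  meaningless on unbounded sets.\<close>

definition hausdorff_weight :: "nat \<Rightarrow> 'a::metric_space set \<Rightarrow> ennreal" where
  "hausdorff_weight s E =
     (if E = {} then 0 else ennreal (unit_ball_vol (real s) * (diameter E / 2) ^ s))"

definition hausdorff_premeasure :: "nat \<Rightarrow> real \<Rightarrow> 'a::metric_space set \<Rightarrow> ennreal" where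
  "hausdorff_premeasure s \<delta> A =
     (INF E \<in> {E :: nat \<Rightarrow> 'a set. A \<subseteq> (\<Union>i. E i) \<and> (\<forall>i. bounded (E i) \<and> diameter (E i) \<le> \<delta>)}.
        \<Sum>i. hausdorff_weight s (E i))"

definition hausdorff_measure :: "nat \<Rightarrow> 'a::metric_space set \<Rightarrow> ennreal" where
  "hausdorff_measure s A = (SUP \<delta> \<in> {0<..}. hausdorff_premeasure s \<delta> A)"

section \<open>Conditions on a density\<close>

definition regular_density :: "real \<Rightarrow> ('a::euclidean_space \<Rightarrow> real) \<Rightarrow> bool" where
  "regular_density \<sigma> g \<longleftrightarrow>
     (\<exists>C>0. AE x in lborel. g x \<le> C) \<and>
     (\<exists>c>0. \<forall>x\<in>supp g. c \<le> g x) \<and>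
     bounded (supp g) \<and>
     (\<exists>r>0. 0 < (INF x\<in>supp g. INF r'\<in>{0<..r}.
                   measure lborel (ball x r' \<inter> supp g) / measure lborel (ball x r'))) \<and>
     (0 < \<sigma> \<and> \<sigma> \<le> 2 \<and> holder_continuous_on \<sigma> g (interior (supp g))) \<and>
     hausdorff_measure (DIM('a) - 1) (frontier (supp g)) < \<infinity>"

section \<open>The functional and its nearest neighbour estimator\<close>

text \<open>The integral is over the completed measure because \<open>f\<close> is arbitrary, so that the integrand
  is uncontrolled on the null set where \<open>q\<close> vanishes and \<open>p\<close> does not.\<close>

definition density_functional ::
    "(real \<Rightarrow> real \<Rightarrow> real) \<Rightarrow> ('a::euclidean_space \<Rightarrow> real) \<Rightarrow> ('a \<Rightarrow> real) \<Rightarrow> real" where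
  "density_functional f p q = (\<integral>x. f (p x) (q x) * p x \<partial>lebesgue)"

definition is_estimator_function ::
    "nat \<Rightarrow> nat \<Rightarrow> (real \<Rightarrow> real \<Rightarrow> real) \<Rightarrow> (real \<Rightarrow> real \<Rightarrow> real) \<Rightarrow> bool" where
  "is_estimator_function k l f \<phi> \<longleftrightarrow>
     (\<forall>s>0. \<forall>t>0.
        set_integrable lborel ({0<..} \<times> {0<..})
          (\<lambda>(u, v). u ^ (k - 1) * v ^ (l - 1) * \<phi> u v * exp (- s * u - t * v)) \<and>
        (LINT (u, v) : {0<..} \<times> {0<..} | lborel.
           u ^ (k - 1) * v ^ (l - 1) * \<phi> u v * exp (- s * u - t * v))
          = Gamma (real k) * Gamma (real l) * (f s t / (s ^ k * t ^ l)))"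

definition poly_envelope :: "real \<Rightarrow> real \<Rightarrow> real \<Rightarrow> real" where
  "poly_envelope a b u = (if u \<le> 1 then u powr a else u powr b)"

definition nn_dist :: "nat \<Rightarrow> 'a::metric_space \<Rightarrow> 'a set \<Rightarrow> real" where
  "nn_dist k x A = sorted_list_of_multiset (image_mset (dist x) (mset_set A)) ! (k - 1)"

text \<open>The samples are \<open>X\<^sub>1, \<dots>, X\<^sub>m\<close> and \<open>Y\<^sub>1, \<dots>, Y\<^sub>n\<close>; the value at index 0 is not used.\<close>

definition nn_U :: "nat \<Rightarrow> nat \<Rightarrow> (nat \<Rightarrow> 'a::euclidean_space) \<Rightarrow> nat \<Rightarrow> real" where
  "nn_U k m X i = (real m - 1) * measure lborel (ball (X i) (nn_dist k (X i) (X ` ({1..m} - {i}))))"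

definition nn_V ::
    "nat \<Rightarrow> nat \<Rightarrow> (nat \<Rightarrow> 'a::euclidean_space) \<Rightarrow> (nat \<Rightarrow> 'a) \<Rightarrow> nat \<Rightarrow> real" where
  "nn_V l n X Y i = real n * measure lborel (ball (X i) (nn_dist l (X i) (Y ` {1..n})))"

text \<open>An estimator function is only meaningful on the open quadrant. The volumes vanish only when
  sample points coincide, a null event; the value 0 there keeps the estimator measurable.\<close>

definition on_quadrant :: "(real \<Rightarrow> real \<Rightarrow> real) \<Rightarrow> real \<Rightarrow> real \<Rightarrow> real" where
  "on_quadrant \<phi> u v = (if 0 < u \<and> 0 < v then \<phi> u v else 0)"

definition nn_estimator ::
    "(real \<Rightarrow> real \<Rightarrow> real) \<Rightarrow> nat \<Rightarrow> nat \<Rightarrow> nat \<Rightarrow> nat \<Rightarrow>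
     (nat \<Rightarrow> 'a::euclidean_space) \<Rightarrow> (nat \<Rightarrow> 'a) \<Rightarrow> real" where
  "nn_estimator \<phi> k l m n X Y =
     (1 / real m) * (\<Sum>i=1..m. on_quadrant \<phi> (nn_U k m X i) (nn_V l n X Y i))"

section \<open>Rates\<close>

text \<open>For \<open>k = 1\<close> the condition \<open>k > - a\<close> leaves only the last case, so \<open>k - 1\<close> is never zero in a
  denominator that matters.\<close>

definition bias_exponent :: "nat \<Rightarrow> real \<Rightarrow> real \<Rightarrow> nat \<Rightarrow> real" where
  "bias_exponent d \<sigma> a k =
     (if a \<le> - \<sigma> / real d - 1 then (1 / real d) * min \<sigma> 1 * ((real k + a) / (real k - 1))
      else if a \<le> - 1 then (1 / real d) * min \<sigma> ((real k + a) / (real k - 1))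
      else (1 / real d) * min \<sigma> 1)"

text \<open>The absolute value makes real powers of the negative number \<open>ln G\<close> meaningful when
  \<open>G\<close> tends to 0.\<close>

definition with_polylog :: "real \<Rightarrow> real \<Rightarrow> real" where
  "with_polylog c G = G * \<bar>ln G\<bar> powr c"

end

theory Submission
  imports Defs
begin

text \<open>
  Fix a point \<open>x\<close>, and let \<open>N\<close> points be sampled independently from a density \<open>g\<close> with
  distribution \<open>G\<close>; here \<open>N = m - 1\<close> for the sample of \<open>p\<close> and \<open>N = n\<close> for that of \<open>q\<close>. The offset
  \<open>z\<close> from \<open>x\<close> to its \<open>k\<close>-th nearest neighbour has density
  \<open>nn_kernel g N k x z = N g(x + z) \<beta>(G(B(x, \<bar>z\<bar>)))\<close>, where \<open>\<beta>(P)\<close> is the binomial probability that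
  exactly \<open>k - 1\<close> of the other \<open>N - 1\<close> points fall in a set of probability \<open>P\<close>. The estimator sees
  \<open>z\<close> through the rescaled volume \<open>u = N Leb(B(x, \<bar>z\<bar>))\<close>. Summing over the pairs of sample points
  which can be the two neighbours writes the expectation of the estimator as an integral of \<open>\<phi>\<close>
  against a product of two such kernels (\<open>expectation_nn_estimator\<close>).

  Replacing \<open>g(x + z)\<close> by \<open>g(x)\<close> and the binomial weight by the Poisson weight gives
  \<open>gamma_kernel\<close>, under which \<open>u\<close> has the Gamma law with shape \<open>k\<close> and rate \<open>g(x)\<close>. The Laplace
  identity that defines an estimator function says that \<open>\<phi>\<close> integrates to \<open>f(p(x), q(x))\<close> against
  the product of two Gamma laws (\<open>gamma_kernel_integral\<close>). So the functional is the same integral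
  with Gamma kernels, and the bias is bounded by the distance of the two kernels in
  \<open>L\<^sup>1\<close> weighted by the polynomial envelope (\<open>kernel_functional_difference\<close>).

  That distance is \<open>O(N powr (- s / d))\<close> with \<open>s = min \<sigma> 1\<close> (\<open>kernel_error_bound\<close>). The bounds on
  \<open>g\<close> and the ball condition keep \<open>G(B(x, \<bar>z\<bar>))\<close> between two multiples of the volume, whence both
  kernels are at most a multiple of \<open>N u ^ (k - 1) exp (- c u)\<close>. As \<open>k > - a\<close>, this is integrable
  against an envelope which blows up like \<open>u powr a\<close> at \<open>0\<close>. The difference of the kernels carries
  in addition the factor
  \<open>\<bar>g(x + z) - g(x)\<bar> + 1 / N + \<bar>G(B(x, \<bar>z\<bar>)) / Leb(B(x, \<bar>z\<bar>)) - g(x)\<bar>\<close>. Integrated over \<open>x\<close> before \<open>z\<close>,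
  its first and last terms are at most a multiple of \<open>\<bar>z\<bar> powr s\<close>, that is, of \<open>(u / N) powr (s / d)\<close>.
  Every case of the exponent in the statement is at most \<open>s / d\<close>, so the rate holds with both
  logarithmic exponents equal to \<open>0\<close>.

  It remains to bound the integral of \<open>\<bar>g(x + z) - g(x)\<bar>\<close> over \<open>x\<close> in the support
  (\<open>regular_density_modulus\<close>). Where the segment from \<open>x\<close> to \<open>x + z\<close> stays in the interior, Hoelder
  continuity applies, with \<open>s\<close> instead of \<open>\<sigma>\<close> since one derivative already makes \<open>g\<close> Lipschitz. The
  points \<open>x\<close> whose segment meets the boundary form a tube of volume \<open>O(\<bar>z\<bar>)\<close>, because covering sets of
  the boundary with diameter \<open>D\<close> sweep out a volume \<open>O(\<bar>z\<bar> D ^ (d - 1))\<close> each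
  (\<open>tube_emeasure_hausdorff\<close>). Averaging over \<open>x\<close> for a fixed translation is essential: the
  \<open>r\<close>-neighbourhood of a set of finite Hausdorff measure may have a volume of larger order than \<open>r\<close>,
  while its tubes are small in every single direction.
\<close>

section \<open>Rescaled ball volumes and moments of the envelope\<close>

definition bvol :: "'a::euclidean_space \<Rightarrow> real" where
  "bvol z = unit_ball_vol (real DIM('a)) * norm z ^ DIM('a)"

lemma bvol_nonneg: "0 \<le> bvol z"
  by (simp add: bvol_def)

lemma bvol_pos_iff: "0 < bvol z \<longleftrightarrow> z \<noteq> 0"
  for z :: "'a::euclidean_space"
  by (cases "z = 0") (simp_all add: bvol_def power_0_left)

lemma bvol_borel [measurable]: "bvol \<in> borel_measurable borel"
  unfolding bvol_def by measurable

lemma measure_ball_bvol: "measure lborel (ball x (norm z)) = bvol z"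
  for x z :: "'a::euclidean_space"
  by (simp add: bvol_def content_ball)

text \<open>The value of the statistics \<open>nn_U\<close> and \<open>nn_V\<close> when the neighbour has offset \<open>z\<close> and is
  sought among \<open>N\<close> points.\<close>

definition svol :: "nat \<Rightarrow> 'a::euclidean_space \<Rightarrow> real" where
  "svol N z = real N * bvol z"

lemma svol_nonneg: "0 \<le> svol N z"
  by (simp add: svol_def bvol_nonneg)

lemma svol_pos: "0 < N \<Longrightarrow> z \<noteq> 0 \<Longrightarrow> 0 < svol N z"
  by (simp add: svol_def bvol_pos_iff)

lemma svol_borel [measurable]: "svol N \<in> borel_measurable borel"
  unfolding svol_def by measurable

lemma emeasure_svol_le:
  assumes "N > 0"
  shows "ennreal (real N) * emeasure lborel {z::'a::euclidean_space. svol N z \<le> u} = ennreal u"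
proof (cases "u < 0")
  case True
  then have "{z::'a. svol N z \<le> u} = {}"
    using svol_nonneg[of N] by (smt (verit) empty_Collect_eq)
  then show ?thesis using True by (simp add: ennreal_neg)
next
  case False
  let ?d = "DIM('a)"
  let ?c = "unit_ball_vol (real ?d)"
  define R where "R = root ?d (u / (real N * ?c))"
  have c: "?c > 0" by (simp add: unit_ball_vol_pos)
  have R0: "R \<ge> 0" using False assms c by (simp add: R_def)
  have Rd: "R ^ ?d = u / (real N * ?c)" using False assms c by (simp add: R_def)
  have "svol N z \<le> u \<longleftrightarrow> norm z \<le> R" for z :: 'a
  proof -
    have "svol N z \<le> u \<longleftrightarrow> norm z ^ ?d \<le> R ^ ?d"
      unfolding Rd svol_def bvol_def using assms c by (simp add: field_simps)
    also have "\<dots> \<longleftrightarrow> norm z \<le> R"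
      using R0 by (simp add: power_mono_iff)
    finally show ?thesis .
  qed
  then have "{z::'a. svol N z \<le> u} = cball 0 R"
    by (intro set_eqI) (simp only: mem_Collect_eq mem_cball_0)
  then have "ennreal (real N) * emeasure lborel {z::'a. svol N z \<le> u} = ennreal (real N) * ennreal (?c * R ^ ?d)"
    using R0 by (simp add: emeasure_cball)
  also have "\<dots> = ennreal u"
    using assms c False by (simp add: Rd ennreal_mult'[symmetric] less_imp_neq[OF c, symmetric])
  finally show ?thesis .
qed

text \<open>The sublevel sets of \<open>svol N\<close> are balls of volume \<open>u / N\<close>, so the rescaled volume carries
  \<open>N\<close> times Lebesgue measure of the space to Lebesgue measure of the half line.\<close>

lemma distr_svol:
  assumes N: "N > 0"
  shows "distr (density lborel (\<lambda>_::'a::euclidean_space. ennreal (real N))) borel (svol N)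
       = density lborel (indicator {0..})" (is "?L = ?R")
proof (rule measure_eqI_generator_eq[where E="range (\<lambda>u::real. {..u})" and A="\<lambda>n. {..real n}" and \<Omega>=UNIV])
  have L: "emeasure ?L {..u} = ennreal u" for u
  proof -
    have "emeasure ?L {..u} = emeasure (density lborel (\<lambda>_::'a. ennreal (real N))) {z. svol N z \<le> u}"
      by (subst emeasure_distr) (auto intro!: arg_cong2[where f=emeasure])
    also have "\<dots> = ennreal (real N) * emeasure lborel {z::'a. svol N z \<le> u}"
      by (subst emeasure_density_const) auto
    finally show ?thesis by (simp only: emeasure_svol_le[OF N])
  qed
  have R: "emeasure ?R {..u} = ennreal u" for u
  proof -
    have "emeasure ?R {..u} = (\<integral>\<^sup>+x. indicator {0..u} x \<partial>lborel)"
      by (subst emeasure_density) (auto simp del: nn_integral_indicator intro!: nn_integral_cong split: split_indicator)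
    also have "\<dots> = ennreal u"
      by (cases "u < 0") (auto simp: ennreal_neg)
    finally show ?thesis .
  qed
  show "\<And>X. X \<in> range atMost \<Longrightarrow> emeasure ?L X = emeasure ?R X"
    by (auto simp: L R)
  show "emeasure ?L {..real i} \<noteq> \<infinity>" for i :: nat
    by (simp add: L)
qed (auto simp: Int_stable_def borel_eq_atMost intro: real_arch_simple)

lemma nn_integral_svol:
  assumes N: "N > 0" and [measurable]: "h \<in> borel_measurable borel"
  shows "(\<integral>\<^sup>+(z::'a::euclidean_space). ennreal (real N) * h (svol N z) \<partial>lborel)
       = (\<integral>\<^sup>+u. h u * indicator {0..} u \<partial>lborel)"
proof -
  have "(\<integral>\<^sup>+(z::'a). ennreal (real N) * h (svol N z) \<partial>lborel)
      = (\<integral>\<^sup>+u. h u \<partial>distr (density lborel (\<lambda>_::'a. ennreal (real N))) borel (svol N))"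
    by (simp add: nn_integral_distr nn_integral_density)
  also have "\<dots> = (\<integral>\<^sup>+u. h u * indicator {0..} u \<partial>lborel)"
    unfolding distr_svol[OF N] by (simp add: nn_integral_density mult.commute)
  finally show ?thesis .
qed

lemma nn_integral_powr_exp_finite:
  fixes \<alpha> c :: real
  assumes "\<alpha> > -1" "c > 0"
  shows "(\<integral>\<^sup>+u. ennreal (u powr \<alpha> * exp (- c * u)) * indicator {0..} u \<partial>lborel) < \<infinity>"
proof -
  have G: "ennreal (Gamma (\<alpha> + 1)) = (\<integral>\<^sup>+t. ennreal (indicator {0..} t * t powr \<alpha> / exp t) \<partial>lborel)"
    using Gamma_conv_nn_integral_real[of "\<alpha> + 1"] assms by simp
  also have "\<dots> = ennreal \<bar>c\<bar> * (\<integral>\<^sup>+u. ennreal (indicator {0..} (0 + c * u) * (0 + c * u) powr \<alpha> / exp (0 + c * u)) \<partial>lborel)"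
    using assms by (intro nn_integral_real_affine) auto
  also have "\<dots> = (\<integral>\<^sup>+u. ennreal c * ennreal (indicator {0..} (c * u) * (c * u) powr \<alpha> / exp (c * u)) \<partial>lborel)"
    using assms by (subst nn_integral_cmult) auto
  also have "\<dots> = (\<integral>\<^sup>+u. ennreal (c * c powr \<alpha>) * (ennreal (u powr \<alpha> * exp (- c * u)) * indicator {0..} u) \<partial>lborel)"
  proof (intro nn_integral_cong)
    fix u :: real
    show "ennreal c * ennreal (indicator {0..} (c * u) * (c * u) powr \<alpha> / exp (c * u)) =
         ennreal (c * c powr \<alpha>) * (ennreal (u powr \<alpha> * exp (- c * u)) * indicator {0..} u)"
    proof (cases "u \<ge> 0")
      case True
      have "ennreal c * ennreal ((c * u) powr \<alpha> / exp (c * u)) = ennreal (c * ((c * u) powr \<alpha> / exp (c * u)))"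
        using assms by (subst ennreal_mult') auto
      also have "c * ((c * u) powr \<alpha> / exp (c * u)) = (c * c powr \<alpha>) * (u powr \<alpha> * exp (- c * u))"
        using True assms by (simp add: powr_mult exp_minus divide_inverse)
      also have "ennreal \<dots> = ennreal (c * c powr \<alpha>) * ennreal (u powr \<alpha> * exp (- c * u))"
        using assms by (subst ennreal_mult') auto
      finally show ?thesis using True assms by simp
    next
      case False
      then have "c * u < 0" using assms by (simp add: mult_pos_neg)
      then show ?thesis using False by simp
    qed
  qed
  also have "\<dots> = ennreal (c * c powr \<alpha>) * (\<integral>\<^sup>+u. ennreal (u powr \<alpha> * exp (- c * u)) * indicator {0..} u \<partial>lborel)"
    by (subst nn_integral_cmult) auto
  finally have *: "ennreal (c * c powr \<alpha>) * (\<integral>\<^sup>+u. ennreal (u powr \<alpha> * exp (- c * u)) * indicator {0..} u \<partial>lborel) < \<infinity>"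
    by (metis ennreal_less_top infinity_ennreal_def)
  have "ennreal (c * c powr \<alpha>) \<noteq> 0" using assms by (simp add: mult_pos_pos)
  with * show ?thesis by (auto simp: ennreal_mult_less_top)
qed

lemma poly_envelope_nonneg: "0 \<le> poly_envelope a b u"
  by (simp add: poly_envelope_def)

lemma poly_envelope_borel [measurable]: "poly_envelope a b \<in> borel_measurable borel"
  unfolding poly_envelope_def by measurable

lemma poly_envelope_le: "poly_envelope a b u \<le> u powr a + u powr (max a b)" if "u \<ge> 0"
proof (cases "u \<le> 1")
  case False
  then have "u powr b \<le> u powr (max a b)" by (intro powr_mono) auto
  with False show ?thesis by (simp add: poly_envelope_def add_increasing)
qed (simp add: poly_envelope_def)

text \<open>The density of the Gamma law with shape \<open>k\<close> and rate \<open>c\<close>, up to its normalising constant.\<close>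

definition gamma_weight :: "nat \<Rightarrow> real \<Rightarrow> real \<Rightarrow> real" where
  "gamma_weight k c u = u ^ (k - 1) * exp (- c * u)"

lemma gamma_weight_nonneg: "0 \<le> u \<Longrightarrow> 0 \<le> gamma_weight k c u"
  by (simp add: gamma_weight_def)

lemma gamma_weight_borel [measurable]: "gamma_weight k c \<in> borel_measurable borel"
  unfolding gamma_weight_def by measurable

definition envelope_moment :: "real \<Rightarrow> real \<Rightarrow> nat \<Rightarrow> real \<Rightarrow> real \<Rightarrow> ennreal" where
  "envelope_moment a b k e c =
     (\<integral>\<^sup>+u. ennreal (poly_envelope a b u * u powr e * gamma_weight k c u) * indicator {0..} u \<partial>lborel)"

lemma envelope_moment_svol:
  assumes "N > 0"
  shows "(\<integral>\<^sup>+(z::'a::euclidean_space). ennreal (real N) * ennreal (poly_envelope a b (svol N z) * svol N z powr e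
            * gamma_weight k c (svol N z)) \<partial>lborel) = envelope_moment a b k e c"
  unfolding envelope_moment_def by (rule nn_integral_svol[OF assms]) measurable

text \<open>At \<open>0\<close> the integrand is of order \<open>u powr (a + e + k - 1)\<close>, whose exponent exceeds \<open>- 1\<close>, and
  at infinity the exponential dominates.\<close>

lemma envelope_moment_finite:
  assumes "k \<ge> 1" "real k > - a" "e \<ge> 0" "c > 0"
  shows "envelope_moment a b k e c < \<infinity>"
proof -
  let ?h = "\<lambda>\<alpha> u. ennreal (u powr \<alpha> * exp (- c * u)) * indicator {0..} u"
  let ?\<alpha> = "a + real (k - 1) + e" and ?\<beta> = "max a b + real (k - 1) + e"
  have "envelope_moment a b k e c \<le> (\<integral>\<^sup>+u. ?h ?\<alpha> u + ?h ?\<beta> u \<partial>lborel)"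
    unfolding envelope_moment_def
  proof (intro nn_integral_mono)
    fix u :: real
    let ?l = "poly_envelope a b u * u powr e * gamma_weight k c u"
    show "ennreal ?l * indicator {0..} u \<le> ?h ?\<alpha> u + ?h ?\<beta> u"
    proof (cases "u > 0")
      case True
      have "?l \<le> (u powr a + u powr (max a b)) * u powr e * gamma_weight k c u"
        using True by (intro mult_right_mono poly_envelope_le) (auto simp: gamma_weight_nonneg)
      also have "\<dots> = u powr ?\<alpha> * exp (- c * u) + u powr ?\<beta> * exp (- c * u)"
        using True by (simp add: gamma_weight_def powr_add powr_realpow algebra_simps)
      finally have "ennreal ?l \<le> ennreal (u powr ?\<alpha> * exp (- c * u)) + ennreal (u powr ?\<beta> * exp (- c * u))"
        by (subst ennreal_plus[symmetric]) (auto simp del: ennreal_plus intro: ennreal_leI)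
      then show ?thesis using True by simp
    qed (cases "u = 0"; auto simp: poly_envelope_def)
  qed
  also have "\<dots> = (\<integral>\<^sup>+u. ?h ?\<alpha> u \<partial>lborel) + (\<integral>\<^sup>+u. ?h ?\<beta> u \<partial>lborel)"
    by (intro nn_integral_add) auto
  also have "\<dots> < \<infinity>"
    using nn_integral_powr_exp_finite[of ?\<alpha> c] nn_integral_powr_exp_finite[of ?\<beta> c] assms by auto
  finally show ?thesis .
qed

section \<open>Binomial weights and their Poisson limit\<close>

text \<open>The probability that exactly \<open>k - 1\<close> of \<open>N - 1\<close> independent points hit a set of
  probability \<open>P\<close>; for a ball with a further sample point on its boundary, this is the probability that
  this point is the \<open>k\<close>-th nearest one.\<close>

definition binom_nn :: "nat \<Rightarrow> nat \<Rightarrow> real \<Rightarrow> real" where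
  "binom_nn N k P = real ((N - 1) choose (k - 1)) * P ^ (k - 1) * (1 - P) ^ (N - k)"

text \<open>The Poisson weight at \<open>k - 1\<close>, which is the limit of \<open>binom_nn\<close> for \<open>t = N P\<close>.\<close>

definition pois :: "nat \<Rightarrow> real \<Rightarrow> real" where
  "pois k t = t ^ (k - 1) * exp (- t) / fact (k - 1)"

lemma binom_nn_borel [measurable]: "binom_nn N k \<in> borel_measurable borel"
  unfolding binom_nn_def by measurable

lemma pois_borel [measurable]: "pois k \<in> borel_measurable borel"
  unfolding pois_def by measurable

lemma binom_nn_nonneg: "0 \<le> P \<Longrightarrow> P \<le> 1 \<Longrightarrow> 0 \<le> binom_nn N k P"
  by (simp add: binom_nn_def)

lemma pois_nonneg: "0 \<le> t \<Longrightarrow> 0 \<le> pois k t"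
  by (simp add: pois_def)

text \<open>The ratio is the product of \<open>1 - i / N\<close> over \<open>1 \<le> i \<le> j\<close>.\<close>

lemma falling_ratio_bounds:
  fixes N j :: nat
  assumes "j < N"
  shows "real ((N - 1) choose j) * fact j / real N ^ j \<le> 1
       \<and> 1 - real j ^ 2 / real N \<le> real ((N - 1) choose j) * fact j / real N ^ j
       \<and> 0 \<le> real ((N - 1) choose j) * fact j / real N ^ j"
  using assms
proof (induction j)
  case 0
  then show ?case by simp
next
  case (Suc j)
  define \<theta> where "\<theta> = real ((N - 1) choose j) * fact j / real N ^ j"
  have IH: "\<theta> \<le> 1" "1 - real j ^ 2 / real N \<le> \<theta>" "0 \<le> \<theta>"
    using Suc unfolding \<theta>_def by auto
  have N: "real N > 0" using Suc.prems by simp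
  have "Suc j * ((N - 1) choose Suc j) = (N - 1 - j) * ((N - 1) choose j)"
    by (metis binomial_absorb_comp binomial_absorption mult.commute binomial_symmetric
        diff_diff_left Suc_diff_Suc choose_reduce_nat Suc_times_binomial_add)
  then have "real (Suc j) * real ((N - 1) choose Suc j) = real (N - 1 - j) * real ((N - 1) choose j)"
    by (metis of_nat_mult)
  moreover have "real (N - 1 - j) = real N - 1 - real j" using Suc.prems by simp
  ultimately have r: "real (Suc j) * real ((N - 1) choose Suc j) = (real N - 1 - real j) * real ((N - 1) choose j)"
    by simp
  have eq: "real ((N - 1) choose Suc j) * fact (Suc j) / real N ^ Suc j = \<theta> * (1 - (1 + real j) / real N)"
  proof -
    have "real ((N - 1) choose Suc j) * fact (Suc j) / real N ^ Suc j
      = (real (Suc j) * real ((N - 1) choose Suc j)) * fact j / real N ^ Suc j"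
      by (simp add: algebra_simps)
    also have "\<dots> = \<theta> * (1 - (1 + real j) / real N)"
      unfolding r \<theta>_def using N by (simp add: field_simps)
    finally show ?thesis .
  qed
  have f: "0 \<le> 1 - (1 + real j) / real N" "(1 + real j) / real N \<ge> 0"
    using Suc.prems by (auto simp: field_simps)
  have "\<theta> * (1 - (1 + real j) / real N) \<ge> \<theta> - (1 + real j) / real N"
    using mult_right_mono[OF IH(1) f(2)] by (simp add: algebra_simps)
  also have "\<theta> - (1 + real j) / real N \<ge> 1 - (real j ^ 2 + 1 + real j) / real N"
    using IH(2) by (simp add: add_divide_distrib)
  also have "1 - (real j ^ 2 + 1 + real j) / real N \<ge> 1 - real (Suc j) ^ 2 / real N"
    using N by (simp add: divide_right_mono power2_eq_square algebra_simps)
  finally have lo: "\<theta> * (1 - (1 + real j) / real N) \<ge> 1 - real (Suc j) ^ 2 / real N" .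
  have "\<theta> * (1 - (1 + real j) / real N) \<le> 1 * 1"
    using IH f by (intro mult_mono) auto
  then show ?case unfolding eq using lo IH f by auto
qed

lemma one_minus_power_le_exp:
  fixes P :: real
  assumes "0 \<le> P" "P \<le> 1"
  shows "(1 - P) ^ n \<le> exp (- (real n * P))"
proof -
  have "(1 - P) ^ n \<le> exp (- P) ^ n"
    using assms exp_ge_add_one_self[of "- P"] by (intro power_mono) auto
  then show ?thesis by (simp add: exp_of_nat_mult[symmetric])
qed

text \<open>Since \<open>1 - P\<^sup>2 = (1 - P) (1 + P) \<le> (1 - P) exp P\<close>, Bernoulli's inequality bounds
  \<open>(1 - P) ^ n exp (n P)\<close> from below.\<close>

lemma exp_minus_power_one_minus:
  fixes P :: real
  assumes P: "0 \<le> P" "P \<le> 1" and "n \<ge> 1"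
  shows "exp (- (real n * P)) - (1 - P) ^ n \<le> exp (- (real n * P)) * (real n * P\<^sup>2)"
proof -
  have "1 - P\<^sup>2 = (1 - P) * (1 + P)" by (simp add: power2_eq_square algebra_simps)
  also have "\<dots> \<le> (1 - P) * exp P"
    using P exp_ge_add_one_self[of P] by (intro mult_left_mono) auto
  finally have "(1 - P\<^sup>2) ^ n \<le> ((1 - P) * exp P) ^ n"
    using P by (intro power_mono) (auto simp: power_le_one)
  moreover have "1 + real n * (- P\<^sup>2) \<le> (1 + (- P\<^sup>2)) ^ n"
    using P by (intro Bernoulli_inequality) (auto simp: power_le_one)
  ultimately have "1 - real n * P\<^sup>2 \<le> (1 - P) ^ n * exp (real n * P)"
    by (simp add: power_mult_distrib exp_of_nat_mult[symmetric])
  then have "exp (- (real n * P)) * (1 - real n * P\<^sup>2) \<le> exp (- (real n * P)) * ((1 - P) ^ n * exp (real n * P))"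
    by (intro mult_left_mono) auto
  then show ?thesis by (simp add: algebra_simps exp_minus)
qed

text \<open>The binomial weight is \<open>t ^ (k - 1) / (k - 1)!\<close> times a falling factorial ratio times
  \<open>(1 - P) ^ (N - k)\<close>, and the last two factors differ from \<open>1\<close> and \<open>exp (- t)\<close> by \<open>O(1 / N)\<close> up to
  polynomials in \<open>t\<close>. The factor \<open>t ^ (k - 1)\<close> must survive in the bound, as it will have to
  compensate the singularity of the envelope at \<open>0\<close>.\<close>

lemma binom_pois:
  fixes P :: real
  assumes k: "1 \<le> k" "k \<le> N" and P: "0 \<le> P" "P \<le> 1"
  defines "t \<equiv> real N * P"
  shows "\<bar>binom_nn N k P - pois k t\<bar>
      \<le> 2 * real k ^ 2 * exp (real k) / real N * (t ^ (k - 1) * (1 + t\<^sup>2) * exp (- t))"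
proof -
  define j where "j = k - 1"
  define \<theta> where "\<theta> = real ((N - 1) choose j) * fact j / real N ^ j"
  define Q where "Q = (1 - P) ^ (N - k)"
  have N: "real N > 0" using k by simp
  have t0: "t \<ge> 0" using P by (simp add: t_def)
  have jN: "j < N" using k by (simp add: j_def)
  have \<theta>: "\<theta> \<le> 1" "1 - real j ^ 2 / real N \<le> \<theta>" "0 \<le> \<theta>"
    using falling_ratio_bounds[OF jN] unfolding \<theta>_def by auto
  have kk: "real k \<ge> 1" using k by simp
  have ek: "exp (real k) \<ge> 1" using kk by simp
  have Q0: "Q \<ge> 0" using P by (simp add: Q_def)
  have Q1: "Q \<le> exp (- t) * exp (real k * P)"
  proof -
    have "Q \<le> exp (- (real (N - k) * P))" unfolding Q_def by (rule one_minus_power_le_exp[OF P])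
    also have "\<dots> = exp (- t) * exp (real k * P)"
      using k by (simp add: t_def exp_add[symmetric] of_nat_diff algebra_simps)
    finally show ?thesis .
  qed
  have Q2: "Q \<le> exp (- t) * exp (real k)"
  proof (rule order_trans[OF Q1])
    show "exp (- t) * exp (real k * P) \<le> exp (- t) * exp (real k)"
      using P k by (simp add: mult_left_le)
  qed
  have up: "Q - exp (- t) \<le> exp (- t) * (real k * exp (real k) * t / real N)"
  proof -
    have "exp (real k * P) - 1 \<le> real k * P * exp (real k * P)"
    proof -
      have "1 - real k * P \<le> exp (- (real k * P))" using exp_ge_add_one_self[of "- (real k * P)"] by simp
      then have "(1 - real k * P) * exp (real k * P) \<le> exp (- (real k * P)) * exp (real k * P)"
        by (intro mult_right_mono) auto
      then show ?thesis by (simp add: algebra_simps exp_minus)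
    qed
    also have "\<dots> \<le> real k * P * exp (real k)"
      using P k by (intro mult_left_mono) (auto simp: mult_left_le)
    also have "\<dots> = real k * exp (real k) * t / real N" using N by (simp add: t_def)
    finally have "exp (real k * P) - 1 \<le> real k * exp (real k) * t / real N" .
    then have "exp (- t) * (exp (real k * P) - 1) \<le> exp (- t) * (real k * exp (real k) * t / real N)"
      by (intro mult_left_mono) auto
    with Q1 show ?thesis by (simp add: algebra_simps)
  qed
  have lo: "exp (- t) - Q \<le> exp (- t) * (t\<^sup>2 / real N)"
  proof -
    have "(1 - P) ^ N \<le> Q" unfolding Q_def using P k by (intro power_decreasing) auto
    moreover have "exp (- t) - (1 - P) ^ N \<le> exp (- t) * (real N * P\<^sup>2)"
      using exp_minus_power_one_minus[OF P, of N] k by (simp add: t_def)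
    moreover have "real N * P\<^sup>2 = t\<^sup>2 / real N" using N by (simp add: t_def power2_eq_square)
    ultimately show ?thesis by simp
  qed
  let ?A = "real k ^ 2 * exp (real k)"
  have A1: "real j ^ 2 * exp (real k) \<le> ?A"
    by (intro mult_right_mono power_mono) (auto simp: j_def)
  have A2: "real k * exp (real k) \<le> ?A"
    using kk by (simp add: power2_eq_square)
  have A3: "1 \<le> ?A"
    using kk ek by (metis (mono_tags, lifting) A2 mult_mono order_trans mult_1 zero_le_one)
  have "\<bar>Q - exp (- t)\<bar> \<le> exp (- t) * (real k * exp (real k) * t / real N) + exp (- t) * (t\<^sup>2 / real N)"
    using up lo t0 by (smt (verit, best) divide_nonneg_nonneg exp_ge_zero mult_nonneg_nonneg of_nat_0_le_iff zero_le_power2)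
  moreover have "\<bar>(\<theta> - 1) * Q\<bar> \<le> (real j ^ 2 / real N) * (exp (- t) * exp (real k))"
    unfolding abs_mult using \<theta> Q0 Q2 by (intro mult_mono) auto
  moreover have "\<bar>\<theta> * Q - exp (- t)\<bar> \<le> \<bar>(\<theta> - 1) * Q\<bar> + \<bar>Q - exp (- t)\<bar>"
    by (simp add: algebra_simps)
  ultimately have "\<bar>\<theta> * Q - exp (- t)\<bar> \<le> (real j ^ 2 / real N) * (exp (- t) * exp (real k))
     + (exp (- t) * (real k * exp (real k) * t / real N) + exp (- t) * (t\<^sup>2 / real N))"
    by linarith
  also have "\<dots> = (exp (- t) / real N) * (real j ^ 2 * exp (real k) + real k * exp (real k) * t + 1 * t\<^sup>2)"
    using N by (simp add: field_simps)
  also have "\<dots> \<le> (exp (- t) / real N) * (?A + ?A * t + ?A * t\<^sup>2)"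
    using A1 A2 A3 t0 by (intro mult_left_mono add_mono mult_right_mono) auto
  also have "\<dots> = (exp (- t) / real N) * (?A * (1 + t + t\<^sup>2))"
    by (simp add: algebra_simps)
  also have "\<dots> \<le> (exp (- t) / real N) * (?A * (2 * (1 + t\<^sup>2)))"
  proof -
    have "2 * t \<le> 1 + t\<^sup>2"
      using zero_le_power2[of "t - 1"] by (simp add: power2_eq_square algebra_simps)
    then have "t \<le> 1 + t\<^sup>2" using t0 by linarith
    then have "1 + t + t\<^sup>2 \<le> 2 * (1 + t\<^sup>2)" by (simp add: distrib_left)
    then show ?thesis by (intro mult_left_mono) auto
  qed
  finally have main: "\<bar>\<theta> * Q - exp (- t)\<bar> \<le> 2 * ?A / real N * ((1 + t\<^sup>2) * exp (- t))"
    by (simp add: algebra_simps add_divide_distrib)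
  have "binom_nn N k P = t ^ j / fact j * (\<theta> * Q)"
    using N by (simp add: binom_nn_def t_def \<theta>_def Q_def j_def power_mult_distrib)
  then have "binom_nn N k P - pois k t = t ^ j / fact j * (\<theta> * Q - exp (- t))"
    by (simp add: pois_def j_def algebra_simps add_divide_distrib diff_divide_distrib)
  then have "\<bar>binom_nn N k P - pois k t\<bar> = t ^ j / fact j * \<bar>\<theta> * Q - exp (- t)\<bar>"
    using t0 by (simp add: abs_mult)
  also have "\<dots> \<le> t ^ j * \<bar>\<theta> * Q - exp (- t)\<bar>"
    using t0 by (intro mult_right_mono) (auto simp: divide_le_eq mult_left_le fact_ge_1 intro: order_trans mult_left_mono[of 1 "fact j" "t ^ j", simplified])
  also have "\<dots> \<le> t ^ j * (2 * ?A / real N * ((1 + t\<^sup>2) * exp (- t)))"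
    using t0 main by (intro mult_left_mono) auto
  finally show ?thesis by (simp add: j_def algebra_simps add_divide_distrib)
qed

text \<open>The argument of the weight is \<open>t = r u\<close>. Its derivative in \<open>t\<close> is only of order
  \<open>t ^ (k - 2)\<close> at \<open>0\<close>; differentiating in the ratio \<open>r\<close> instead gains a factor \<open>u\<close>.\<close>

lemma pois_lipschitz:
  fixes c C u r1 r2 :: real
  assumes c: "0 < c" "c \<le> C" and u: "0 \<le> u" and r: "r1 \<in> {c..C}" "r2 \<in> {c..C}" and k: "k \<ge> 1"
  shows "\<bar>pois k (r1 * u) - pois k (r2 * u)\<bar>
       \<le> real k * (C + 1) ^ k * u ^ (k - 1) * (1 + u) * exp (- c * u) * \<bar>r1 - r2\<bar>"
proof -
  define j where "j = k - 1"
  define h where "h = (\<lambda>r::real. r ^ j * exp (- (r * u)))"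
  define B where "B = real k * (C + 1) ^ k * (1 + u) * exp (- c * u)"
  have "norm (h r1 - h r2) \<le> B * norm (r1 - r2)"
  proof (rule field_differentiable_bound[where S="{c..C}"
        and f'="\<lambda>r. real j * r ^ (j - 1) * exp (- (r * u)) - u * r ^ j * exp (- (r * u))"])
    show "(h has_field_derivative real j * r ^ (j - 1) * exp (- (r * u)) - u * r ^ j * exp (- (r * u))) (at r within {c..C})" for r
      unfolding h_def by (auto intro!: derivative_eq_intros simp: algebra_simps)
    show "norm (real j * r ^ (j - 1) * exp (- (r * u)) - u * r ^ j * exp (- (r * u))) \<le> B" if "r \<in> {c..C}" for r
    proof -
      have r: "0 < r" "c \<le> r" "r \<le> C" using that c by auto
      have e: "exp (- (r * u)) \<le> exp (- c * u)" using r u by (simp add: mult_right_mono)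
      have p1: "r ^ (j - 1) \<le> (C + 1) ^ k"
      proof -
        have "r ^ (j - 1) \<le> (C + 1) ^ (j - 1)" using r by (intro power_mono) auto
        also have "\<dots> \<le> (C + 1) ^ k" using r by (intro power_increasing) (auto simp: j_def)
        finally show ?thesis .
      qed
      have p2: "r ^ j \<le> (C + 1) ^ k"
      proof -
        have "r ^ j \<le> (C + 1) ^ j" using r by (intro power_mono) auto
        also have "\<dots> \<le> (C + 1) ^ k" using r by (intro power_increasing) (auto simp: j_def)
        finally show ?thesis .
      qed
      have "\<bar>real j * r ^ (j - 1) * exp (- (r * u)) - u * r ^ j * exp (- (r * u))\<bar>
        \<le> \<bar>real j * r ^ (j - 1) * exp (- (r * u))\<bar> + \<bar>u * r ^ j * exp (- (r * u))\<bar>"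
        by linarith
      also have "\<dots> = (real j * r ^ (j - 1) + u * r ^ j) * exp (- (r * u))"
        using r u by (simp add: abs_mult algebra_simps)
      also have "\<dots> \<le> (real k * (C + 1) ^ k + u * (real k * (C + 1) ^ k)) * exp (- c * u)"
      proof (intro mult_mono add_mono)
        show "real j \<le> real k" by (simp add: j_def)
        show "r ^ j \<le> real k * (C + 1) ^ k"
        proof -
          have "1 * (C + 1) ^ k \<le> real k * (C + 1) ^ k" using r k by (intro mult_right_mono) auto
          with p2 show ?thesis by linarith
        qed
      qed (use e p1 p2 r u in auto)
      also have "\<dots> = B" by (simp add: B_def algebra_simps)
      finally show ?thesis by simp
    qed
  qed (use r in auto)
  then have *: "\<bar>h r1 - h r2\<bar> \<le> B * \<bar>r1 - r2\<bar>" by simp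
  have "pois k (r1 * u) - pois k (r2 * u) = u ^ j / fact j * (h r1 - h r2)"
    by (simp add: pois_def h_def j_def power_mult_distrib field_simps)
  then have "\<bar>pois k (r1 * u) - pois k (r2 * u)\<bar> = u ^ j / fact j * \<bar>h r1 - h r2\<bar>"
    using u by (simp add: abs_mult)
  also have "\<dots> \<le> u ^ j * \<bar>h r1 - h r2\<bar>"
    using u by (intro mult_right_mono) (auto simp: divide_le_eq mult_left_le fact_ge_1 intro: order_trans mult_left_mono[of 1 "fact j" "u ^ j", simplified])
  also have "\<dots> \<le> u ^ j * (B * \<bar>r1 - r2\<bar>)" using u * by (intro mult_left_mono) auto
  finally show ?thesis by (simp add: B_def j_def algebra_simps)
qed

lemma poly_exp_bound:
  fixes c u :: real
  assumes "c > 0" "u \<ge> 0"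
  shows "(1 + u + u\<^sup>2) * exp (- c * u) \<le> (1 + 2 / c + 8 / c\<^sup>2) * exp (- (c / 2) * u)"
proof -
  let ?x = "c / 2 * u"
  have x: "?x \<ge> 0" using assms by simp
  have "1 + ?x + ?x\<^sup>2 / 2 \<le> exp ?x" using exp_lower_Taylor_quadratic[OF x] by simp
  then have e: "1 \<le> exp ?x" "?x \<le> exp ?x" "?x\<^sup>2 / 2 \<le> exp ?x" using x by (smt (verit) divide_nonneg_nonneg zero_le_power2)+
  have "1 + u + u\<^sup>2 = 1 + (2 / c) * ?x + (8 / c\<^sup>2) * (?x\<^sup>2 / 2)"
    using assms by (simp add: power2_eq_square field_simps)
  also have "\<dots> \<le> exp ?x + (2 / c) * exp ?x + (8 / c\<^sup>2) * exp ?x"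
    using e assms by (intro add_mono mult_left_mono) auto
  finally have "(1 + u + u\<^sup>2) * exp (- c * u) \<le> (exp ?x + (2 / c) * exp ?x + (8 / c\<^sup>2) * exp ?x) * exp (- c * u)"
    by (intro mult_right_mono) auto
  also have "\<dots> = (1 + 2 / c + 8 / c\<^sup>2) * (exp ?x * exp (- c * u))" by (simp add: algebra_simps)
  also have "exp ?x * exp (- c * u) = exp (- (c / 2) * u)" by (simp add: exp_add[symmetric])
  finally show ?thesis .
qed

section \<open>Tubes over sets of finite Hausdorff measure\<close>

definition tube :: "'a::real_vector set \<Rightarrow> 'a \<Rightarrow> 'a set" where
  "tube B z = {x. \<exists>t\<in>{0..1::real}. x + t *\<^sub>R z \<in> B}"

lemma tube_mono: "A \<subseteq> B \<Longrightarrow> tube A z \<subseteq> tube B z"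
  by (auto simp: tube_def)

lemma tube_UN: "tube (\<Union>i. E i) z = (\<Union>i. tube (E i) z)"
  by (auto simp: tube_def)

lemma tube_zero_subset: "tube B 0 \<subseteq> tube B z"
  by (auto simp: tube_def intro!: bexI[of _ 0])

lemma tube_empty [simp]: "tube {} z = {}"
  by (simp add: tube_def)

text \<open>The points of \<open>T\<close> are points of \<open>E\<close> moved back along the segment from \<open>0\<close> to \<open>z\<close>. Cutting the
  segment into about \<open>\<bar>z\<bar> / D\<close> pieces of length at most \<open>D\<close> covers \<open>T\<close> by as many balls of radius
  \<open>2 D\<close>, which avoids rotating \<open>z\<close> into a coordinate direction.\<close>

lemma tube_emeasure_le:
  fixes E :: "'a::euclidean_space set" and z :: 'a
  assumes E: "bounded E" "diameter E \<le> D" and D: "0 < D" "D \<le> norm z"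
    and T: "T \<in> sets borel" "T \<subseteq> tube E z"
  shows "emeasure lborel T
       \<le> ennreal (3 * unit_ball_vol (real DIM('a)) * 2 ^ DIM('a) * norm z * D ^ (DIM('a) - 1))"
proof (cases "E = {}")
  case True
  then show ?thesis using T by auto
next
  case False
  then obtain e0 where e0: "e0 \<in> E" by auto
  let ?d = "DIM('a)" and ?c = "unit_ball_vol (real DIM('a))"
  define J where "J = nat \<lceil>norm z / D\<rceil>"
  have zD: "norm z / D \<ge> 1" using D by simp
  have J: "real J \<ge> norm z / D" "real J \<le> norm z / D + 1"
    unfolding J_def using zD by (linarith, linarith)
  then have J1: "real J \<ge> 1" using zD by linarith
  have zJ: "norm z / real J \<le> D"
    using J(1) J1 D by (simp add: field_simps)
  have "T \<subseteq> (\<Union>i\<in>{..J}. cball (e0 - (real i / real J) *\<^sub>R z) (2 * D))"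
  proof
    fix x assume "x \<in> T"
    then obtain t where t: "0 \<le> t" "t \<le> 1" "x + t *\<^sub>R z \<in> E" using T(2) unfolding tube_def by force
    define i where "i = nat \<lfloor>t * real J\<rfloor>"
    have tJ: "0 \<le> t * real J" "t * real J \<le> real J" using t J1 by (auto simp: mult_left_le_one_le)
    have i: "real i \<le> t * real J" "t * real J \<le> real i + 1" "i \<le> J"
    proof -
      show "real i \<le> t * real J" "t * real J \<le> real i + 1"
        unfolding i_def using tJ by linarith+
      then show "i \<le> J" using tJ by linarith
    qed
    have "\<bar>t - real i / real J\<bar> = \<bar>t * real J - real i\<bar> / real J"
      using J1 by (simp add: field_simps abs_if)
    also have "\<dots> \<le> 1 / real J" using i by (intro divide_right_mono) auto
    finally have a: "\<bar>real i / real J - t\<bar> \<le> 1 / real J" by (simp add: abs_minus_commute)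
    have "dist (x + t *\<^sub>R z) e0 \<le> D"
      using diameter_bounded_bound[OF E(1) t(3) e0] E(2) by linarith
    then have b: "norm (x + t *\<^sub>R z - e0) \<le> D" by (simp add: dist_norm)
    have "x - (e0 - (real i / real J) *\<^sub>R z) = (x + t *\<^sub>R z - e0) + (real i / real J - t) *\<^sub>R z"
      by (simp add: algebra_simps)
    then have "norm (x - (e0 - (real i / real J) *\<^sub>R z)) \<le> norm (x + t *\<^sub>R z - e0) + \<bar>real i / real J - t\<bar> * norm z"
      by (metis norm_scaleR norm_triangle_ineq)
    also have "\<bar>real i / real J - t\<bar> * norm z \<le> 1 / real J * norm z"
      using a by (intro mult_right_mono) auto
    finally have "norm (x - (e0 - (real i / real J) *\<^sub>R z)) \<le> 2 * D" using b zJ by simp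
    then show "x \<in> (\<Union>i\<in>{..J}. cball (e0 - (real i / real J) *\<^sub>R z) (2 * D))"
      using i(3) by (auto simp: dist_norm norm_minus_commute)
  qed
  then have "emeasure lborel T \<le> emeasure lborel (\<Union>i\<in>{..J}. cball (e0 - (real i / real J) *\<^sub>R z) (2 * D))"
    by (intro emeasure_mono) auto
  also have "\<dots> \<le> (\<Sum>i\<in>{..J}. emeasure lborel (cball (e0 - (real i / real J) *\<^sub>R z) (2 * D)))"
    by (intro emeasure_subadditive_finite) auto
  also have "\<dots> = of_nat (J + 1) * ennreal (?c * (2 * D) ^ ?d)"
    using D by (simp add: emeasure_cball)
  also have "\<dots> = ennreal (real (J + 1) * (?c * (2 * D) ^ ?d))"
    using D by (simp add: ennreal_mult ennreal_of_nat_eq_real_of_nat del: of_nat_add of_nat_Suc)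
  also have "\<dots> \<le> ennreal (3 * norm z / D * (?c * (2 * D) ^ ?d))"
  proof (intro ennreal_leI mult_right_mono)
    show "real (J + 1) \<le> 3 * norm z / D" using J zD by simp
  qed (use D in auto)
  also have "3 * norm z / D * (?c * (2 * D) ^ ?d) = 3 * ?c * 2 ^ ?d * norm z * D ^ (?d - 1)"
  proof -
    have "D ^ ?d = D * D ^ (?d - 1)" by (metis DIM_positive power_eq_if less_numeral_extra(3))
    then show ?thesis using D by (simp add: power_mult_distrib)
  qed
  finally show ?thesis .
qed

lemma compact_tube:
  fixes B :: "'a::euclidean_space set"
  assumes "compact B"
  shows "compact (tube B z)"
proof -
  have "tube B z = (\<lambda>(e, t). e - t *\<^sub>R z) ` (B \<times> {0..1})"
  proof (intro set_eqI iffI)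
    fix x assume "x \<in> tube B z"
    then obtain t where t: "t \<in> {0..1}" "x + t *\<^sub>R z \<in> B" by (auto simp: tube_def)
    then have "x = (\<lambda>(e, t). e - t *\<^sub>R z) (x + t *\<^sub>R z, t)" by simp
    then show "x \<in> (\<lambda>(e, t). e - t *\<^sub>R z) ` (B \<times> {0..1})" using t by blast
  next
    fix x assume "x \<in> (\<lambda>(e, t). e - t *\<^sub>R z) ` (B \<times> {0..1})"
    then obtain e t where "e \<in> B" "t \<in> {0..1}" "x = e - t *\<^sub>R z" by auto
    then show "x \<in> tube B z" unfolding tube_def by (auto intro!: bexI[of _ t])
  qed
  also have "compact \<dots>"
    using assms by (intro compact_continuous_image compact_Times continuous_intros) (auto simp: case_prod_unfold intro!: continuous_intros)
  finally show ?thesis .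
qed

text \<open>The closure makes the tube compact and hence measurable, at the same diameter. If the diameter
  is \<open>0\<close>, the previous bound is available for every positive \<open>D\<close> only, and one lets \<open>D\<close> tend to
  \<open>0\<close>; in dimension one the limit is not \<open>0\<close>, in accordance with the weight \<open>1\<close> of a point.\<close>

lemma tube_emeasure_le_weight:
  fixes E :: "'a::euclidean_space set" and z :: 'a
  assumes E: "bounded E" "diameter E \<le> norm z" and z: "z \<noteq> 0"
  shows "emeasure lborel (tube (closure E) z)
       \<le> ennreal (3 * unit_ball_vol (real DIM('a)) * 2 ^ DIM('a) * 2 ^ (DIM('a) - 1)
            / unit_ball_vol (real (DIM('a) - 1)) * norm z) * hausdorff_weight (DIM('a) - 1) E"
proof (cases "E = {}")
  case True
  then show ?thesis by simp
next
  case False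
  let ?T = "tube (closure E) z"
  let ?d = "DIM('a)" and ?A = "3 * unit_ball_vol (real DIM('a)) * 2 ^ DIM('a) * norm z"
  have T: "?T \<in> sets borel"
    using compact_tube[of "closure E"] E(1) by (auto intro!: borel_compact)
  have bE: "bounded (closure E)" "diameter (closure E) = diameter E"
    using E(1) by (auto simp: diameter_closure)
  have le: "emeasure lborel ?T \<le> ennreal (?A * D ^ (?d - 1))" if "diameter E \<le> D" "0 < D" "D \<le> norm z" for D
    using tube_emeasure_le[of "closure E" D z ?T] that bE T by auto
  have diam0: "diameter E \<ge> 0" by (rule diameter_ge_0[OF E(1)])
  have "emeasure lborel ?T \<le> ennreal (?A * diameter E ^ (?d - 1))"
  proof (cases "diameter E = 0")
    case False
    then show ?thesis using diam0 E(2) by (intro le) auto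
  next
    case True
    have "(\<lambda>n. norm z / real (Suc n)) \<longlonglongrightarrow> 0"
      by (intro LIMSEQ_Suc lim_const_over_n)
    then have lim: "(\<lambda>n. ennreal (?A * (norm z / real (Suc n)) ^ (?d - 1))) \<longlonglongrightarrow> ennreal (?A * 0 ^ (?d - 1))"
      by (intro tendsto_ennrealI tendsto_mult tendsto_const tendsto_power)
    show ?thesis unfolding True
    proof (rule LIMSEQ_le_const[OF lim], intro exI allI impI)
      fix n :: nat
      show "emeasure lborel ?T \<le> ennreal (?A * (norm z / real (Suc n)) ^ (?d - 1))"
        using True z by (intro le) (auto simp: field_simps)
    qed
  qed
  also have "\<dots> = ennreal (?A * 2 ^ (?d - 1) / unit_ball_vol (real (?d - 1))) * hausdorff_weight (?d - 1) E"
  proof -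
    have v: "unit_ball_vol (real (?d - 1)) > 0" by (intro unit_ball_vol_pos) simp
    have "?A * diameter E ^ (?d - 1)
       = (?A * 2 ^ (?d - 1) / unit_ball_vol (real (?d - 1))) * (unit_ball_vol (real (?d - 1)) * (diameter E / 2) ^ (?d - 1))"
      using less_imp_neq[OF v] by (simp add: power_divide)
    also have "ennreal \<dots> = ennreal (?A * 2 ^ (?d - 1) / unit_ball_vol (real (?d - 1)))
        * ennreal (unit_ball_vol (real (?d - 1)) * (diameter E / 2) ^ (?d - 1))"
      by (rule ennreal_mult') (use diam0 v in auto)
    finally show ?thesis using False by (simp add: hausdorff_weight_def)
  qed
  finally show ?thesis by (simp add: mult.commute mult.left_commute)
qed

text \<open>Covers at scale \<open>\<bar>z\<bar>\<close> suffice. The case \<open>z = 0\<close>, which says that \<open>B\<close> is a null set, follows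
  because \<open>B\<close> lies in every tube over it.\<close>

lemma tube_emeasure_hausdorff:
  fixes B :: "'a::euclidean_space set"
  assumes "compact B" and H: "hausdorff_measure (DIM('a) - 1) B < \<infinity>"
  obtains K where "K \<ge> 0"
    "\<And>z. emeasure lborel (tube B z) \<le> ennreal (K * norm z)"
proof -
  let ?d = "DIM('a)"
  define A where "A = 3 * unit_ball_vol (real ?d) * 2 ^ ?d * 2 ^ (?d - 1) / unit_ball_vol (real (?d - 1))"
  define h where "h = enn2real (hausdorff_measure (?d - 1) B) + 1"
  have hH: "hausdorff_measure (?d - 1) B < ennreal h"
    unfolding h_def using H by (metis add_strict_increasing enn2real_nonneg ennreal_enn2real ennreal_less_iff
        infinity_ennreal_def less_add_one order.strict_implies_order)
  have h0: "h \<ge> 0" by (simp add: h_def)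
  have A0: "A \<ge> 0" by (simp add: A_def)
  have bound: "emeasure lborel (tube B z) \<le> ennreal (A * h * norm z)" if z: "z \<noteq> 0" for z :: 'a
  proof -
    have "hausdorff_premeasure (?d - 1) (norm z) B \<le> hausdorff_measure (?d - 1) B"
      unfolding hausdorff_measure_def using z by (intro SUP_upper) auto
    then have "hausdorff_premeasure (?d - 1) (norm z) B < ennreal h" using hH by (rule le_less_trans)
    then obtain E where E: "B \<subseteq> (\<Union>i. E i)" "\<And>i. bounded (E i)" "\<And>i. diameter (E i) \<le> norm z"
      and sE: "(\<Sum>i. hausdorff_weight (?d - 1) (E i)) < ennreal h"
      unfolding hausdorff_premeasure_def INF_less_iff by blast
    let ?T = "\<lambda>i. tube (closure (E i)) z"
    have mT: "?T i \<in> sets lborel" for i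
      using compact_tube[of "closure (E i)"] E(2)[of i] by (auto intro!: borel_compact)
    have "tube B z \<subseteq> (\<Union>i. ?T i)"
    proof -
      have "tube B z \<subseteq> (\<Union>i. tube (E i) z)" unfolding tube_UN[symmetric] by (rule tube_mono[OF E(1)])
      also have "\<dots> \<subseteq> (\<Union>i. ?T i)" by (intro UN_mono tube_mono closure_subset subset_refl)
      finally show ?thesis .
    qed
    then have "emeasure lborel (tube B z) \<le> emeasure lborel (\<Union>i. ?T i)"
      using mT by (intro emeasure_mono) auto
    also have "\<dots> \<le> (\<Sum>i. emeasure lborel (?T i))"
      using mT by (intro emeasure_subadditive_countably) auto
    also have "\<dots> \<le> (\<Sum>i. ennreal (A * norm z) * hausdorff_weight (?d - 1) (E i))"
      using tube_emeasure_le_weight[OF E(2,3) z] unfolding A_def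
      by (intro suminf_le) (auto simp: mult.commute mult.left_commute)
    also have "\<dots> = ennreal (A * norm z) * (\<Sum>i. hausdorff_weight (?d - 1) (E i))" by simp
    also have "\<dots> \<le> ennreal (A * norm z) * ennreal h" using sE by (intro mult_left_mono) auto
    also have "\<dots> = ennreal (A * h * norm z)"
      using h0 by (subst ennreal_mult''[symmetric]) (auto simp: ac_simps)
    finally show ?thesis .
  qed
  have "emeasure lborel (tube B z) \<le> ennreal (A * h * norm z)" for z :: 'a
  proof (cases "z = 0")
    case False
    then show ?thesis by (rule bound)
  next
    case True
    obtain b :: 'a where b: "b \<in> Basis" by (meson nonempty_Basis ex_in_conv)
    have lim: "(\<lambda>n. ennreal (A * h * (1 / real (Suc n)))) \<longlonglongrightarrow> ennreal (A * h * 0)"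
      by (intro tendsto_ennrealI tendsto_mult tendsto_const LIMSEQ_Suc lim_const_over_n)
    have "emeasure lborel (tube B z) \<le> ennreal (A * h * 0)"
    proof (rule LIMSEQ_le_const[OF lim], intro exI allI impI)
      fix n :: nat
      let ?z = "(1 / real (Suc n)) *\<^sub>R b"
      have nz: "norm ?z = 1 / real (Suc n)" using b by simp
      have "emeasure lborel (tube B z)
         \<le> emeasure lborel (tube B ?z)"
      proof (intro emeasure_mono)
        show "tube B z \<subseteq> tube B ?z" unfolding True by (rule tube_zero_subset)
        show "tube B ?z \<in> sets lborel"
          using borel_compact[OF compact_tube[OF assms(1), of ?z]] by (simp only: sets_lborel)
      qed
      also have "\<dots> \<le> ennreal (A * h * norm ?z)"
        using nz by (intro bound) auto
      finally show "emeasure lborel (tube B z) \<le> ennreal (A * h * (1 / real (Suc n)))"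
        unfolding nz .
    qed
    then show ?thesis using True by simp
  qed
  with that[of "A * h"] A0 h0 show ?thesis by auto
qed

text \<open>For \<open>\<sigma> > 1\<close> the first derivatives are Hoelder continuous on a bounded set, hence bounded, and
  the mean value theorem applies. As \<open>\<Omega>\<close> need not be convex, it does so only along segments inside
  \<open>\<Omega>\<close>.\<close>

lemma holder_segment:
  fixes g :: "'a::euclidean_space \<Rightarrow> real"
  assumes \<sigma>: "0 < \<sigma>" "\<sigma> \<le> 2" and hol: "holder_continuous_on \<sigma> g \<Omega>" and \<Omega>: "bounded \<Omega>"
  obtains L where "L \<ge> 0"
    "\<And>x z. closed_segment x (x + z) \<subseteq> \<Omega> \<Longrightarrow> \<bar>g (x + z) - g x\<bar> \<le> L * norm z powr (min \<sigma> 1)"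
proof -
  obtain L where L: "\<bar>iter_partial bs g y - iter_partial bs g z\<bar> / norm (y - z) powr (\<sigma> - real (holder_order \<sigma>)) \<le> L"
    if "set bs \<subseteq> Basis" "length bs = holder_order \<sigma>" "y \<in> \<Omega>" "z \<in> \<Omega>" "y \<noteq> z" for bs y z
    using hol unfolding holder_continuous_on_def bdd_above_def by blast
  show ?thesis
  proof (cases "\<sigma> \<le> 1")
    case True
    then have o: "holder_order \<sigma> = 0" using \<sigma> unfolding holder_order_def by linarith
    have *: "\<bar>g y - g z\<bar> / norm (y - z) powr \<sigma> \<le> L" if "y \<in> \<Omega>" "z \<in> \<Omega>" "y \<noteq> z" for y z
      using L[of "[]" y z] that by (simp add: o)
    show ?thesis
    proof (rule that[of "max L 0"])
      fix x z assume seg: "closed_segment x (x + z) \<subseteq> \<Omega>"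
      then have in\<Omega>: "x + z \<in> \<Omega>" "x \<in> \<Omega>" by auto
      show "\<bar>g (x + z) - g x\<bar> \<le> max L 0 * norm z powr (min \<sigma> 1)"
      proof (cases "z = 0")
        case False
        then have "\<bar>g (x + z) - g x\<bar> / norm z powr \<sigma> \<le> L" using *[OF in\<Omega>] by simp
        then have "\<bar>g (x + z) - g x\<bar> \<le> L * norm z powr \<sigma>" using False by (simp add: divide_le_eq)
        also have "\<dots> \<le> max L 0 * norm z powr \<sigma>" by (intro mult_right_mono) auto
        finally show ?thesis using True by (simp add: min_def)
      qed simp
    qed simp
  next
    case False
    then have o: "holder_order \<sigma> = 1" using \<sigma> unfolding holder_order_def by linarith
    have diff: "g differentiable (at x)" if "x \<in> \<Omega>" for x
      using hol that by (simp add: holder_continuous_on_def o)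
    have *: "\<bar>partial_deriv b g y - partial_deriv b g z\<bar> / norm (y - z) powr (\<sigma> - 1) \<le> L"
      if "y \<in> \<Omega>" "z \<in> \<Omega>" "y \<noteq> z" "b \<in> Basis" for y z b
      using L[of "[b]" y z] that by (simp add: o)
    define D where "D = diameter \<Omega>"
    define L' where "L' = max L 0"
    show ?thesis
    proof (cases "\<Omega> = {}")
      case True
      show ?thesis by (rule that[of 0]) (use True in auto)
    next
      case False
      then obtain w where w: "w \<in> \<Omega>" by auto
      define Mb where "Mb b = \<bar>partial_deriv b g w\<bar> + L' * D powr (\<sigma> - 1)" for b
      have Mb: "\<bar>partial_deriv b g y\<bar> \<le> Mb b" if "y \<in> \<Omega>" "b \<in> Basis" for y b
      proof (cases "y = w")
        case True
        then show ?thesis by (simp add: Mb_def L'_def)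
      next
        case False
        then have "\<bar>partial_deriv b g y - partial_deriv b g w\<bar> \<le> L * norm (y - w) powr (\<sigma> - 1)"
          using *[OF that(1) w False that(2)] by (simp add: divide_le_eq)
        also have "\<dots> \<le> L' * norm (y - w) powr (\<sigma> - 1)" by (intro mult_right_mono) (auto simp: L'_def)
        also have "\<dots> \<le> L' * D powr (\<sigma> - 1)"
          using diameter_bounded_bound[OF \<Omega> that(1) w] \<open>\<not> \<sigma> \<le> 1\<close>
          by (intro mult_left_mono powr_mono2) (auto simp: D_def dist_norm L'_def)
        finally show ?thesis by (simp add: Mb_def)
      qed
      define M where "M = (\<Sum>b\<in>(Basis::'a set). Mb b)"
      have M0: "M \<ge> 0" unfolding M_def by (intro sum_nonneg) (auto simp: Mb_def L'_def)
      show ?thesis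
      proof (rule that[OF M0])
        fix x z :: 'a assume seg: "closed_segment x (x + z) \<subseteq> \<Omega>"
        have "norm (g (x + z) - g x) \<le> M * norm (x + z - x)"
        proof (rule differentiable_bound[where S="closed_segment x (x + z)" and f'="\<lambda>y. frechet_derivative g (at y)"])
          fix y assume "y \<in> closed_segment x (x + z)"
          then have y: "y \<in> \<Omega>" using seg by auto
          have d: "(g has_derivative frechet_derivative g (at y)) (at y)"
            using diff[OF y] frechet_derivative_works by blast
          then show "(g has_derivative frechet_derivative g (at y)) (at y within closed_segment x (x + z))"
            by (rule has_derivative_at_withinI)
          interpret bl: bounded_linear "frechet_derivative g (at y)" using d by (rule has_derivative_bounded_linear)
          show "onorm (frechet_derivative g (at y)) \<le> M"
          proof (rule onorm_le)
            fix v
            have "frechet_derivative g (at y) v = frechet_derivative g (at y) (\<Sum>b\<in>Basis. (v \<bullet> b) *\<^sub>R b)"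
              by (simp add: euclidean_representation)
            also have "\<dots> = (\<Sum>b\<in>Basis. (v \<bullet> b) * frechet_derivative g (at y) b)"
              by (simp add: bl.sum bl.scaleR)
            also have "norm \<dots> \<le> (\<Sum>b\<in>Basis. norm ((v \<bullet> b) * frechet_derivative g (at y) b))"
              by (rule norm_sum)
            also have "\<dots> \<le> (\<Sum>b\<in>Basis. norm v * Mb b)"
            proof (intro sum_mono)
              fix b :: 'a assume b: "b \<in> Basis"
              show "norm ((v \<bullet> b) * frechet_derivative g (at y) b) \<le> norm v * Mb b"
                using Mb[OF y b] Basis_le_norm[OF b, of v]
                by (auto simp: abs_mult partial_deriv_def intro!: mult_mono)
            qed
            also have "\<dots> = M * norm v" by (simp add: M_def sum_distrib_left mult.commute sum_distrib_right)
            finally show "norm (frechet_derivative g (at y) v) \<le> M * norm v" .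
          qed
        qed auto
        then show "\<bar>g (x + z) - g x\<bar> \<le> M * norm z powr (min \<sigma> 1)" using \<open>\<not> \<sigma> \<le> 1\<close> by (cases "z = 0") (auto simp: min_def)
      qed
    qed
  qed
qed

section \<open>Regular densities: ball masses and translation modulus\<close>

lemma emeasure_prob_of:
  assumes "prob_density g" "A \<in> sets borel"
  shows "emeasure (prob_of g) A = (\<integral>\<^sup>+x. ennreal (g x) * indicator A x \<partial>lborel)"
  using assms by (simp add: prob_of_def emeasure_density prob_density_def)

lemma sets_prob_of [measurable_cong, simp]: "sets (prob_of g) = sets borel"
  by (simp add: prob_of_def)

lemma space_prob_of [simp]: "space (prob_of g) = UNIV"
  by (simp add: prob_of_def)

lemma prob_space_prob_of: "prob_density g \<Longrightarrow> prob_space (prob_of g)"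
  by (rule prob_spaceI) (simp add: emeasure_prob_of prob_density_def)

definition ballmass :: "('a::euclidean_space \<Rightarrow> real) \<Rightarrow> 'a \<Rightarrow> real \<Rightarrow> real" where
  "ballmass g x r = measure (prob_of g) (ball x r)"

lemma ballmass_bounds:
  assumes "prob_density g" shows "0 \<le> ballmass g x r" "ballmass g x r \<le> 1"
proof -
  interpret prob_space "prob_of g" by (rule prob_space_prob_of[OF assms])
  show "0 \<le> ballmass g x r" "ballmass g x r \<le> 1" unfolding ballmass_def by simp_all
qed

lemma ennreal_ballmass:
  assumes "prob_density g"
  shows "ennreal (ballmass g x r) = (\<integral>\<^sup>+y. ennreal (g y) * indicator (ball x r) y \<partial>lborel)"
proof -
  interpret prob_space "prob_of g" by (rule prob_space_prob_of[OF assms])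
  show ?thesis
    unfolding ballmass_def by (subst emeasure_prob_of[OF assms, symmetric]) (auto simp: emeasure_eq_measure)
qed

lemma ballmass_borel [measurable]:
  fixes g :: "'a::euclidean_space \<Rightarrow> real"
  assumes g: "prob_density g"
  shows "(\<lambda>(x, r). ballmass g x r) \<in> borel_measurable (borel \<Otimes>\<^sub>M borel)"
proof -
  have [measurable]: "g \<in> borel_measurable borel" using g by (simp add: prob_density_def)
  have "(\<lambda>(x, r). ballmass g x r) = (\<lambda>w. enn2real (\<integral>\<^sup>+y. ennreal (g y) * (if dist (fst w) y < snd w then 1 else 0) \<partial>lborel))"
  proof
    fix w :: "'a \<times> real"
    have "(\<integral>\<^sup>+y. ennreal (g y) * (if dist (fst w) y < snd w then 1 else 0) \<partial>lborel) = ennreal (ballmass g (fst w) (snd w))"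
      unfolding ennreal_ballmass[OF g] by (intro nn_integral_cong) (auto simp: indicator_def)
    then show "(\<lambda>(x, r). ballmass g x r) w = enn2real (\<integral>\<^sup>+y. ennreal (g y) * (if dist (fst w) y < snd w then 1 else 0) \<partial>lborel)"
      by (simp add: split_beta ballmass_bounds[OF g])
  qed
  also have "\<dots> \<in> borel_measurable (borel \<Otimes>\<^sub>M borel)"
    by measurable
  finally show ?thesis .
qed

lemma ballmass_measurable:
  assumes "prob_density g" "f \<in> measurable M borel" "h \<in> borel_measurable M"
  shows "(\<lambda>w. ballmass g (f w) (h w)) \<in> borel_measurable M"
  using measurable_compose[OF measurable_Pair[OF assms(2,3)] ballmass_borel[OF assms(1)]] by simp

lemma closed_supp: "closed (supp g)"
proof -
  have "open (- supp g)"
  proof (rule openI)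
    fix x assume "x \<in> - supp g"
    then obtain r where r: "r > 0" "emeasure (prob_of g) (ball x r) = 0"
      by (auto simp: supp_def zero_less_iff_neq_zero)
    have "ball x r \<subseteq> - supp g"
    proof
      fix y assume y: "y \<in> ball x r"
      have "emeasure (prob_of g) (ball y (r - dist x y)) \<le> emeasure (prob_of g) (ball x r)"
      proof (intro emeasure_mono)
        show "ball y (r - dist x y) \<subseteq> ball x r"
          by (auto simp: ) (metis dist_triangle_lt dist_commute add.commute less_diff_eq)
      qed auto
      then have "emeasure (prob_of g) (ball y (r - dist x y)) = 0" using r by simp
      moreover have "r - dist x y > 0" using y by simp
      ultimately show "y \<in> - supp g" unfolding supp_def by (auto intro!: exI[of _ "r - dist x y"])
    qed
    with r show "\<exists>e>0. ball x e \<subseteq> - supp g" by blast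
  qed
  then show ?thesis by (simp add: closed_def)
qed

lemma supp_borel [measurable, simp]: "supp g \<in> sets borel"
  by (rule borel_closed[OF closed_supp])

text \<open>The complement of the support is covered by open null balls, and by Lindelof's theorem countably
  many of them suffice.\<close>

lemma AE_outside_supp:
  fixes g :: "'a::euclidean_space \<Rightarrow> real"
  assumes g: "prob_density g"
  shows "AE x in lborel. x \<notin> supp g \<longrightarrow> g x = 0"
proof -
  have [measurable]: "g \<in> borel_measurable borel" using g by (simp add: prob_density_def)
  define F where "F = {B. \<exists>x r. r > 0 \<and> B = ball x r \<and> emeasure (prob_of g) (ball x r) = 0}"
  have "\<And>S. S \<in> F \<Longrightarrow> open S" by (auto simp: F_def)
  from Lindelof[OF this] obtain F' where F': "F' \<subseteq> F" "countable F'" "\<Union>F' = \<Union>F" by blast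
  have sub: "- supp g \<subseteq> \<Union>F"
  proof
    fix x assume "x \<in> - supp g"
    then obtain r where r: "r > 0" "emeasure (prob_of g) (ball x r) = 0"
      by (auto simp: supp_def zero_less_iff_neq_zero)
    then have "ball x r \<in> F" by (auto simp: F_def)
    then show "x \<in> \<Union>F" using r by (metis Union_iff centre_in_ball)
  qed
  have "(\<Union>B\<in>F'. B) \<in> null_sets (prob_of g)"
    using F'(1,2) by (intro null_sets_UN') (auto simp: F_def null_sets_def)
  then have "\<Union>F \<in> null_sets (prob_of g)" using F'(3) by simp
  then have "AE x in prob_of g. x \<notin> \<Union>F" by (rule AE_not_in)
  then have "AE x in lborel. 0 < ennreal (g x) \<longrightarrow> x \<notin> \<Union>F"
    unfolding prob_of_def by (subst (asm) AE_density) auto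
  then show ?thesis
    using sub g by (elim AE_mp) (auto intro!: AE_I2 simp: prob_density_def intro: antisym)
qed

lemma AE_lborel_translate:
  fixes z :: "'a::euclidean_space"
  assumes "AE x in lborel. P x" and [measurable]: "Measurable.pred borel P"
  shows "AE x in lborel. P (x + z)"
proof -
  have "AE x in distr lborel borel ((+) z). P x"
    unfolding lborel_distr_plus by (rule assms)
  then have "AE x in lborel. P (z + x)" by (subst (asm) AE_distr_iff) auto
  then show ?thesis by (simp add: add.commute)
qed

lemma nn_integral_lborel_translate:
  fixes z :: "'a::euclidean_space"
  assumes [measurable]: "h \<in> borel_measurable borel"
  shows "(\<integral>\<^sup>+x. h (z + x) \<partial>lborel) = (\<integral>\<^sup>+x. h x \<partial>lborel)"
proof -
  have "(\<integral>\<^sup>+x. h x \<partial>lborel) = (\<integral>\<^sup>+x. h x \<partial>distr lborel borel ((+) z))"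
    by (simp add: lborel_distr_plus)
  also have "\<dots> = (\<integral>\<^sup>+x. h (z + x) \<partial>lborel)" by (subst nn_integral_distr) auto
  finally show ?thesis ..
qed

text \<open>What the comparison of kernels uses of a regular density with support \<open>S\<close>. The constant \<open>c\<close>
  bounds from below both the density and the mean density of balls centred in \<open>S\<close> which have a point
  of \<open>S\<close> on their boundary.\<close>

locale tame_density =
  fixes g :: "'a::euclidean_space \<Rightarrow> real" and S :: "'a set" and c C K s :: real
  assumes dens: "prob_density g"
    and S_borel: "S \<in> sets borel" and S_fin: "emeasure lborel S < \<infinity>"
    and g_upper: "AE x in lborel. g x \<le> C"
    and c_pos: "0 < c" and C_pos: "0 < C" and g_lower: "\<And>x. x \<in> S \<Longrightarrow> c \<le> g x"
    and g_outside: "AE x in lborel. x \<notin> S \<longrightarrow> g x = 0"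
    and ballmass_lower: "\<And>x z. x \<in> S \<Longrightarrow> x + z \<in> S \<Longrightarrow> c * bvol z \<le> ballmass g x (norm z)"
    and K_nonneg: "0 \<le> K" and s_pos: "0 < s" and s_le: "s \<le> 1"
    and modulus: "\<And>z. (\<integral>\<^sup>+x. ennreal \<bar>g (x + z) - g x\<bar> * indicator S x \<partial>lborel) \<le> ennreal (K * norm z powr s)"

text \<open>The ball condition controls radii up to some \<open>r\<close>. A larger radius \<open>\<bar>z\<bar>\<close> with both ends in the
  support is bounded by the diameter of the support, so that the mass of the ball of radius \<open>r\<close>
  already exceeds a multiple of the volume.\<close>

lemma regular_density_ballmass_lower:
  fixes g :: "'a::euclidean_space \<Rightarrow> real"
  assumes g: "prob_density g" and reg: "regular_density \<sigma> g"
  obtains c where "0 < c" "\<And>x. x \<in> supp g \<Longrightarrow> c \<le> g x"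
    "\<And>x z. x \<in> supp g \<Longrightarrow> x + z \<in> supp g \<Longrightarrow> c * bvol z \<le> ballmass g x (norm z)"
proof -
  interpret prob_space "prob_of g" by (rule prob_space_prob_of[OF g])
  have [measurable]: "g \<in> borel_measurable borel" using g by (simp add: prob_density_def)
  let ?S = "supp g"
  obtain c0 where c0: "c0 > 0" "\<And>x. x \<in> ?S \<Longrightarrow> c0 \<le> g x"
    using reg unfolding regular_density_def by blast
  let ?q = "\<lambda>x r'. measure lborel (ball x r' \<inter> ?S) / measure lborel (ball x r')"
  obtain r where r: "r > 0" "0 < (INF x\<in>?S. INF r'\<in>{0<..r}. ?q x r')"
    using reg unfolding regular_density_def by blast
  define \<eta> where "\<eta> = (INF x\<in>?S. INF r'\<in>{0<..r}. ?q x r')"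
  have \<eta>0: "\<eta> > 0" using r by (simp add: \<eta>_def)
  have \<eta>: "\<eta> \<le> ?q x r'" if "x \<in> ?S" "0 < r'" "r' \<le> r" for x r'
  proof -
    have "\<eta> \<le> (INF r'\<in>{0<..r}. ?q x r')" unfolding \<eta>_def
    proof (rule cINF_lower[OF _ that(1)], rule bdd_belowI2[where m=0])
      fix x show "0 \<le> (INF r'\<in>{0<..r}. ?q x r')"
        using r by (intro cINF_greatest) auto
    qed
    also have "\<dots> \<le> ?q x r'"
      using that by (intro cINF_lower bdd_belowI2[where m=0]) auto
    finally show ?thesis .
  qed
  have low: "c0 * measure lborel (ball x r' \<inter> ?S) \<le> ballmass g x r'" for x r'
  proof -
    have "emeasure lborel (ball x r' \<inter> ?S) \<le> emeasure lborel (ball x r')" by (intro emeasure_mono) auto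
    also have "\<dots> < \<infinity>" by (rule emeasure_bounded_finite[OF bounded_ball])
    finally have fin: "emeasure lborel (ball x r' \<inter> ?S) \<noteq> \<infinity>" by simp
    have "ennreal (c0 * measure lborel (ball x r' \<inter> ?S)) = ennreal c0 * emeasure lborel (ball x r' \<inter> ?S)"
      using c0 fin by (simp add: ennreal_mult' emeasure_eq_ennreal_measure)
    also have "\<dots> = (\<integral>\<^sup>+y. ennreal c0 * indicator (ball x r' \<inter> ?S) y \<partial>lborel)"
      by (simp add: nn_integral_cmult_indicator)
    also have "\<dots> \<le> (\<integral>\<^sup>+y. ennreal (g y) * indicator (ball x r') y \<partial>lborel)"
      using c0 by (intro nn_integral_mono) (auto simp: indicator_def intro: ennreal_leI)
    also have "\<dots> = ennreal (ballmass g x r')" by (simp add: ennreal_ballmass[OF g])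
    finally show ?thesis using ballmass_bounds[OF g] by simp
  qed
  have low2: "c0 * \<eta> * measure lborel (ball x r') \<le> ballmass g x r'" if "x \<in> ?S" "0 < r'" "r' \<le> r" for x r'
  proof -
    have "measure lborel (ball x r') > 0" using that by (simp add: content_ball_pos)
    then have "\<eta> * measure lborel (ball x r') \<le> measure lborel (ball x r' \<inter> ?S)"
      using \<eta>[OF that] by (simp add: pos_le_divide_eq)
    then have "c0 * (\<eta> * measure lborel (ball x r')) \<le> c0 * measure lborel (ball x r' \<inter> ?S)"
      using c0 by (intro mult_left_mono) auto
    with low[of x r'] show ?thesis by (simp add: mult.assoc)
  qed
  have bS: "bounded ?S" using reg by (simp add: regular_density_def)
  \<comment> \<open>Adding 1 merely makes \<open>R\<close> positive.\<close>
  define R where "R = diameter ?S + 1"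
  have R: "R > 0" using diameter_ge_0[OF bS] by (simp add: R_def)
  let ?v = "\<lambda>\<rho>. unit_ball_vol (real DIM('a)) * \<rho> ^ DIM('a)"
  have vpos: "?v \<rho> > 0" if "\<rho> > 0" for \<rho> using that by simp
  define c where "c = Min {c0, c0 * \<eta>, c0 * \<eta> * (?v r / ?v R)}"
  have cle: "c \<le> c0" "c \<le> c0 * \<eta>" "c \<le> c0 * \<eta> * (?v r / ?v R)" by (auto simp: c_def)
  have ub: "unit_ball_vol (real DIM('a)) \<noteq> 0"
    by (metis less_irrefl unit_ball_vol_pos of_nat_0_le_iff)
  have cpos: "c > 0" unfolding c_def using c0 \<eta>0 r R ub by simp
  show ?thesis
  proof (rule that[OF cpos])
    show "c \<le> g x" if "x \<in> ?S" for x using c0(2)[OF that] cle by linarith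
    fix x z assume xz: "x \<in> ?S" "x + z \<in> ?S"
    show "c * bvol z \<le> ballmass g x (norm z)"
    proof (cases "z = 0")
      case True
      then have "bvol z = 0" by (simp add: bvol_def power_0_left)
      then show ?thesis using ballmass_bounds[OF g] by simp
    next
      case False
      show ?thesis
      proof (cases "norm z \<le> r")
        case True
        have "c * bvol z \<le> c0 * \<eta> * bvol z" using cle by (intro mult_right_mono bvol_nonneg) auto
        also have "\<dots> \<le> ballmass g x (norm z)"
          using low2[OF xz(1), of "norm z"] True False by (simp add: measure_ball_bvol)
        finally show ?thesis .
      next
        case nr: False
        have "norm z \<le> R"
          using diameter_bounded_bound[OF bS xz] by (simp add: R_def dist_norm)
        then have "bvol z \<le> ?v R" unfolding bvol_def by (intro mult_left_mono power_mono) auto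
        then have "c * bvol z \<le> c0 * \<eta> * (?v r / ?v R) * ?v R"
          using cle cpos by (intro mult_mono) (auto intro: bvol_nonneg order_trans)
        also have "\<dots> = c0 * \<eta> * ?v r" using ub R by simp
        also have "\<dots> \<le> ballmass g x r"
          using low2[OF xz(1), of r] r by (simp add: content_ball)
        also have "\<dots> \<le> ballmass g x (norm z)"
          unfolding ballmass_def using nr by (intro finite_measure_mono) auto
        finally show ?thesis .
      qed
    qed
  qed
qed

text \<open>If the segment from \<open>x\<close> to \<open>x + z\<close> misses the boundary of the support, it stays in the
  interior. The remaining \<open>x\<close> form a tube, on which the difference is at most the essential bound of
  \<open>g\<close>. The tube has volume at most \<open>min (K \<bar>z\<bar>) V\<close> with the volume \<open>V\<close> of the support, which is
  bounded by a multiple of \<open>\<bar>z\<bar> powr s\<close> for small and for large \<open>z\<close>.\<close>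

lemma regular_density_modulus:
  fixes g :: "'a::euclidean_space \<Rightarrow> real"
  assumes g: "prob_density g" and reg: "regular_density \<sigma> g"
  obtains K where "0 \<le> K"
    "\<And>z. (\<integral>\<^sup>+x. ennreal \<bar>g (x + z) - g x\<bar> * indicator (supp g) x \<partial>lborel) \<le> ennreal (K * norm z powr (min \<sigma> 1))"
proof -
  have [measurable]: "g \<in> borel_measurable borel" using g by (simp add: prob_density_def)
  let ?S = "supp g" and ?s = "min \<sigma> 1"
  have g0: "\<And>x. 0 \<le> g x" using g by (simp add: prob_density_def)
  obtain C where C: "C > 0" "AE x in lborel. g x \<le> C"
    using reg unfolding regular_density_def by blast
  have bS: "bounded ?S" and \<sigma>: "0 < \<sigma>" "\<sigma> \<le> 2" and hol: "holder_continuous_on \<sigma> g (interior ?S)"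
    and H: "hausdorff_measure (DIM('a) - 1) (frontier ?S) < \<infinity>"
    using reg unfolding regular_density_def by blast+
  have cS: "compact ?S" using bS closed_supp by (simp add: compact_eq_bounded_closed)
  obtain L where L: "L \<ge> 0"
    "\<And>x z. closed_segment x (x + z) \<subseteq> interior ?S \<Longrightarrow> \<bar>g (x + z) - g x\<bar> \<le> L * norm z powr ?s"
    using holder_segment[OF \<sigma> hol bounded_interior[OF bS]] by blast
  obtain K where K: "K \<ge> 0"
    "\<And>z. emeasure lborel (tube (frontier ?S) z) \<le> ennreal (K * norm z)"
    using tube_emeasure_hausdorff[OF compact_frontier[OF cS] H] by blast
  define V where "V = measure lborel ?S"
  have V: "emeasure lborel ?S = ennreal V" "V \<ge> 0"
    unfolding V_def using emeasure_compact_finite[OF cS] by (auto simp: emeasure_eq_ennreal_measure)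
  define K' where "K' = L * V + C * (K + V)"
  show ?thesis
  proof (rule that[of K'])
    show "0 \<le> K'" using L K V C by (simp add: K'_def)
    fix z :: 'a
    let ?T = "tube (frontier ?S) z"
    have T [measurable]: "?T \<in> sets borel"
      using compact_tube[OF compact_frontier[OF cS], of z] by (auto intro!: borel_compact)
    have pt: "\<bar>g (x + z) - g x\<bar> \<le> L * norm z powr ?s" if x: "x \<in> ?S" "x \<notin> ?T" for x
    proof (rule L(2), rule ccontr)
      assume "\<not> closed_segment x (x + z) \<subseteq> interior ?S"
      then have "closed_segment x (x + z) - interior ?S \<noteq> {}" by auto
      moreover have fx: "x \<notin> frontier ?S" using x(2) unfolding tube_def by (auto dest: bspec[of _ _ 0])
      then have "x \<in> interior ?S" using x(1) closed_supp[of g] by (auto simp: frontier_def)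
      then have "closed_segment x (x + z) \<inter> interior ?S \<noteq> {}" by auto
      ultimately have "closed_segment x (x + z) \<inter> frontier (interior ?S) \<noteq> {}"
        by (intro connected_Int_frontier connected_segment)
      then obtain y where y: "y \<in> closed_segment x (x + z)" "y \<in> frontier ?S"
        using frontier_interior_subset by blast
      from y(1) obtain t where t: "0 \<le> t" "t \<le> 1" "y = (1 - t) *\<^sub>R x + t *\<^sub>R (x + z)" by (auto simp: closed_segment_def)
      then have "y = x + t *\<^sub>R z" by (simp add: algebra_simps)
      then show False using x(2) y(2) t unfolding tube_def by auto
    qed
    have "AE x in lborel. g (x + z) \<le> C"
      by (rule AE_lborel_translate[OF C(2)]) auto
    then have "AE x in lborel. ennreal \<bar>g (x + z) - g x\<bar> * indicator ?S x
       \<le> ennreal (L * norm z powr ?s) * indicator ?S x + ennreal C * indicator (?T \<inter> ?S) x"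
      using C(2)
    proof eventually_elim
      fix x assume le: "g (x + z) \<le> C" "g x \<le> C"
      have "\<bar>g (x + z) - g x\<bar> \<le> C" using le g0[of x] g0[of "x + z"] by linarith
      then show "ennreal \<bar>g (x + z) - g x\<bar> * indicator ?S x
       \<le> ennreal (L * norm z powr ?s) * indicator ?S x + ennreal C * indicator (?T \<inter> ?S) x"
        using pt[of x] by (cases "x \<in> ?S"; cases "x \<in> ?T") (auto intro!: ennreal_leI add_increasing)
    qed
    then have "(\<integral>\<^sup>+x. ennreal \<bar>g (x + z) - g x\<bar> * indicator ?S x \<partial>lborel)
      \<le> (\<integral>\<^sup>+x. ennreal (L * norm z powr ?s) * indicator ?S x + ennreal C * indicator (?T \<inter> ?S) x \<partial>lborel)"
      by (rule nn_integral_mono_AE)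
    also have "\<dots> = ennreal (L * norm z powr ?s) * emeasure lborel ?S + ennreal C * emeasure lborel (?T \<inter> ?S)"
      by (subst nn_integral_add) (auto simp: nn_integral_cmult_indicator)
    also have "\<dots> \<le> ennreal (L * norm z powr ?s) * ennreal V + ennreal C * ennreal ((K + V) * norm z powr ?s)"
    proof (intro add_mono mult_left_mono)
      show "emeasure lborel (?T \<inter> ?S) \<le> ennreal ((K + V) * norm z powr ?s)"
      proof (cases "norm z \<le> 1")
        case True
        have "emeasure lborel (?T \<inter> ?S) \<le> emeasure lborel ?T" by (intro emeasure_mono) auto
        also have "\<dots> \<le> ennreal (K * norm z)" by (rule K(2))
        also have "\<dots> \<le> ennreal ((K + V) * norm z powr ?s)"
        proof (intro ennreal_leI mult_mono)
          have "norm z powr 1 \<le> norm z powr ?s" using True by (intro powr_mono') auto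
          then show "norm z \<le> norm z powr ?s" by simp
        qed (use K V in auto)
        finally show ?thesis .
      next
        case False
        have "emeasure lborel (?T \<inter> ?S) \<le> emeasure lborel ?S" by (intro emeasure_mono) auto
        also have "\<dots> = ennreal (V * 1)" using V by simp
        also have "\<dots> \<le> ennreal ((K + V) * norm z powr ?s)"
          using False \<sigma> K V by (intro ennreal_leI mult_mono ge_one_powr_ge_zero) auto
        finally show ?thesis .
      qed
    qed (use V in auto)
    also have "\<dots> = ennreal (K' * norm z powr ?s)"
      using L V K C by (simp add: ennreal_mult[symmetric] K'_def algebra_simps flip: ennreal_plus)
    finally show "(\<integral>\<^sup>+x. ennreal \<bar>g (x + z) - g x\<bar> * indicator ?S x \<partial>lborel) \<le> ennreal (K' * norm z powr ?s)" .
  qed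
qed

lemma regular_imp_tame:
  fixes g :: "'a::euclidean_space \<Rightarrow> real"
  assumes g: "prob_density g" and reg: "regular_density \<sigma> g"
  obtains c C K where "tame_density g (supp g) c C K (min \<sigma> 1)"
proof -
  obtain c where c: "0 < c" "\<And>x. x \<in> supp g \<Longrightarrow> c \<le> g x"
    "\<And>x z. x \<in> supp g \<Longrightarrow> x + z \<in> supp g \<Longrightarrow> c * bvol z \<le> ballmass g x (norm z)"
    using regular_density_ballmass_lower[OF assms] by blast
  obtain K where K: "0 \<le> K"
    "\<And>z. (\<integral>\<^sup>+x. ennreal \<bar>g (x + z) - g x\<bar> * indicator (supp g) x \<partial>lborel) \<le> ennreal (K * norm z powr (min \<sigma> 1))"
    using regular_density_modulus[OF assms] by blast
  obtain C where C: "C > 0" "AE x in lborel. g x \<le> C" and bS: "bounded (supp g)" and \<sigma>: "\<sigma> > 0"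
    using reg unfolding regular_density_def by blast
  have cS: "compact (supp g)" using bS closed_supp by (simp add: compact_eq_bounded_closed)
  show ?thesis
    by (rule that[of c C K], unfold_locales)
       (use c K C \<sigma> g AE_outside_supp[OF g] emeasure_compact_finite[OF cS] in auto)
qed

lemma supp_mono_absolutely_continuous:
  assumes "absolutely_continuous (prob_of q) (prob_of p)"
  shows "supp p \<subseteq> supp q"
proof
  fix x assume x: "x \<in> supp p"
  have "emeasure (prob_of q) (ball x r) > 0" if r: "r > 0" for r
  proof (rule ccontr)
    assume "\<not> 0 < emeasure (prob_of q) (ball x r)"
    then have "ball x r \<in> null_sets (prob_of q)" by (auto simp: null_sets_def)
    then have "ball x r \<in> null_sets (prob_of p)" using assms by (auto simp: absolutely_continuous_def)
    then show False using x r by (auto simp: supp_def null_sets_def)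
  qed
  then show "x \<in> supp q" by (simp add: supp_def)
qed

section \<open>Nearest neighbour kernels and Gamma kernels\<close>

text \<open>Here \<open>P\<close> stands for the mass of a ball, \<open>\<tau>\<close> for its volume, and \<open>\<gamma>\<close> for the density at its
  centre. Both Poisson parameters \<open>N P\<close> and \<open>N \<gamma> \<tau>\<close> lie between \<open>c N \<tau>\<close> and \<open>C N \<tau>\<close>, so all weights
  are controlled by one Gamma weight; half of the rate pays for the polynomial factors.\<close>

lemma binom_pois_comparison:
  fixes c C :: real and k :: nat
  assumes c: "0 < c" "c \<le> C" and k: "k \<ge> 1"
  obtains A where "A \<ge> 0"
    "\<And>N P \<gamma> \<tau>. k \<le> N \<Longrightarrow> 0 < \<tau> \<Longrightarrow> 0 \<le> P \<Longrightarrow> P \<le> 1 \<Longrightarrow> c * \<tau> \<le> P \<Longrightarrow> P \<le> C * \<tau> \<Longrightarrow> c \<le> \<gamma> \<Longrightarrow> \<gamma> \<le> C \<Longrightarrow>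
       \<bar>binom_nn N k P - pois k (real N * \<gamma> * \<tau>)\<bar>
        \<le> A * gamma_weight k (c / 2) (real N * \<tau>) * (1 / real N + \<bar>P - \<gamma> * \<tau>\<bar> / \<tau>)"
    "\<And>N P \<tau>. k \<le> N \<Longrightarrow> 0 < \<tau> \<Longrightarrow> 0 \<le> P \<Longrightarrow> P \<le> 1 \<Longrightarrow> c * \<tau> \<le> P \<Longrightarrow> P \<le> C * \<tau> \<Longrightarrow>
       binom_nn N k P \<le> A * gamma_weight k (c / 2) (real N * \<tau>)"
    "\<And>N \<gamma> \<tau>. 0 \<le> \<tau> \<Longrightarrow> c \<le> \<gamma> \<Longrightarrow> \<gamma> \<le> C \<Longrightarrow>
       pois k (real N * \<gamma> * \<tau>) \<le> A * gamma_weight k (c / 2) (real N * \<tau>)"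
proof -
  define B where "B = 1 + 2 / c + 8 / c\<^sup>2"
  define A1 where "A1 = 2 * real k ^ 2 * exp (real k) * C ^ (k - 1) * (1 + C\<^sup>2) * B"
  define A2 where "A2 = real k * (C + 1) ^ k * B"
  define A3 where "A3 = (A1 + A2) * (1 + 2 * C)"
  define A where "A = A1 + A2 + A3 + C ^ (k - 1) * 2"
  let ?E = "gamma_weight k (c / 2)"
  have C0: "C > 0" using c by simp
  have B0: "B \<ge> 1" using c by (simp add: B_def)
  have A10: "A1 \<ge> 0" using C0 B0 by (simp add: A1_def)
  have A20: "A2 \<ge> 0" using C0 B0 by (simp add: A2_def)
  have A30: "A3 \<ge> 0" using A10 A20 C0 by (simp add: A3_def)
  have C30: "C ^ (k - 1) \<ge> 0" using C0 by simp
  have A12: "A1 + A2 \<le> A" and A3A: "A3 + C ^ (k - 1) \<le> A" and CA: "C ^ (k - 1) \<le> A" and A0: "A \<ge> 0"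
    using A10 A20 A30 C30 by (auto simp: A_def)
  have E0: "?E u \<ge> 0" if "u \<ge> 0" for u using that by (rule gamma_weight_nonneg)
  have pol: "(1 + u\<^sup>2) * exp (- c * u) \<le> B * exp (- (c / 2) * u)" "(1 + u) * exp (- c * u) \<le> B * exp (- (c / 2) * u)"
    if "u \<ge> 0" for u
  proof -
    have b: "(1 + u + u\<^sup>2) * exp (- c * u) \<le> B * exp (- (c / 2) * u)"
      using poly_exp_bound[OF c(1) that] by (simp add: B_def)
    have "(1 + u\<^sup>2) * exp (- c * u) \<le> (1 + u + u\<^sup>2) * exp (- c * u)" using that by (intro mult_right_mono) auto
    then show "(1 + u\<^sup>2) * exp (- c * u) \<le> B * exp (- (c / 2) * u)" using b by linarith
    have "(1 + u) * exp (- c * u) \<le> (1 + u + u\<^sup>2) * exp (- c * u)" using that by (intro mult_right_mono) auto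
    then show "(1 + u) * exp (- c * u) \<le> B * exp (- (c / 2) * u)" using b by linarith
  qed
  have diff: "\<bar>binom_nn N k P - pois k (real N * \<gamma> * \<tau>)\<bar> \<le> (A1 + A2) * ?E (real N * \<tau>) * (1 / real N + \<bar>P - \<gamma> * \<tau>\<bar> / \<tau>)"
    if h: "k \<le> N" "0 < \<tau>" "0 \<le> P" "P \<le> 1" "c * \<tau> \<le> P" "P \<le> C * \<tau>" "c \<le> \<gamma>" "\<gamma> \<le> C" for N P \<gamma> \<tau>
  proof -
    define u where "u = real N * \<tau>"
    define t where "t = real N * P"
    have u0: "u \<ge> 0" using h by (simp add: u_def)
    have t: "c * u \<le> t" "t \<le> C * u" "t \<ge> 0"
      using mult_left_mono[OF h(5), of "real N"] mult_left_mono[OF h(6), of "real N"] h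
      by (auto simp: u_def t_def ac_simps)
    have "t ^ (k - 1) * (1 + t\<^sup>2) * exp (- t) \<le> (C * u) ^ (k - 1) * ((1 + C\<^sup>2) * (1 + u\<^sup>2)) * exp (- c * u)"
    proof (intro mult_mono power_mono)
      have "t\<^sup>2 \<le> (C * u)\<^sup>2" using t by (intro power_mono) auto
      then show "1 + t\<^sup>2 \<le> (1 + C\<^sup>2) * (1 + u\<^sup>2)" by (simp add: algebra_simps power_mult_distrib add_increasing)
    qed (use t u0 C0 in auto)
    also have "\<dots> = C ^ (k - 1) * (1 + C\<^sup>2) * u ^ (k - 1) * ((1 + u\<^sup>2) * exp (- c * u))"
      by (simp add: power_mult_distrib ac_simps)
    also have "\<dots> \<le> C ^ (k - 1) * (1 + C\<^sup>2) * u ^ (k - 1) * (B * exp (- (c / 2) * u))"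
      using pol[OF u0] u0 C0 by (intro mult_left_mono) auto
    finally have t': "t ^ (k - 1) * (1 + t\<^sup>2) * exp (- t) \<le> C ^ (k - 1) * (1 + C\<^sup>2) * u ^ (k - 1) * (B * exp (- (c / 2) * u))" .
    have "\<bar>binom_nn N k P - pois k t\<bar> \<le> 2 * real k ^ 2 * exp (real k) / real N * (t ^ (k - 1) * (1 + t\<^sup>2) * exp (- t))"
      using binom_pois[OF k h(1) h(3,4)] by (simp add: t_def)
    also have "\<dots> \<le> 2 * real k ^ 2 * exp (real k) / real N * (C ^ (k - 1) * (1 + C\<^sup>2) * u ^ (k - 1) * (B * exp (- (c / 2) * u)))"
      using t' by (intro mult_left_mono) auto
    also have "\<dots> = A1 * ?E u * (1 / real N)" by (simp add: A1_def gamma_weight_def)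
    finally have d1: "\<bar>binom_nn N k P - pois k t\<bar> \<le> A1 * ?E u * (1 / real N)" .
    have r: "P / \<tau> \<in> {c..C}" using h by (simp add: field_simps)
    have "\<bar>pois k (P / \<tau> * u) - pois k (\<gamma> * u)\<bar>
       \<le> real k * (C + 1) ^ k * u ^ (k - 1) * (1 + u) * exp (- c * u) * \<bar>P / \<tau> - \<gamma>\<bar>"
      using h by (intro pois_lipschitz[OF c u0 r _ k]) auto
    also have "\<dots> = real k * (C + 1) ^ k * u ^ (k - 1) * ((1 + u) * exp (- c * u)) * \<bar>P / \<tau> - \<gamma>\<bar>" by simp
    also have "\<dots> \<le> real k * (C + 1) ^ k * u ^ (k - 1) * (B * exp (- (c / 2) * u)) * \<bar>P / \<tau> - \<gamma>\<bar>"
      using pol[OF u0] u0 C0 by (intro mult_left_mono mult_right_mono) auto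
    also have "\<dots> = A2 * ?E u * \<bar>P / \<tau> - \<gamma>\<bar>" by (simp add: A2_def gamma_weight_def)
    also have "\<bar>P / \<tau> - \<gamma>\<bar> = \<bar>P - \<gamma> * \<tau>\<bar> / \<tau>" using h by (simp add: field_simps abs_if)
    also have "P / \<tau> * u = t" using h by (simp add: u_def t_def)
    also have "\<gamma> * u = real N * \<gamma> * \<tau>" by (simp add: u_def)
    finally have d2: "\<bar>pois k t - pois k (real N * \<gamma> * \<tau>)\<bar> \<le> A2 * ?E u * (\<bar>P - \<gamma> * \<tau>\<bar> / \<tau>)" .
    have "\<bar>binom_nn N k P - pois k (real N * \<gamma> * \<tau>)\<bar> \<le> A1 * ?E u * (1 / real N) + A2 * ?E u * (\<bar>P - \<gamma> * \<tau>\<bar> / \<tau>)"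
      using d1 d2 by linarith
    also have "\<dots> \<le> (A1 + A2) * ?E u * (1 / real N) + (A1 + A2) * ?E u * (\<bar>P - \<gamma> * \<tau>\<bar> / \<tau>)"
      using A10 A20 E0[OF u0] h by (intro add_mono mult_right_mono) auto
    also have "\<dots> = (A1 + A2) * ?E u * (1 / real N + \<bar>P - \<gamma> * \<tau>\<bar> / \<tau>)" by (simp add: distrib_left)
    finally show ?thesis by (simp add: u_def)
  qed
  have up3: "pois k (real N * \<gamma> * \<tau>) \<le> C ^ (k - 1) * ?E (real N * \<tau>)" if h: "0 \<le> \<tau>" "c \<le> \<gamma>" "\<gamma> \<le> C" for N \<gamma> \<tau>
  proof -
    define u where "u = real N * \<tau>"
    have u0: "u \<ge> 0" using h by (simp add: u_def)
    have eq: "real N * \<gamma> * \<tau> = \<gamma> * u" by (simp add: u_def)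
    have "pois k (\<gamma> * u) \<le> (\<gamma> * u) ^ (k - 1) * exp (- (\<gamma> * u))"
    proof -
      have p0: "0 \<le> (\<gamma> * u) ^ (k - 1) * exp (- (\<gamma> * u))" using u0 h c by simp
      have "(\<gamma> * u) ^ (k - 1) * exp (- (\<gamma> * u)) * 1 \<le> (\<gamma> * u) ^ (k - 1) * exp (- (\<gamma> * u)) * fact (k - 1)"
        by (intro mult_left_mono p0 fact_ge_1)
      then show ?thesis by (simp add: pois_def divide_le_eq)
    qed
    also have "\<dots> \<le> (C * u) ^ (k - 1) * exp (- (c / 2) * u)"
    proof (intro mult_mono power_mono)
      show "exp (- (\<gamma> * u)) \<le> exp (- (c / 2) * u)"
        using mult_right_mono[of "c / 2" \<gamma> u] u0 h c by simp
    qed (use u0 h c in \<open>auto intro: mult_right_mono\<close>)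
    finally show ?thesis by (simp add: eq u_def power_mult_distrib gamma_weight_def)
  qed
  show ?thesis
  proof (rule that[OF A0])
    fix N :: nat and P \<gamma> \<tau> :: real
    assume h: "k \<le> N" "0 < \<tau>" "0 \<le> P" "P \<le> 1" "c * \<tau> \<le> P" "P \<le> C * \<tau>" "c \<le> \<gamma>" "\<gamma> \<le> C"
    have "\<bar>binom_nn N k P - pois k (real N * \<gamma> * \<tau>)\<bar> \<le> (A1 + A2) * ?E (real N * \<tau>) * (1 / real N + \<bar>P - \<gamma> * \<tau>\<bar> / \<tau>)"
      using diff[OF h] .
    also have "\<dots> \<le> A * ?E (real N * \<tau>) * (1 / real N + \<bar>P - \<gamma> * \<tau>\<bar> / \<tau>)"
      using A12 h by (intro mult_right_mono E0) auto
    finally show "\<bar>binom_nn N k P - pois k (real N * \<gamma> * \<tau>)\<bar>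
        \<le> A * gamma_weight k (c / 2) (real N * \<tau>) * (1 / real N + \<bar>P - \<gamma> * \<tau>\<bar> / \<tau>)"
      by (simp add: mult.assoc)
  next
    fix N :: nat and P \<tau> :: real
    assume h: "k \<le> N" "0 < \<tau>" "0 \<le> P" "P \<le> 1" "c * \<tau> \<le> P" "P \<le> C * \<tau>"
    have "1 / real N \<le> 1" using h k by (simp add: divide_le_eq)
    moreover have "\<bar>P - c * \<tau>\<bar> / \<tau> \<le> 2 * C"
    proof -
      have "\<bar>P - c * \<tau>\<bar> \<le> C * \<tau>" using h mult_pos_pos[OF c(1) h(2)] by linarith
      then have "\<bar>P - c * \<tau>\<bar> / \<tau> \<le> C" using h by (simp add: divide_le_eq)
      then show ?thesis using C0 by linarith
    qed
    ultimately have f: "1 / real N + \<bar>P - c * \<tau>\<bar> / \<tau> \<le> 1 + 2 * C" by linarith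
    have "\<bar>binom_nn N k P - pois k (real N * c * \<tau>)\<bar> \<le> (A1 + A2) * ?E (real N * \<tau>) * (1 / real N + \<bar>P - c * \<tau>\<bar> / \<tau>)"
      using diff[OF h(1-6), of c] c by simp
    also have "\<dots> \<le> (A1 + A2) * ?E (real N * \<tau>) * (1 + 2 * C)"
      using A10 A20 h by (intro mult_left_mono f mult_nonneg_nonneg E0) auto
    also have "\<dots> = A3 * ?E (real N * \<tau>)" by (simp add: A3_def)
    finally have "binom_nn N k P \<le> A3 * ?E (real N * \<tau>) + C ^ (k - 1) * ?E (real N * \<tau>)"
      using up3[of \<tau> c N] h c by linarith
    also have "\<dots> = (A3 + C ^ (k - 1)) * ?E (real N * \<tau>)" by (simp add: distrib_right)
    also have "\<dots> \<le> A * ?E (real N * \<tau>)" using A3A h by (intro mult_right_mono E0) auto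
    finally show "binom_nn N k P \<le> A * gamma_weight k (c / 2) (real N * \<tau>)" by (simp add: mult.assoc)
  next
    fix N :: nat and \<gamma> \<tau> :: real
    assume h: "0 \<le> \<tau>" "c \<le> \<gamma>" "\<gamma> \<le> C"
    have "pois k (real N * \<gamma> * \<tau>) \<le> C ^ (k - 1) * ?E (real N * \<tau>)" by (rule up3[OF h])
    also have "\<dots> \<le> A * ?E (real N * \<tau>)" using CA h by (intro mult_right_mono E0) auto
    finally show "pois k (real N * \<gamma> * \<tau>) \<le> A * gamma_weight k (c / 2) (real N * \<tau>)" by (simp add: mult.assoc)
  qed
qed

text \<open>The density of the offset from \<open>x\<close> to its \<open>k\<close>-th nearest neighbour among \<open>N\<close> points, and its
  Gamma limit.\<close>

definition nn_kernel :: "('a::euclidean_space \<Rightarrow> real) \<Rightarrow> nat \<Rightarrow> nat \<Rightarrow> 'a \<Rightarrow> 'a \<Rightarrow> real" where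
  "nn_kernel g N k x z = real N * g (x + z) * binom_nn N k (ballmass g x (norm z))"

definition gamma_kernel :: "('a::euclidean_space \<Rightarrow> real) \<Rightarrow> nat \<Rightarrow> nat \<Rightarrow> 'a \<Rightarrow> 'a \<Rightarrow> real" where
  "gamma_kernel g N k x z = real N * g x * pois k (g x * svol N z)"

context tame_density
begin

lemma g_nonneg: "0 \<le> g x"
  using dens by (simp add: prob_density_def)

lemma g_borel [measurable]: "g \<in> borel_measurable borel"
  using dens by (simp add: prob_density_def)

lemmas ballmass_measurable' [measurable (raw)] = ballmass_measurable[OF dens]

lemma S_measurable [measurable]: "S \<in> sets borel" by (rule S_borel)

lemma c_le_C: "c \<le> C"
proof (rule ccontr)
  assume *: "\<not> c \<le> C"
  have "AE x in lborel. ennreal (g x) = 0"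
    using g_upper g_outside
  proof eventually_elim
    case (elim x)
    then show ?case using * g_lower[of x] by (cases "x \<in> S") auto
  qed
  then have "(\<integral>\<^sup>+x. ennreal (g x) \<partial>lborel) = 0" by (subst nn_integral_0_iff_AE) auto
  then show False using dens by (simp add: prob_density_def)
qed

lemma ballmass_upper:
  fixes z :: 'a
  shows "ballmass g x (norm z) \<le> C * bvol z"
proof -
  have "ennreal (ballmass g x (norm z)) = (\<integral>\<^sup>+y. ennreal (g y) * indicator (ball x (norm z)) y \<partial>lborel)"
    by (rule ennreal_ballmass[OF dens])
  also have "\<dots> \<le> (\<integral>\<^sup>+y. ennreal C * indicator (ball x (norm z)) y \<partial>lborel)"
    using g_upper by (intro nn_integral_mono_AE) (auto simp: indicator_def intro: ennreal_leI)
  also have "\<dots> = ennreal C * emeasure lborel (ball x (norm z))" by (simp add: nn_integral_cmult_indicator)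
  also have "emeasure lborel (ball x (norm z)) = ennreal (bvol z)"
    using emeasure_bounded_finite[OF bounded_ball, of x "norm z"]
    by (simp add: emeasure_eq_ennreal_measure measure_ball_bvol)
  also have "ennreal C * ennreal (bvol z) = ennreal (C * bvol z)" using C_pos bvol_nonneg by (simp add: ennreal_mult')
  finally show ?thesis using C_pos bvol_nonneg[of z] by (subst (asm) ennreal_le_iff) auto
qed

lemma AE_translate_good:
  "AE z in lborel. g (x + z) \<le> C \<and> (x + z \<notin> S \<longrightarrow> g (x + z) = 0) \<and> z \<noteq> 0"
proof -
  have "AE z in lborel. g (z + x) \<le> C" by (rule AE_lborel_translate[OF g_upper]) auto
  moreover have "AE z in lborel. z + x \<notin> S \<longrightarrow> g (z + x) = 0"
    by (rule AE_lborel_translate[OF g_outside]) auto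
  moreover have "AE z in lborel. z \<noteq> (0 :: 'a)" by (rule AE_lborel_singleton)
  ultimately show ?thesis by eventually_elim (auto simp: add.commute)
qed

text \<open>In the difference of the kernels the factor \<open>g (x + z)\<close> stays with the difference of the
  weights: it vanishes unless \<open>x + z\<close> lies in \<open>S\<close>, and only then is the mass of the ball bounded from
  below.\<close>

lemma kernel_bounds:
  assumes k: "k \<ge> 1"
  obtains A where "A \<ge> 0"
    "\<And>N x. k \<le> N \<Longrightarrow> x \<in> S \<Longrightarrow> g x \<le> C \<Longrightarrow> AE z in lborel.
       \<bar>nn_kernel g N k x z - gamma_kernel g N k x z\<bar> \<le> real N * (A * gamma_weight k (c / 2) (svol N z))
          * (\<bar>g (x + z) - g x\<bar> + 1 / real N + \<bar>ballmass g x (norm z) - g x * bvol z\<bar> / bvol z)"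
    "\<And>N x. k \<le> N \<Longrightarrow> x \<in> S \<Longrightarrow> AE z in lborel.
       nn_kernel g N k x z \<le> real N * (A * gamma_weight k (c / 2) (svol N z))"
    "\<And>N x z. x \<in> S \<Longrightarrow> g x \<le> C \<Longrightarrow>
       gamma_kernel g N k x z \<le> real N * (A * gamma_weight k (c / 2) (svol N z))"
proof -
  obtain A where A0: "A \<ge> 0"
    and A1: "\<And>N P \<gamma> \<tau>. k \<le> N \<Longrightarrow> 0 < \<tau> \<Longrightarrow> 0 \<le> P \<Longrightarrow> P \<le> 1 \<Longrightarrow> c * \<tau> \<le> P \<Longrightarrow> P \<le> C * \<tau> \<Longrightarrow> c \<le> \<gamma> \<Longrightarrow> \<gamma> \<le> C \<Longrightarrow>
       \<bar>binom_nn N k P - pois k (real N * \<gamma> * \<tau>)\<bar>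
        \<le> A * gamma_weight k (c / 2) (real N * \<tau>) * (1 / real N + \<bar>P - \<gamma> * \<tau>\<bar> / \<tau>)"
    and A2: "\<And>N P \<tau>. k \<le> N \<Longrightarrow> 0 < \<tau> \<Longrightarrow> 0 \<le> P \<Longrightarrow> P \<le> 1 \<Longrightarrow> c * \<tau> \<le> P \<Longrightarrow> P \<le> C * \<tau> \<Longrightarrow>
       binom_nn N k P \<le> A * gamma_weight k (c / 2) (real N * \<tau>)"
    and A3: "\<And>N \<gamma> \<tau>. 0 \<le> \<tau> \<Longrightarrow> c \<le> \<gamma> \<Longrightarrow> \<gamma> \<le> C \<Longrightarrow>
       pois k (real N * \<gamma> * \<tau>) \<le> A * gamma_weight k (c / 2) (real N * \<tau>)"
    using binom_pois_comparison[OF c_pos c_le_C k] by blast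
  let ?E = "\<lambda>N z. gamma_weight k (c / 2) (svol N z)"
  have E0: "?E N z \<ge> 0" for N z by (intro gamma_weight_nonneg svol_nonneg)
  have gs: "real N * g x * bvol z = g x * svol N z" for N x z by (simp add: svol_def)
  define A' where "A' = A * (1 + C)"
  have AA': "A \<le> A'" "A * C \<le> A'" "0 \<le> A'" using A0 C_pos by (auto simp: A'_def algebra_simps)
  have AC: "C * (A * ?E N z) \<le> A' * ?E N z" for N z
    using mult_right_mono[OF AA'(2) E0[of N z]] by (simp add: ac_simps)
  show ?thesis
  proof (rule that[OF AA'(3)])
    fix N x assume h: "k \<le> N" "x \<in> S" "g x \<le> C"
    show "AE z in lborel. \<bar>nn_kernel g N k x z - gamma_kernel g N k x z\<bar> \<le> real N * (A' * ?E N z)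
          * (\<bar>g (x + z) - g x\<bar> + 1 / real N + \<bar>ballmass g x (norm z) - g x * bvol z\<bar> / bvol z)"
      using AE_translate_good[of x]
    proof eventually_elim
      case z: (elim z)
      let ?P = "ballmass g x (norm z)" and ?\<tau> = "bvol z"
      let ?R = "1 / real N + \<bar>?P - g x * ?\<tau>\<bar> / ?\<tau>"
      let ?b = "binom_nn N k ?P" and ?\<pi> = "pois k (g x * svol N z)"
      have \<tau>: "?\<tau> > 0" using z by (simp add: bvol_pos_iff)
      have R0: "?R \<ge> 0" using \<tau> by simp
      have p: "?\<pi> \<le> A * ?E N z"
        using A3[of ?\<tau> "g x" N] \<tau> h g_lower by (simp add: gs svol_def)
      have p0: "?\<pi> \<ge> 0" using svol_nonneg[of N z] g_nonneg by (intro pois_nonneg) auto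
      have second: "g (x + z) * \<bar>?b - ?\<pi>\<bar> \<le> C * (A * ?E N z * ?R)"
      proof (cases "x + z \<in> S")
        case True
        have "\<bar>?b - ?\<pi>\<bar> \<le> A * ?E N z * ?R"
          using A1[OF h(1) \<tau> ballmass_bounds[OF dens] ballmass_lower[OF h(2) True] ballmass_upper g_lower[OF h(2)] h(3)]
          by (simp add: gs svol_def)
        then show ?thesis using z C_pos g_nonneg by (intro mult_mono) auto
      next
        case False
        then show ?thesis using z C_pos A0 R0 E0[of N z] by (simp del: mult_nonneg_nonneg add: mult_nonneg_nonneg)
      qed
      have eq: "nn_kernel g N k x z - gamma_kernel g N k x z
        = real N * ((g (x + z) - g x) * ?\<pi> + g (x + z) * (?b - ?\<pi>))"
        by (simp add: nn_kernel_def gamma_kernel_def algebra_simps)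
      have "\<bar>(g (x + z) - g x) * ?\<pi> + g (x + z) * (?b - ?\<pi>)\<bar> \<le> \<bar>g (x + z) - g x\<bar> * ?\<pi> + g (x + z) * \<bar>?b - ?\<pi>\<bar>"
        using abs_triangle_ineq[of "(g (x + z) - g x) * ?\<pi>" "g (x + z) * (?b - ?\<pi>)"] p0 g_nonneg by (simp add: abs_mult)
      also have "\<dots> \<le> \<bar>g (x + z) - g x\<bar> * (A * ?E N z) + C * (A * ?E N z * ?R)"
        using p second by (intro add_mono mult_left_mono) auto
      also have "\<dots> = A * (\<bar>g (x + z) - g x\<bar> * ?E N z) + (A * C) * (?E N z * ?R)" by simp
      also have "\<dots> \<le> A' * (\<bar>g (x + z) - g x\<bar> * ?E N z) + A' * (?E N z * ?R)"
        using AA' E0[of N z] mult_nonneg_nonneg[OF E0[of N z] R0]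
        by (intro add_mono mult_right_mono mult_nonneg_nonneg[OF _ E0]) auto
      also have "\<dots> = (A' * ?E N z) * (\<bar>g (x + z) - g x\<bar> + ?R)" by (simp add: algebra_simps)
      finally have "\<bar>nn_kernel g N k x z - gamma_kernel g N k x z\<bar> \<le> real N * ((A' * ?E N z) * (\<bar>g (x + z) - g x\<bar> + ?R))"
        unfolding eq abs_mult by (intro mult_mono) auto
      then show ?case by (simp add: mult.assoc add.assoc)
    qed
  next
    fix N x assume h: "k \<le> N" "x \<in> S"
    show "AE z in lborel. nn_kernel g N k x z \<le> real N * (A' * ?E N z)"
      using AE_translate_good[of x]
    proof eventually_elim
      case z: (elim z)
      have \<tau>: "bvol z > 0" using z by (simp add: bvol_pos_iff)
      have "g (x + z) * binom_nn N k (ballmass g x (norm z)) \<le> C * (A * ?E N z)"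
      proof (cases "x + z \<in> S")
        case True
        then show ?thesis
          using A2[OF h(1) \<tau> ballmass_bounds[OF dens] ballmass_lower[OF h(2) True] ballmass_upper] z C_pos g_nonneg
          by (intro mult_mono binom_nn_nonneg ballmass_bounds[OF dens]) (auto simp: svol_def)
      next
        case False
        then show ?thesis using z C_pos A0 E0[of N z] by (simp del: mult_nonneg_nonneg add: mult_nonneg_nonneg)
      qed
      then have "real N * (g (x + z) * binom_nn N k (ballmass g x (norm z))) \<le> real N * (A' * ?E N z)"
        using AC[of N z] by (intro mult_left_mono) auto
      then show ?case by (simp add: nn_kernel_def mult.assoc)
    qed
  next
    fix N :: nat and x z :: 'a assume h: "x \<in> S" "g x \<le> C"
    have "g x * pois k (g x * svol N z) \<le> C * (A * ?E N z)"
      using A3[of "bvol z" "g x" N] bvol_nonneg[of z] svol_nonneg[of N z] h g_lower[of x] g_nonneg C_pos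
      by (intro mult_mono pois_nonneg) (auto simp: gs svol_def)
    then have "real N * (g x * pois k (g x * svol N z)) \<le> real N * (A' * ?E N z)"
      using AC[of N z] by (intro mult_left_mono) auto
    then show "gamma_kernel g N k x z \<le> real N * (A' * ?E N z)"
      by (simp add: gamma_kernel_def mult.assoc)
  qed
qed

end

lemma norm_powr_svol:
  fixes z :: "'a::euclidean_space"
  assumes N: "N > 0"
  shows "norm z powr s = real N powr - (s / DIM('a)) * unit_ball_vol (real DIM('a)) powr - (s / DIM('a)) * svol N z powr (s / DIM('a))"
proof (cases "z = 0")
  case True
  then show ?thesis by (simp add: svol_def bvol_def power_0_left)
next
  case False
  let ?d = "real DIM('a)" and ?c = "unit_ball_vol (real DIM('a))"
  have c: "?c > 0" by (simp add: unit_ball_vol_pos)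
  have d: "?d > 0" by simp
  have "(norm z ^ DIM('a)) powr (s / ?d) = norm z powr s"
    using False d by (simp add: powr_realpow[symmetric] powr_powr)
  moreover have "svol N z powr (s / ?d) = real N powr (s / ?d) * (?c powr (s / ?d) * (norm z ^ DIM('a)) powr (s / ?d))"
    using N c by (simp add: svol_def bvol_def powr_mult)
  ultimately show ?thesis
    using less_imp_neq[OF c, symmetric] N by (simp add: powr_minus field_simps)
qed

context tame_density
begin

lemma gamma_kernel_nonneg: "0 \<le> gamma_kernel g N k x z"
  by (simp add: gamma_kernel_def g_nonneg pois_nonneg svol_nonneg)

lemma nn_kernel_nonneg: "0 \<le> nn_kernel g N k x z"
  by (simp add: nn_kernel_def g_nonneg binom_nn_nonneg ballmass_bounds[OF dens])

lemma kernel_measurable [measurable]: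
  "(\<lambda>(x, z). nn_kernel g N k x z) \<in> borel_measurable (borel \<Otimes>\<^sub>M borel)"
  "(\<lambda>(x, z). gamma_kernel g N k x z) \<in> borel_measurable (borel \<Otimes>\<^sub>M borel)"
  unfolding nn_kernel_def gamma_kernel_def by measurable

lemma kernel_moment_bound:
  fixes a b :: real
  assumes k: "k \<ge> 1" "real k > - a"
  obtains B where "B \<ge> 0"
    "\<And>N x. k \<le> N \<Longrightarrow> x \<in> S \<Longrightarrow> (\<integral>\<^sup>+z. ennreal (poly_envelope a b (svol N z) * nn_kernel g N k x z) \<partial>lborel) \<le> ennreal B"
    "\<And>N x. k \<le> N \<Longrightarrow> x \<in> S \<Longrightarrow> g x \<le> C \<Longrightarrow> (\<integral>\<^sup>+z. ennreal (poly_envelope a b (svol N z) * gamma_kernel g N k x z) \<partial>lborel) \<le> ennreal B"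
proof -
  obtain A where A: "A \<ge> 0"
    "\<And>N x. k \<le> N \<Longrightarrow> x \<in> S \<Longrightarrow> AE z in lborel. nn_kernel g N k x z \<le> real N * (A * gamma_weight k (c / 2) (svol N z))"
    "\<And>N x z. x \<in> S \<Longrightarrow> g x \<le> C \<Longrightarrow> gamma_kernel g N k x z \<le> real N * (A * gamma_weight k (c / 2) (svol N z))"
    by (rule kernel_bounds[OF k(1)], rule that) assumption+
  define B where "B = A * enn2real (envelope_moment a b k 0 (c / 2))"
  have m: "envelope_moment a b k 0 (c / 2) < \<infinity>" using k c_pos by (intro envelope_moment_finite) auto
  have gen: "(\<integral>\<^sup>+z. ennreal (poly_envelope a b (svol N z) * h z) \<partial>lborel) \<le> ennreal B"
    if N: "k \<le> N" and h: "AE z in lborel. h z \<le> real N * (A * gamma_weight k (c / 2) (svol N z))"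
    for N and h :: "'a \<Rightarrow> real"
  proof -
    have N0: "N > 0" using N k by simp
    have "(\<integral>\<^sup>+z. ennreal (poly_envelope a b (svol N z) * h z) \<partial>lborel)
      \<le> (\<integral>\<^sup>+(z::'a). ennreal A * (ennreal (real N) * ennreal (poly_envelope a b (svol N z) * svol N z powr 0
            * gamma_weight k (c / 2) (svol N z))) \<partial>lborel)"
    \<comment> \<open>The origin is excluded because \<open>0 powr 0\<close> is \<open>0\<close>.\<close>
    proof (rule nn_integral_mono_AE, use h AE_lborel_singleton[of 0] in eventually_elim)
      fix z :: 'a assume hz: "h z \<le> real N * (A * gamma_weight k (c / 2) (svol N z))" and z: "z \<noteq> 0"
      let ?u = "svol N z"
      have p0: "?u powr 0 = 1" using svol_pos[OF N0 z] unfolding powr_zero_eq_one by (metis less_irrefl)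
      have "poly_envelope a b ?u * h z \<le> poly_envelope a b ?u * (real N * (A * gamma_weight k (c / 2) ?u))"
        using hz by (intro mult_left_mono poly_envelope_nonneg)
      also have "\<dots> = A * (real N * (poly_envelope a b ?u * ?u powr 0 * gamma_weight k (c / 2) ?u))"
        unfolding p0 mult_1_right by (simp only: ac_simps)
      finally have "ennreal (poly_envelope a b ?u * h z) \<le> ennreal (A * (real N * (poly_envelope a b ?u * ?u powr 0 * gamma_weight k (c / 2) ?u)))"
        by (rule ennreal_leI)
      then show "ennreal (poly_envelope a b ?u * h z)
        \<le> ennreal A * (ennreal (real N) * ennreal (poly_envelope a b ?u * ?u powr 0 * gamma_weight k (c / 2) ?u))"
        using A(1) N0 by (simp only: ennreal_mult' of_nat_0_le_iff)
    qed
    also have "\<dots> = ennreal A * envelope_moment a b k 0 (c / 2)"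
      by (subst nn_integral_cmult) (measurable, subst envelope_moment_svol[OF N0], rule refl)
    also have "\<dots> = ennreal B"
      unfolding B_def using A(1) m by (simp add: ennreal_mult')
    finally show ?thesis .
  qed
  show ?thesis
  proof (rule that[of B])
    show "B \<ge> 0" using A(1) by (simp add: B_def)
  qed (use A gen in auto)
qed

text \<open>The error is the integral of \<open>g (x + w) - g x\<close> over \<open>\<bar>w\<bar> < \<bar>z\<bar>\<close>, so after exchanging the
  integrals the translation modulus applies to each \<open>w\<close>.\<close>

lemma ballmass_error:
  fixes z :: 'a
  shows "(\<integral>\<^sup>+x. ennreal \<bar>ballmass g x (norm z) - g x * bvol z\<bar> * indicator S x \<partial>lborel) \<le> ennreal (bvol z * (K * norm z powr s))"
proof -
  have [measurable]: "ball x r \<in> sets borel" for x :: 'a and r by simp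
  let ?B = "\<lambda>w. indicator (ball (0::'a) (norm z)) w :: ennreal"
  have vol: "emeasure lborel (ball (0::'a) (norm z)) = ennreal (bvol z)"
    using emeasure_bounded_finite[OF bounded_ball, of "0::'a" "norm z"]
    by (simp add: emeasure_eq_ennreal_measure measure_ball_bvol)
  have pt: "ennreal \<bar>ballmass g x (norm z) - g x * bvol z\<bar> \<le> (\<integral>\<^sup>+w. ennreal \<bar>g (x + w) - g x\<bar> * ?B w \<partial>lborel)" (is "_ \<le> ?I") for x
  proof -
    have bm: "ennreal (ballmass g x (norm z)) = (\<integral>\<^sup>+w. ennreal (g (x + w)) * ?B w \<partial>lborel)"
    proof -
      have "ennreal (ballmass g x (norm z)) = (\<integral>\<^sup>+w. ennreal (g (x + w)) * indicator (ball x (norm z)) (x + w) \<partial>lborel)"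
        unfolding ennreal_ballmass[OF dens] by (rule nn_integral_lborel_translate[symmetric]) measurable
      also have "\<dots> = (\<integral>\<^sup>+w. ennreal (g (x + w)) * ?B w \<partial>lborel)"
        by (intro nn_integral_cong) (auto simp: indicator_def dist_norm)
      finally show ?thesis .
    qed
    have gb: "ennreal (g x * bvol z) = (\<integral>\<^sup>+w. ennreal (g x) * ?B w \<partial>lborel)"
      by (simp add: nn_integral_cmult_indicator vol ennreal_mult' g_nonneg)
    have up: "ennreal (ballmass g x (norm z)) \<le> ennreal (g x * bvol z) + ?I"
      and lo: "ennreal (g x * bvol z) \<le> ennreal (ballmass g x (norm z)) + ?I"
      unfolding bm gb by (subst nn_integral_add[symmetric],
        auto intro!: nn_integral_mono simp: indicator_def g_nonneg simp flip: ennreal_plus intro: ennreal_leI)+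
    show ?thesis
    proof (cases "?I = \<infinity>")
      case False
      then obtain r where r: "?I = ennreal r" "r \<ge> 0" by (cases ?I) auto
      have nn: "g x * bvol z \<ge> 0" "ballmass g x (norm z) \<ge> 0"
        using mult_nonneg_nonneg[OF g_nonneg[of x] bvol_nonneg[of z]] ballmass_bounds(1)[OF dens] by auto
      have "ballmass g x (norm z) \<le> g x * bvol z + r" "g x * bvol z \<le> ballmass g x (norm z) + r"
        using up lo nn r by (auto simp flip: ennreal_plus simp: ennreal_le_iff)
      then show ?thesis unfolding r by (intro ennreal_leI) auto
    qed simp
  qed
  have "(\<integral>\<^sup>+x. ennreal \<bar>ballmass g x (norm z) - g x * bvol z\<bar> * indicator S x \<partial>lborel)
    \<le> (\<integral>\<^sup>+x. (\<integral>\<^sup>+w. ennreal \<bar>g (x + w) - g x\<bar> * ?B w * indicator S x \<partial>lborel) \<partial>lborel)"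
    using pt by (intro nn_integral_mono) (auto simp: nn_integral_multc intro!: mult_right_mono)
  also have "\<dots> = (\<integral>\<^sup>+w. (\<integral>\<^sup>+x. ennreal \<bar>g (x + w) - g x\<bar> * ?B w * indicator S x \<partial>lborel) \<partial>lborel)"
    by (rule lborel_pair.Fubini'[symmetric]) measurable
  also have "\<dots> \<le> (\<integral>\<^sup>+w. ennreal (K * norm z powr s) * ?B w \<partial>lborel)"
  proof (intro nn_integral_mono)
    fix w :: 'a
    show "(\<integral>\<^sup>+x. ennreal \<bar>g (x + w) - g x\<bar> * ?B w * indicator S x \<partial>lborel) \<le> ennreal (K * norm z powr s) * ?B w"
    proof (cases "norm w < norm z")
      case True
      have "(\<integral>\<^sup>+x. ennreal \<bar>g (x + w) - g x\<bar> * indicator S x \<partial>lborel) \<le> ennreal (K * norm w powr s)"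
        by (rule modulus)
      also have "\<dots> \<le> ennreal (K * norm z powr s)"
        using True s_pos K_nonneg by (intro ennreal_leI mult_left_mono powr_mono2) auto
      finally show ?thesis using True by (simp add: indicator_def)
    qed simp
  qed
  also have "\<dots> = ennreal (K * norm z powr s) * ennreal (bvol z)"
    by (simp add: nn_integral_cmult_indicator vol)
  also have "\<dots> = ennreal (bvol z * (K * norm z powr s))"
    using bvol_nonneg by (subst ennreal_mult''[symmetric]) (auto simp: ac_simps)
  finally show ?thesis .
qed

text \<open>By Tonelli's theorem the pointwise bound on the difference is integrated over \<open>x\<close> first. What
  is left depends on \<open>z\<close> through \<open>svol N z\<close> only, and \<open>norm z powr s\<close> contributes the factor
  \<open>N powr (- s / d)\<close>.\<close>

lemma kernel_error_bound:
  fixes a b :: real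
  assumes k: "k \<ge> 1" "real k > - a"
  obtains B where "B \<ge> 0"
    "\<And>N. k \<le> N \<Longrightarrow> (\<integral>\<^sup>+x. indicator S x * (\<integral>\<^sup>+z. ennreal (poly_envelope a b (svol N z)
          * \<bar>nn_kernel g N k x z - gamma_kernel g N k x z\<bar>) \<partial>lborel) \<partial>lborel) \<le> ennreal (B * real N powr - (s / real DIM('a)))"
proof -
  let ?d = "real DIM('a)"
  obtain A where A: "A \<ge> 0"
    "\<And>N x. k \<le> N \<Longrightarrow> x \<in> S \<Longrightarrow> g x \<le> C \<Longrightarrow> AE z in lborel.
       \<bar>nn_kernel g N k x z - gamma_kernel g N k x z\<bar> \<le> real N * (A * gamma_weight k (c / 2) (svol N z))
          * (\<bar>g (x + z) - g x\<bar> + 1 / real N + \<bar>ballmass g x (norm z) - g x * bvol z\<bar> / bvol z)"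
    by (rule kernel_bounds[OF k(1)], rule that) assumption+
  define V where "V = measure lborel S"
  have V: "emeasure lborel S = ennreal V" "V \<ge> 0"
    unfolding V_def using S_fin by (auto simp: emeasure_eq_ennreal_measure)
  define cd where "cd = unit_ball_vol ?d powr - (s / ?d)"
  let ?mom = "\<lambda>e. envelope_moment a b k e (c / 2)"
  define B where "B = A * (2 * K * cd * enn2real (?mom (s / ?d)) + V * enn2real (?mom 0))"
  have em: "ennreal (enn2real (?mom 0)) = ?mom 0" "ennreal (enn2real (?mom (s / ?d))) = ?mom (s / ?d)"
    using k c_pos s_pos envelope_moment_finite[of k a 0 "c / 2" b] envelope_moment_finite[of k a "s / ?d" "c / 2" b] by auto
  show ?thesis
  proof (rule that[of B])
    show "B \<ge> 0" unfolding B_def using A K_nonneg V by (auto simp: cd_def)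
    fix N :: nat assume N: "k \<le> N"
    have N0: "N > 0" "real N \<ge> 1" using N k by simp_all
    let ?W = "\<lambda>z::'a. poly_envelope a b (svol N z) * (real N * (A * gamma_weight k (c / 2) (svol N z)))"
    let ?R = "\<lambda>x z::'a. \<bar>g (x + z) - g x\<bar> + 1 / real N + \<bar>ballmass g x (norm z) - g x * bvol z\<bar> / bvol z"
    let ?E = "\<lambda>x z. poly_envelope a b (svol N z) * \<bar>nn_kernel g N k x z - gamma_kernel g N k x z\<bar>"
    let ?h = "\<lambda>e z::'a. poly_envelope a b (svol N z) * svol N z powr e * gamma_weight k (c / 2) (svol N z)"
    let ?\<alpha> = "A * (2 * K * cd * real N powr - (s / ?d))" and ?\<beta> = "A * (V / real N)"
    have W0: "?W z \<ge> 0" for z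
      using A by (intro mult_nonneg_nonneg poly_envelope_nonneg gamma_weight_nonneg svol_nonneg) auto
    have R0: "?R x z \<ge> 0" for x z by (simp add: bvol_nonneg)
    have nn: "0 \<le> ?\<alpha>" "0 \<le> ?\<beta>" using A K_nonneg V by (auto simp: cd_def)
    have "(\<integral>\<^sup>+x. indicator S x * (\<integral>\<^sup>+z. ennreal (?E x z) \<partial>lborel) \<partial>lborel)
      \<le> (\<integral>\<^sup>+x. (\<integral>\<^sup>+z. ennreal (?W z) * (ennreal (?R x z) * indicator S x) \<partial>lborel) \<partial>lborel)"
    proof (rule nn_integral_mono_AE, use g_upper in eventually_elim)
      fix x assume gx: "g x \<le> C"
      show "indicator S x * (\<integral>\<^sup>+z. ennreal (?E x z) \<partial>lborel) \<le> (\<integral>\<^sup>+z. ennreal (?W z) * (ennreal (?R x z) * indicator S x) \<partial>lborel)"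
      proof (cases "x \<in> S")
        case True
        have "(\<integral>\<^sup>+z. ennreal (?E x z) \<partial>lborel) \<le> (\<integral>\<^sup>+z. ennreal (?W z) * ennreal (?R x z) \<partial>lborel)"
        proof (rule nn_integral_mono_AE, use A(2)[OF N True gx] in eventually_elim)
          case (elim z)
          have "?E x z \<le> ?W z * ?R x z"
            using mult_left_mono[OF elim poly_envelope_nonneg[of a b "svol N z"]] by (simp add: mult.assoc)
          then show ?case by (subst ennreal_mult[OF W0 R0, symmetric]) (rule ennreal_leI)
        qed
        then show ?thesis using True by simp
      qed simp
    qed
    also have "\<dots> = (\<integral>\<^sup>+z. (\<integral>\<^sup>+x. ennreal (?W z) * (ennreal (?R x z) * indicator S x) \<partial>lborel) \<partial>lborel)"
      by (rule lborel_pair.Fubini'[symmetric]) measurable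
    also have "\<dots> \<le> (\<integral>\<^sup>+z. ennreal (?W z) * ennreal (2 * K * norm z powr s + V / real N) \<partial>lborel)"
    proof (rule nn_integral_mono_AE, use AE_lborel_singleton[of 0] in eventually_elim)
      case z: (elim z)
      have bz: "bvol z > 0" using z by (simp add: bvol_pos_iff)
      let ?e = "\<lambda>x. ennreal \<bar>ballmass g x (norm z) - g x * bvol z\<bar>"
      have "ennreal (?R x z) = ennreal \<bar>g (x + z) - g x\<bar> + ennreal (1 / real N) + ennreal (1 / bvol z) * ?e x" for x
        using bz by (simp flip: ennreal_plus ennreal_mult)
      then have "(\<integral>\<^sup>+x. ennreal (?R x z) * indicator S x \<partial>lborel)
        = (\<integral>\<^sup>+x. ennreal \<bar>g (x + z) - g x\<bar> * indicator S x + ennreal (1 / real N) * indicator S x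
              + ennreal (1 / bvol z) * (?e x * indicator S x) \<partial>lborel)"
        by (intro nn_integral_cong) (auto simp: indicator_def)
      also have "\<dots> = (\<integral>\<^sup>+x. ennreal \<bar>g (x + z) - g x\<bar> * indicator S x \<partial>lborel) + ennreal (1 / real N) * emeasure lborel S
            + ennreal (1 / bvol z) * (\<integral>\<^sup>+x. ?e x * indicator S x \<partial>lborel)"
        by (simp add: nn_integral_add nn_integral_cmult nn_integral_cmult_indicator)
      also have "\<dots> \<le> ennreal (K * norm z powr s) + ennreal (1 / real N) * ennreal V + ennreal (1 / bvol z) * ennreal (bvol z * (K * norm z powr s))"
        unfolding V(1) by (intro add_mono mult_left_mono modulus ballmass_error) auto
      also have "\<dots> = ennreal (2 * K * norm z powr s + V / real N)"
        using bz V K_nonneg by (simp flip: ennreal_plus ennreal_mult)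
      finally show ?case by (subst nn_integral_cmult) (measurable, auto intro: mult_left_mono)
    qed
    also have "\<dots> = (\<integral>\<^sup>+z. ennreal ?\<alpha> * (ennreal (real N) * ennreal (?h (s / ?d) z)) + ennreal ?\<beta> * (ennreal (real N) * ennreal (?h 0 z)) \<partial>lborel)"
    proof (rule nn_integral_cong_AE, use AE_lborel_singleton[of 0] in eventually_elim)
      case z: (elim z)
      let ?u = "svol N z"
      define \<psi> where "\<psi> = poly_envelope a b ?u * gamma_weight k (c / 2) ?u"
      have \<psi>0: "\<psi> \<ge> 0" unfolding \<psi>_def by (intro mult_nonneg_nonneg poly_envelope_nonneg gamma_weight_nonneg svol_nonneg)
      have p0: "?u powr 0 = 1" using svol_pos[OF N0(1) z] unfolding powr_zero_eq_one by (metis less_irrefl)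
      have e1: "?h e z = \<psi> * ?u powr e" for e by (simp add: \<psi>_def)
      have e2: "?W z = A * (real N * \<psi>)" by (simp add: \<psi>_def)
      have e3: "norm z powr s = real N powr - (s / ?d) * cd * ?u powr (s / ?d)"
        unfolding cd_def by (rule norm_powr_svol[OF N0(1)])
      have nn': "0 \<le> A * (real N * \<psi>)" "0 \<le> real N * (\<psi> * ?u powr (s / ?d))" "0 \<le> real N * (\<psi> * ?u powr 0)"
         "0 \<le> 2 * K * norm z powr s + V / real N"
        using A K_nonneg V \<psi>0 by auto
      have "(A * (real N * \<psi>)) * (2 * K * norm z powr s + V / real N)
        = ?\<alpha> * (real N * (\<psi> * ?u powr (s / ?d))) + ?\<beta> * (real N * (\<psi> * ?u powr 0))"
        unfolding e3 p0 by (simp add: algebra_simps)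
      then show ?case
        unfolding e1 e2 ennreal_mult[OF of_nat_0_le_iff mult_nonneg_nonneg[OF \<psi>0 powr_ge_zero], symmetric]
          ennreal_mult[OF nn'(1,4), symmetric] ennreal_mult[OF nn(1) nn'(2), symmetric] ennreal_mult[OF nn(2) nn'(3), symmetric]
          ennreal_plus[OF mult_nonneg_nonneg[OF nn(1) nn'(2)] mult_nonneg_nonneg[OF nn(2) nn'(3)], symmetric] by simp
    qed
    also have "\<dots> = ennreal ?\<alpha> * ?mom (s / ?d) + ennreal ?\<beta> * ?mom 0"
      by (subst nn_integral_add, measurable, subst nn_integral_cmult, measurable, subst nn_integral_cmult, measurable,
          subst (1 2) envelope_moment_svol[OF N0(1)], rule refl)
    also have "\<dots> = ennreal (?\<alpha> * enn2real (?mom (s / ?d)) + ?\<beta> * enn2real (?mom 0))"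
      unfolding ennreal_plus[OF mult_nonneg_nonneg[OF nn(1) enn2real_nonneg] mult_nonneg_nonneg[OF nn(2) enn2real_nonneg]]
        ennreal_mult[OF nn(1) enn2real_nonneg] ennreal_mult[OF nn(2) enn2real_nonneg] em ..
    also have "\<dots> \<le> ennreal (B * real N powr - (s / ?d))"
    proof (rule ennreal_leI)
      have "s / ?d \<le> 1" using s_le s_pos by (simp add: divide_le_eq) (smt (verit) DIM_ge_Suc0 One_nat_def of_nat_1 of_nat_le_iff)
      then have "real N powr - 1 \<le> real N powr - (s / ?d)" using N0 by (intro powr_mono) auto
      then have i: "1 / real N \<le> real N powr - (s / ?d)" using N0 by (simp add: powr_minus_divide)
      have "A * V * enn2real (?mom 0) * (1 / real N) \<le> A * V * enn2real (?mom 0) * real N powr - (s / ?d)"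
        using A V by (intro mult_left_mono i) auto
      then show "?\<alpha> * enn2real (?mom (s / ?d)) + ?\<beta> * enn2real (?mom 0) \<le> B * real N powr - (s / ?d)"
        by (simp add: B_def algebra_simps)
    qed
    finally show "(\<integral>\<^sup>+x. indicator S x * (\<integral>\<^sup>+z. ennreal (?E x z) \<partial>lborel) \<partial>lborel) \<le> ennreal (B * real N powr - (s / ?d))" .
  qed
qed

end

section \<open>The functional as a kernel integral\<close>

abbreviation leb2 :: "('a::euclidean_space \<times> 'a) measure" where
  "leb2 \<equiv> lborel \<Otimes>\<^sub>M lborel"

abbreviation leb3 :: "('a::euclidean_space \<times> 'a \<times> 'a) measure" where
  "leb3 \<equiv> lborel \<Otimes>\<^sub>M leb2"

lemma nn_integral_svol_pair:
  fixes h :: "real \<times> real \<Rightarrow> ennreal"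
  assumes N: "N > 0" "n > 0" and [measurable]: "h \<in> borel_measurable (borel \<Otimes>\<^sub>M borel)"
  shows "(\<integral>\<^sup>+(z::'a::euclidean_space, w). ennreal (real N) * (ennreal (real n) * h (svol N z, svol n w)) \<partial>leb2)
    = (\<integral>\<^sup>+(u, v). h (u, v) * indicator {0..} v * indicator {0..} u \<partial>leb2)"
proof -
  have "(\<integral>\<^sup>+(w::'a). ennreal (real N) * (ennreal (real n) * h (svol N z, svol n w)) \<partial>lborel)
      = ennreal (real N) * (\<integral>\<^sup>+v. h (svol N z, v) * indicator {0..} v \<partial>lborel)" for z :: 'a
    using nn_integral_svol[OF N(2), of "\<lambda>v. h (svol N z, v)", where 'a='a] by (subst nn_integral_cmult) auto
  then have "(\<integral>\<^sup>+(z::'a, w). ennreal (real N) * (ennreal (real n) * h (svol N z, svol n w)) \<partial>leb2)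
    = (\<integral>\<^sup>+(z::'a). ennreal (real N) * (\<integral>\<^sup>+v. h (svol N z, v) * indicator {0..} v \<partial>lborel) \<partial>lborel)"
    by (subst lborel.nn_integral_fst[symmetric]) auto
  also have "\<dots> = (\<integral>\<^sup>+u. (\<integral>\<^sup>+v. h (u, v) * indicator {0..} v \<partial>lborel) * indicator {0..} u \<partial>lborel)"
    by (rule nn_integral_svol[OF N(1)]) measurable
  also have "\<dots> = (\<integral>\<^sup>+u. (\<integral>\<^sup>+v. h (u, v) * indicator {0..} v * indicator {0..} u \<partial>lborel) \<partial>lborel)"
    by (intro nn_integral_cong nn_integral_multc[symmetric]) measurable
  also have "\<dots> = (\<integral>\<^sup>+(u, v). h (u, v) * indicator {0..} v * indicator {0..} u \<partial>leb2)"
    by (subst lborel.nn_integral_fst[symmetric]) auto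
  finally show ?thesis .
qed

lemma distr_svol_pair:
  assumes N: "N > 0" "n > 0"
  shows "distr (density leb2 (\<lambda>_. ennreal (real N * real n))) borel (\<lambda>(z::'a::euclidean_space, w). (svol N z, svol n w))
    = density lborel (\<lambda>(u, v). ennreal (indicator {0..} v * indicator {0..} u))" (is "distr ?D borel ?T = density lborel ?g")
proof (rule measure_eqI)
  fix A assume "A \<in> sets (distr ?D borel ?T)"
  then have A' [measurable]: "A \<in> sets (borel :: (real \<times> real) measure)" by simp
  then have A: "A \<in> sets (borel \<Otimes>\<^sub>M borel)" unfolding borel_prod .
  have T: "?T \<in> leb2 \<rightarrow>\<^sub>M borel"
    by (subst borel_prod[symmetric]) measurable
  have g: "?g \<in> borel_measurable (borel :: (real \<times> real) measure)"
    by (subst borel_prod[symmetric]) measurable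
  have "emeasure (distr ?D borel ?T) A = (\<integral>\<^sup>+x. indicator A x \<partial>distr ?D borel ?T)"
    by simp
  also have "\<dots> = (\<integral>\<^sup>+x. indicator A (?T x) \<partial>?D)"
    using T by (subst nn_integral_distr) (auto simp del: nn_integral_indicator)
  also have "\<dots> = (\<integral>\<^sup>+x. ennreal (real N * real n) * indicator A (?T x) \<partial>leb2)"
    using measurable_compose[OF T borel_measurable_indicator[OF A']] by (subst nn_integral_density) auto
  also have "\<dots> = (\<integral>\<^sup>+(z::'a, w). ennreal (real N) * (ennreal (real n) * indicator A (svol N z, svol n w)) \<partial>leb2)"
    using N by (intro nn_integral_cong) (auto simp: ennreal_mult mult.assoc)
  also have "\<dots> = (\<integral>\<^sup>+(u, v). indicator A (u, v) * indicator {0..} v * indicator {0..} u \<partial>leb2)"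
    using A by (intro nn_integral_svol_pair N) auto
  also have "\<dots> = (\<integral>\<^sup>+x. ?g x * indicator A x \<partial>lborel)"
    unfolding lborel_prod by (intro nn_integral_cong) (auto simp: indicator_def)
  also have "\<dots> = emeasure (density lborel ?g) A"
    using A' g by (subst emeasure_density) auto
  finally show "emeasure (distr ?D borel ?T) A = emeasure (density lborel ?g) A" .
qed simp

lemma integral_svol_pair:
  fixes H :: "real \<times> real \<Rightarrow> real"
  assumes N: "N > 0" "n > 0" and [measurable]: "H \<in> borel_measurable borel"
  shows "(\<integral>(z::'a::euclidean_space, w). real N * real n * H (svol N z, svol n w) \<partial>leb2)
    = (\<integral>(u, v). indicator {0..} v * indicator {0..} u * H (u, v) \<partial>lborel)"
proof -
  let ?T = "\<lambda>(z::'a, w::'a). (svol N z, svol n w)" and ?D = "density leb2 (\<lambda>_. ennreal (real N * real n))"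
  let ?g = "\<lambda>(u, v). indicator {0..} v * indicator {0..} u :: real"
  have T: "?T \<in> leb2 \<rightarrow>\<^sub>M borel"
    by (subst borel_prod[symmetric]) measurable
  have HT: "(\<lambda>x. H (?T x)) \<in> borel_measurable leb2"
    by (rule measurable_compose[OF T]) measurable
  have g: "?g \<in> borel_measurable (borel :: (real \<times> real) measure)"
    by (subst borel_prod[symmetric]) measurable
  have "(\<integral>(z::'a, w). real N * real n * H (svol N z, svol n w) \<partial>leb2) = (\<integral>x. (real N * real n) *\<^sub>R H (?T x) \<partial>leb2)"
    by (intro Bochner_Integration.integral_cong) auto
  also have "\<dots> = (\<integral>x. H (?T x) \<partial>?D)"
    using N HT by (subst integral_density) auto
  also have "\<dots> = (\<integral>x. H x \<partial>distr ?D borel ?T)"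
    using T by (subst integral_distr) auto
  also have "\<dots> = (\<integral>x. H x \<partial>density lborel (\<lambda>x. ennreal (?g x)))"
    unfolding distr_svol_pair[OF N] by (simp add: case_prod_unfold)
  also have "\<dots> = (\<integral>x. ?g x *\<^sub>R H x \<partial>lborel)"
    using g by (subst integral_density) auto
  also have "\<dots> = (\<integral>(u, v). indicator {0..} v * indicator {0..} u * H (u, v) \<partial>lborel)"
    by (intro Bochner_Integration.integral_cong) auto
  finally show ?thesis .
qed

text \<open>Measurability of \<open>\<phi>\<close> on the open quadrant is part of the integrability of its Laplace
  integrand, because the weight there is positive.\<close>

lemma estimator_function_measurable:
  assumes "is_estimator_function k l f \<phi>"
  shows "(\<lambda>(u, v). on_quadrant \<phi> u v) \<in> borel_measurable (borel :: (real \<times> real) measure)"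
proof -
  let ?F = "\<lambda>(u, v). u ^ (k - 1) * v ^ (l - 1) * \<phi> u v * exp (- 1 * u - 1 * v)"
  let ?G = "\<lambda>(u, v). exp (u + v) / (u ^ (k - 1) * v ^ (l - 1)) :: real"
  have "set_integrable lborel ({0<..} \<times> {0<..}) ?F"
    by (rule assms[unfolded is_estimator_function_def, rule_format, OF zero_less_one zero_less_one, THEN conjunct1])
  then have F: "(\<lambda>x. indicator ({0<..} \<times> {0<..}) x *\<^sub>R ?F x) \<in> borel_measurable (borel :: (real \<times> real) measure)"
    unfolding set_integrable_def by (auto dest: borel_measurable_integrable)
  have G: "?G \<in> borel_measurable (borel :: (real \<times> real) measure)"
    by (subst borel_prod[symmetric]) measurable
  have "(\<lambda>(u, v). on_quadrant \<phi> u v) x = (indicator ({0<..} \<times> {0<..}) x *\<^sub>R ?F x) * ?G x" for x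
  proof (cases x)
    case (Pair u v)
    have "exp (- u - v) * exp (u + v) = 1" by (simp flip: exp_add)
    then show ?thesis unfolding Pair by (auto simp: on_quadrant_def indicator_def field_simps)
  qed
  then show ?thesis using borel_measurable_times[OF F G] by presburger
qed

text \<open>Passing to the rescaled volumes turns the left-hand side into the Laplace integral at
  \<open>(p x, q x)\<close>.\<close>

lemma gamma_kernel_integral:
  fixes p q :: "'a::euclidean_space \<Rightarrow> real"
  assumes est: "is_estimator_function k l f \<phi>" and k: "k \<ge> 1" "l \<ge> 1"
    and pos: "p x > 0" "q x > 0" and N: "N > 0" "n > 0"
  shows "(\<integral>(z, w). on_quadrant \<phi> (svol N z) (svol n w) * (gamma_kernel p N k x z * gamma_kernel q n l x w) \<partial>leb2)
    = f (p x) (q x)"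
proof -
  define H where "H = (\<lambda>(u, v). on_quadrant \<phi> u v * (p x * pois k (p x * u) * (q x * pois l (q x * v))))"
  have H: "H \<in> borel_measurable borel"
  proof -
    have "(\<lambda>(u, v). p x * pois k (p x * u) * (q x * pois l (q x * v))) \<in> borel_measurable (borel :: (real \<times> real) measure)"
      by (subst borel_prod[symmetric]) measurable
    from borel_measurable_times[OF estimator_function_measurable[OF est] this]
    show ?thesis by (simp add: H_def case_prod_unfold)
  qed
  let ?A = "p x ^ k * q x ^ l / (Gamma (real k) * Gamma (real l))"
  have G: "Gamma (real k) = fact (k - 1)" "Gamma (real l) = fact (l - 1)"
    using k Gamma_fact[of "k - 1", where 'a=real] Gamma_fact[of "l - 1", where 'a=real] by (simp_all add: of_nat_diff)
  have pw: "p x ^ k = p x * p x ^ (k - 1)" "q x ^ l = q x * q x ^ (l - 1)"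
    using k by (simp_all flip: power_Suc)
  have "(\<integral>(z, w). on_quadrant \<phi> (svol N z) (svol n w) * (gamma_kernel p N k x z * gamma_kernel q n l x w) \<partial>leb2)
     = (\<integral>(z::'a, w). real N * real n * H (svol N z, svol n w) \<partial>leb2)"
    by (intro Bochner_Integration.integral_cong) (auto simp: H_def gamma_kernel_def mult.assoc mult.commute mult.left_commute)
  also have "\<dots> = (\<integral>(u, v). indicator {0..} v * indicator {0..} u * H (u, v) \<partial>lborel)"
    using N by (intro integral_svol_pair H) auto
  also have "\<dots> = (\<integral>w. ?A * (indicator ({0<..} \<times> {0<..}) w *\<^sub>R (case w of (u, v) \<Rightarrow> u ^ (k - 1) * v ^ (l - 1) * \<phi> u v * exp (- p x * u - q x * v))) \<partial>lborel)"
  proof (intro Bochner_Integration.integral_cong refl)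
    fix w :: "real \<times> real"
    obtain u v where w: "w = (u, v)" by fastforce
    show "(case w of (u, v) \<Rightarrow> indicator {0..} v * indicator {0..} u * H (u, v))
       = ?A * (indicator ({0<..} \<times> {0<..}) w *\<^sub>R (case w of (u, v) \<Rightarrow> u ^ (k - 1) * v ^ (l - 1) * \<phi> u v * exp (- p x * u - q x * v)))"
    proof (cases "u > 0 \<and> v > 0")
      case True
      have "exp (- p x * u - q x * v) = exp (- (p x * u)) * exp (- (q x * v))" by (simp flip: exp_add)
      then show ?thesis using True
        unfolding w H_def pois_def G pw on_quadrant_def by (simp add: power_mult_distrib)
    next
      case False
      then show ?thesis by (auto simp: w H_def on_quadrant_def indicator_def)
    qed
  qed
  also have "\<dots> = ?A * (LINT (u, v) : {0<..} \<times> {0<..} | lborel. u ^ (k - 1) * v ^ (l - 1) * \<phi> u v * exp (- p x * u - q x * v))"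
    by (simp add: set_lebesgue_integral_def)
  also have "\<dots> = ?A * (Gamma (real k) * Gamma (real l) * (f (p x) (q x) / (p x ^ k * q x ^ l)))"
    using est pos unfolding is_estimator_function_def by simp
  also have "\<dots> = f (p x) (q x)" using pos G by simp
  finally show ?thesis .
qed

lemma nn_integral_pair_mult:
  fixes f g :: "'a::euclidean_space \<Rightarrow> ennreal"
  assumes [measurable]: "f \<in> borel_measurable borel" "g \<in> borel_measurable borel"
  shows "(\<integral>\<^sup>+(z, w). f z * g w \<partial>leb2) = (\<integral>\<^sup>+z. f z \<partial>lborel) * (\<integral>\<^sup>+w. g w \<partial>lborel)"
proof -
  have "(\<integral>\<^sup>+(z, w). f z * g w \<partial>leb2) = (\<integral>\<^sup>+z. (\<integral>\<^sup>+w. f z * g w \<partial>lborel) \<partial>lborel)"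
    by (subst lborel.nn_integral_fst[symmetric]) auto
  then show ?thesis by (simp add: nn_integral_cmult nn_integral_multc)
qed

text \<open>The integrand of the functional agrees with a Borel function outside a null set, where \<open>f\<close> is
  uncontrolled; in the completed measure this suffices.\<close>

lemma integral_lebesgue_cong_AE:
  fixes f g :: "'a::euclidean_space \<Rightarrow> real"
  assumes ae: "AE x in lborel. f x = g x" and g: "g \<in> borel_measurable borel"
  shows "(\<integral>x. f x \<partial>lebesgue) = (\<integral>x. g x \<partial>lborel)"
proof -
  obtain Z where Z: "Z \<in> null_sets lborel" "{x. f x \<noteq> g x} \<subseteq> Z"
    using ae by (auto simp: eventually_ae_filter)
  have gm: "g \<in> borel_measurable lebesgue" using g by (intro measurable_completion) auto
  have fm: "f \<in> borel_measurable lebesgue"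
  proof (rule measurableI)
    fix A :: "real set" assume A: "A \<in> sets borel"
    have "f -` A \<inter> space lebesgue = (g -` A \<inter> space lebesgue - Z) \<union> (f -` A \<inter> Z)"
      using Z(2) by auto
    moreover have "g -` A \<inter> space lebesgue \<in> sets lebesgue" using gm A by (rule measurable_sets)
    moreover have "Z \<in> sets lebesgue" using Z(1) by (auto simp: null_sets_def)
    moreover have "f -` A \<inter> Z \<in> sets lebesgue"
      by (rule null_sets_completion[OF Z(1)]) auto
    ultimately show "f -` A \<inter> space lebesgue \<in> sets lebesgue" by (metis sets.Un sets.Diff)
  qed auto
  have "(\<integral>x. f x \<partial>lebesgue) = (\<integral>x. g x \<partial>lebesgue)"
    using fm gm AE_completion[OF ae] by (rule integral_cong_AE)
  also have "\<dots> = (\<integral>x. g x \<partial>lborel)" using g by (intro integral_completion) auto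
  finally show ?thesis .
qed

definition kernel_integrand where
  "kernel_integrand \<phi> p k\<^sub>1 k\<^sub>2 N n = (\<lambda>(x, z, w). on_quadrant \<phi> (svol N z) (svol n w) * (p x * (k\<^sub>1 x z * k\<^sub>2 x w)))"

abbreviation "nn_integrand \<phi> k l N n p q \<equiv> kernel_integrand \<phi> p (nn_kernel p N k) (nn_kernel q n l) N n"

abbreviation "gamma_integrand \<phi> k l N n p q \<equiv> kernel_integrand \<phi> p (gamma_kernel p N k) (gamma_kernel q n l) N n"

lemma mult_diff_bound:
  fixes a b c d :: real
  assumes "0 \<le> c" "0 \<le> b"
  shows "\<bar>a * c - b * d\<bar> \<le> \<bar>a - b\<bar> * c + b * \<bar>c - d\<bar>"
proof -
  have "a * c - b * d = (a - b) * c + b * (c - d)" by (simp add: algebra_simps)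
  then have "\<bar>a * c - b * d\<bar> \<le> \<bar>(a - b) * c\<bar> + \<bar>b * (c - d)\<bar>" by (metis abs_triangle_ineq)
  then show ?thesis using assms by (simp add: abs_mult)
qed

text \<open>The difference of the two products of kernels is split by \<open>mult_diff_bound\<close>, so that one
  factor of each summand is a kernel with bounded moment and the other one a kernel difference. The
  density \<open>p\<close> vanishes outside \<open>S\<^sub>p\<close>, which lies in \<open>S\<^sub>q\<close>; hence the bounds for \<open>q\<close> on \<open>S\<^sub>q\<close> apply.\<close>

lemma kernel_functional_difference:
  fixes p q :: "'a::euclidean_space \<Rightarrow> real" and f \<phi> :: "real \<Rightarrow> real \<Rightarrow> real"
  assumes P: "tame_density p S\<^sub>p c\<^sub>p C\<^sub>p K\<^sub>p s\<^sub>p" and Q: "tame_density q S\<^sub>q c\<^sub>q C\<^sub>q K\<^sub>q s\<^sub>q"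
    and sub: "S\<^sub>p \<subseteq> S\<^sub>q" and k: "k \<ge> 1" "l \<ge> 1" "real k > - a" "real l > - a'"
    and est: "is_estimator_function k l f \<phi>"
    and env: "\<And>u v. u > 0 \<Longrightarrow> v > 0 \<Longrightarrow> \<bar>\<phi> u v\<bar> \<le> C * poly_envelope a b u * poly_envelope a' b' v"
  obtains B where "B \<ge> 0"
    "\<And>N n. k \<le> N \<Longrightarrow> l \<le> n \<Longrightarrow> integrable leb3 (nn_integrand \<phi> k l N n p q)"
    "\<And>N n. k \<le> N \<Longrightarrow> l \<le> n \<Longrightarrow> \<bar>(\<integral>t. nn_integrand \<phi> k l N n p q t \<partial>leb3) - density_functional f p q\<bar>
        \<le> B * (real N powr - (s\<^sub>p / real DIM('a)) + real n powr - (s\<^sub>q / real DIM('a)))"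
proof -
  interpret p: tame_density p S\<^sub>p c\<^sub>p C\<^sub>p K\<^sub>p s\<^sub>p by (rule P)
  interpret q: tame_density q S\<^sub>q c\<^sub>q C\<^sub>q K\<^sub>q s\<^sub>q by (rule Q)
  have L2: "sigma_finite_measure (leb2 :: ('a \<times> 'a) measure)"
    unfolding lborel_prod by standard
  interpret pr: pair_sigma_finite "lborel :: 'a measure" "leb2 :: ('a \<times> 'a) measure"
    unfolding lborel_prod by standard
  let ?d = "real DIM('a)"
  let ?\<Phi> = "on_quadrant \<phi>" and ?\<psi> = "\<lambda>N z. poly_envelope a b (svol N z)" and ?\<psi>' = "\<lambda>n w. poly_envelope a' b' (svol n w)"
  obtain Bp where Bp: "Bp \<ge> 0"
    "\<And>N x. k \<le> N \<Longrightarrow> x \<in> S\<^sub>p \<Longrightarrow> (\<integral>\<^sup>+z. ennreal (?\<psi> N z * nn_kernel p N k x z) \<partial>lborel) \<le> ennreal Bp"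
    "\<And>N x. k \<le> N \<Longrightarrow> x \<in> S\<^sub>p \<Longrightarrow> p x \<le> C\<^sub>p \<Longrightarrow> (\<integral>\<^sup>+z. ennreal (?\<psi> N z * gamma_kernel p N k x z) \<partial>lborel) \<le> ennreal Bp"
    by (rule p.kernel_moment_bound[OF k(1,3)], rule that) assumption+
  obtain Bq where Bq: "Bq \<ge> 0"
    "\<And>n x. l \<le> n \<Longrightarrow> x \<in> S\<^sub>q \<Longrightarrow> (\<integral>\<^sup>+z. ennreal (?\<psi>' n z * nn_kernel q n l x z) \<partial>lborel) \<le> ennreal Bq"
    "\<And>n x. l \<le> n \<Longrightarrow> x \<in> S\<^sub>q \<Longrightarrow> q x \<le> C\<^sub>q \<Longrightarrow> (\<integral>\<^sup>+z. ennreal (?\<psi>' n z * gamma_kernel q n l x z) \<partial>lborel) \<le> ennreal Bq"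
    by (rule q.kernel_moment_bound[OF k(2,4)], rule that) assumption+
  define ep where "ep N x = (\<integral>\<^sup>+z. ennreal (?\<psi> N z * \<bar>nn_kernel p N k x z - gamma_kernel p N k x z\<bar>) \<partial>lborel)" for N x
  define eq where "eq n x = (\<integral>\<^sup>+z. ennreal (?\<psi>' n z * \<bar>nn_kernel q n l x z - gamma_kernel q n l x z\<bar>) \<partial>lborel)" for n x
  have [measurable]: "ep N \<in> borel_measurable borel" "eq N \<in> borel_measurable borel" for N
    unfolding ep_def eq_def by measurable
  obtain Ep where Ep: "Ep \<ge> 0"
    "\<And>N. k \<le> N \<Longrightarrow> (\<integral>\<^sup>+x. indicator S\<^sub>p x * ep N x \<partial>lborel) \<le> ennreal (Ep * real N powr - (s\<^sub>p / ?d))"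
    by (rule p.kernel_error_bound[where b = b, OF k(1,3), folded ep_def], rule that) assumption+
  obtain Eq where Eq: "Eq \<ge> 0"
    "\<And>n. l \<le> n \<Longrightarrow> (\<integral>\<^sup>+x. indicator S\<^sub>q x * eq n x \<partial>lborel) \<le> ennreal (Eq * real n powr - (s\<^sub>q / ?d))"
    by (rule q.kernel_error_bound[where b = b', OF k(2,4), folded eq_def], rule that) assumption+
  have C0: "C \<ge> 0" using env[of 1 1] by (simp add: poly_envelope_def)
  have \<Phi>_bound: "\<bar>?\<Phi> u v\<bar> \<le> C * (poly_envelope a b u * poly_envelope a' b' v)" for u v
    using env[of u v] C0 by (auto simp: on_quadrant_def mult.assoc poly_envelope_nonneg)
  have \<Phi>m: "(\<lambda>(u, v). ?\<Phi> u v) \<in> borel_measurable (borel \<Otimes>\<^sub>M borel)"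
    using estimator_function_measurable[OF est] by (simp add: borel_prod)
  have [measurable (raw)]: "(\<lambda>t. ?\<Phi> (h t) (h' t)) \<in> borel_measurable M"
    if "h \<in> borel_measurable M" "h' \<in> borel_measurable M" for M and h h' :: "'b \<Rightarrow> real"
    using measurable_compose[OF measurable_Pair[OF that] \<Phi>m] by simp
  have ae: "AE x in lborel. p x \<le> C\<^sub>p \<and> q x \<le> C\<^sub>q \<and> (x \<notin> S\<^sub>p \<longrightarrow> p x = 0)"
    using p.g_upper q.g_upper p.g_outside by eventually_elim auto
  have bound: "(\<integral>\<^sup>+t. ennreal \<bar>(case t of (x, z, w) \<Rightarrow> ?\<Phi> (svol N z) (svol n w) * (p x * D x z w))\<bar> \<partial>leb3)
      \<le> (\<integral>\<^sup>+x. ennreal (C * p x) * R x \<partial>lborel)"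
    if D [measurable]: "(\<lambda>(x, z, w). D x z w) \<in> borel_measurable (borel \<Otimes>\<^sub>M (borel \<Otimes>\<^sub>M borel))"
      and R: "AE x in lborel. x \<in> S\<^sub>p \<longrightarrow> (\<integral>\<^sup>+(z, w). ennreal (?\<psi> N z * ?\<psi>' n w * \<bar>D x z w\<bar>) \<partial>leb2) \<le> R x"
    for N n D R
  proof -
    have [measurable (raw)]: "(\<lambda>t. D (f1 t) (f2 t) (f3 t)) \<in> borel_measurable M'"
      if "f1 \<in> measurable M' borel" "f2 \<in> measurable M' borel" "f3 \<in> measurable M' borel" for M' f1 f2 f3
      using measurable_compose[OF measurable_Pair[OF that(1) measurable_Pair[OF that(2,3)]] D] by simp
    let ?D = "\<lambda>x z w. ennreal (?\<psi> N z * ?\<psi>' n w * \<bar>D x z w\<bar>)"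
    have "(\<integral>\<^sup>+t. ennreal \<bar>(case t of (x, z, w) \<Rightarrow> ?\<Phi> (svol N z) (svol n w) * (p x * D x z w))\<bar> \<partial>leb3)
      \<le> (\<integral>\<^sup>+t. (case t of (x, z, w) \<Rightarrow> ennreal (C * p x) * ?D x z w) \<partial>leb3)"
    proof (intro nn_integral_mono, simp only: split_paired_all prod.case)
      fix x z w :: 'a
      have "\<bar>?\<Phi> (svol N z) (svol n w) * (p x * D x z w)\<bar> = \<bar>?\<Phi> (svol N z) (svol n w)\<bar> * (p x * \<bar>D x z w\<bar>)"
        by (simp add: abs_mult p.g_nonneg)
      also have "\<dots> \<le> C * (?\<psi> N z * ?\<psi>' n w) * (p x * \<bar>D x z w\<bar>)"
        by (intro mult_right_mono \<Phi>_bound) (simp add: p.g_nonneg)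
      also have "\<dots> = (C * p x) * (?\<psi> N z * ?\<psi>' n w * \<bar>D x z w\<bar>)" by simp
      finally have "ennreal \<bar>?\<Phi> (svol N z) (svol n w) * (p x * D x z w)\<bar> \<le> ennreal ((C * p x) * (?\<psi> N z * ?\<psi>' n w * \<bar>D x z w\<bar>))"
        by (rule ennreal_leI)
      also have "\<dots> = ennreal (C * p x) * ?D x z w"
        by (intro ennreal_mult') (simp add: C0 p.g_nonneg)
      finally show "ennreal \<bar>?\<Phi> (svol N z) (svol n w) * (p x * D x z w)\<bar> \<le> ennreal (C * p x) * ?D x z w" .
    qed
    also have "\<dots> = (\<integral>\<^sup>+x. (\<integral>\<^sup>+(z, w). ennreal (C * p x) * ?D x z w \<partial>leb2) \<partial>lborel)"
      by (subst sigma_finite_measure.nn_integral_fst[OF L2, symmetric]) (auto simp: case_prod_unfold)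
    also have "\<dots> \<le> (\<integral>\<^sup>+x. ennreal (C * p x) * R x \<partial>lborel)"
    proof (rule nn_integral_mono_AE, use R ae in eventually_elim)
      case (elim x)
      have "(\<integral>\<^sup>+(z, w). ennreal (C * p x) * ?D x z w \<partial>leb2) = ennreal (C * p x) * (\<integral>\<^sup>+(z, w). ?D x z w \<partial>leb2)"
        by (subst nn_integral_cmult[symmetric]) (auto simp: case_prod_unfold)
      also have "\<dots> \<le> ennreal (C * p x) * R x"
        using elim by (cases "x \<in> S\<^sub>p") (auto intro: mult_left_mono)
      finally show ?case .
    qed
    finally show ?thesis .
  qed
  have integ: "integrable leb3 (kernel_integrand \<phi> p k\<^sub>1 k\<^sub>2 N n)"
    if [measurable]: "(\<lambda>(x, z). k\<^sub>1 x z) \<in> borel_measurable (borel \<Otimes>\<^sub>M borel)" "(\<lambda>(x, z). k\<^sub>2 x z) \<in> borel_measurable (borel \<Otimes>\<^sub>M borel)"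
      and nonneg: "\<And>x z. 0 \<le> k\<^sub>1 x z" "\<And>x z. 0 \<le> k\<^sub>2 x z"
      and mom: "\<And>x. x \<in> S\<^sub>p \<Longrightarrow> p x \<le> C\<^sub>p \<Longrightarrow> (\<integral>\<^sup>+z. ennreal (?\<psi> N z * k\<^sub>1 x z) \<partial>lborel) \<le> ennreal Bp"
        "\<And>x. x \<in> S\<^sub>p \<Longrightarrow> q x \<le> C\<^sub>q \<Longrightarrow> (\<integral>\<^sup>+w. ennreal (?\<psi>' n w * k\<^sub>2 x w) \<partial>lborel) \<le> ennreal Bq"
    for k\<^sub>1 k\<^sub>2 N n
  proof (rule integrableI_bounded)
    show "kernel_integrand \<phi> p k\<^sub>1 k\<^sub>2 N n \<in> borel_measurable leb3" unfolding kernel_integrand_def by measurable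
    have "(\<integral>\<^sup>+t. ennreal (norm (kernel_integrand \<phi> p k\<^sub>1 k\<^sub>2 N n t)) \<partial>leb3) \<le> (\<integral>\<^sup>+x. ennreal (C * p x) * ennreal (Bp * Bq) \<partial>lborel)"
      unfolding kernel_integrand_def real_norm_def
    proof (rule bound, measurable, use ae in \<open>eventually_elim, intro impI\<close>)
      fix x assume ax: "p x \<le> C\<^sub>p \<and> q x \<le> C\<^sub>q \<and> (x \<notin> S\<^sub>p \<longrightarrow> p x = 0)" and x: "x \<in> S\<^sub>p"
      have "(\<integral>\<^sup>+(z, w). ennreal (?\<psi> N z * ?\<psi>' n w * \<bar>k\<^sub>1 x z * k\<^sub>2 x w\<bar>) \<partial>leb2)
        = (\<integral>\<^sup>+(z, w). ennreal (?\<psi> N z * k\<^sub>1 x z) * ennreal (?\<psi>' n w * k\<^sub>2 x w) \<partial>leb2)"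
        by (intro nn_integral_cong) (auto simp: ennreal_mult[symmetric] poly_envelope_nonneg nonneg abs_mult ac_simps)
      also have "\<dots> = (\<integral>\<^sup>+z. ennreal (?\<psi> N z * k\<^sub>1 x z) \<partial>lborel) * (\<integral>\<^sup>+w. ennreal (?\<psi>' n w * k\<^sub>2 x w) \<partial>lborel)"
        by (rule nn_integral_pair_mult) measurable
      also have "\<dots> \<le> ennreal Bp * ennreal Bq"
        using mom x ax by (intro mult_mono) auto
      finally show "(\<integral>\<^sup>+(z, w). ennreal (?\<psi> N z * ?\<psi>' n w * \<bar>k\<^sub>1 x z * k\<^sub>2 x w\<bar>) \<partial>leb2) \<le> ennreal (Bp * Bq)"
        using Bp Bq by (simp add: ennreal_mult)
    qed
    also have "\<dots> = ennreal C * (\<integral>\<^sup>+x. ennreal (p x) \<partial>lborel) * ennreal (Bp * Bq)"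
      using C0 by (simp add: nn_integral_multc ennreal_mult' nn_integral_cmult)
    also have "(\<integral>\<^sup>+x. ennreal (p x) \<partial>lborel) = 1" using p.dens by (simp add: prob_density_def)
    finally show "(\<integral>\<^sup>+t. ennreal (norm (kernel_integrand \<phi> p k\<^sub>1 k\<^sub>2 N n t)) \<partial>leb3) < \<infinity>"
      by (rule le_less_trans) (simp add: ennreal_mult_less_top)
  qed
  have integ_nn: "integrable leb3 (nn_integrand \<phi> k l N n p q)" if "k \<le> N" "l \<le> n" for N n
    using Bp(2)[OF that(1)] Bq(2)[OF that(2)] sub
    by (intro integ p.kernel_measurable q.kernel_measurable p.nn_kernel_nonneg q.nn_kernel_nonneg) auto
  have integ_g: "integrable leb3 (gamma_integrand \<phi> k l N n p q)" if "k \<le> N" "l \<le> n" for N n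
    using Bp(3)[OF that(1)] Bq(3)[OF that(2)] sub
    by (intro integ p.kernel_measurable q.kernel_measurable p.gamma_kernel_nonneg q.gamma_kernel_nonneg) auto
  have Tf: "(\<integral>t. gamma_integrand \<phi> k l N n p q t \<partial>leb3) = density_functional f p q" if N: "k \<le> N" "l \<le> n" for N n
  proof -
    have N0: "N > 0" "n > 0" using N k by auto
    let ?J = "\<lambda>x. \<integral>y. gamma_integrand \<phi> k l N n p q (x, y) \<partial>leb2"
    have m: "gamma_integrand \<phi> k l N n p q \<in> borel_measurable leb3"
      unfolding kernel_integrand_def by measurable
    have mJ: "?J \<in> borel_measurable borel"
      using sigma_finite_measure.borel_measurable_lebesgue_integral[OF L2, of "\<lambda>x y. gamma_integrand \<phi> k l N n p q (x, y)" lborel] m by simp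
    have J: "AE x in lborel. f (p x) (q x) * p x = ?J x"
      using p.g_outside
    proof eventually_elim
      case (elim x)
      have "?J x = (\<integral>y. p x * (case y of (z, w) \<Rightarrow> ?\<Phi> (svol N z) (svol n w) * (gamma_kernel p N k x z * gamma_kernel q n l x w)) \<partial>leb2)"
        by (intro Bochner_Integration.integral_cong) (auto simp: kernel_integrand_def)
      also have "\<dots> = p x * (\<integral>(z, w). ?\<Phi> (svol N z) (svol n w) * (gamma_kernel p N k x z * gamma_kernel q n l x w) \<partial>leb2)"
        by simp
      also have "\<dots> = p x * f (p x) (q x)"
      proof (cases "x \<in> S\<^sub>p")
        case True
        then have "p x > 0" "q x > 0" using p.g_lower[of x] q.g_lower[of x] p.c_pos q.c_pos sub by auto
        then show ?thesis using gamma_kernel_integral[OF est k(1,2) _ _ N0, of p x q] by simp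
      qed (use elim in simp)
      finally show ?case by simp
    qed
    have "density_functional f p q = (\<integral>x. ?J x \<partial>lborel)"
      unfolding density_functional_def by (rule integral_lebesgue_cong_AE[OF J mJ])
    also have "\<dots> = (\<integral>t. gamma_integrand \<phi> k l N n p q t \<partial>leb3)"
      by (rule pr.integral_fst'[OF integ_g[OF N]])
    finally show ?thesis ..
  qed
  define B1 where "B1 = C * C\<^sub>p * Bq * Ep"
  define B2 where "B2 = C * C\<^sub>p * Bp * Eq"
  have nnB: "B1 \<ge> 0" "B2 \<ge> 0" using C0 p.C_pos Bp Bq Ep Eq by (auto simp: B1_def B2_def)
  have diff: "\<bar>(\<integral>t. nn_integrand \<phi> k l N n p q t \<partial>leb3) - density_functional f p q\<bar>
        \<le> (B1 + B2) * (real N powr - (s\<^sub>p / ?d) + real n powr - (s\<^sub>q / ?d))" if N: "k \<le> N" "l \<le> n" for N n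
  proof -
    let ?F = "nn_integrand \<phi> k l N n p q" and ?G = "gamma_integrand \<phi> k l N n p q"
    let ?rN = "real N powr - (s\<^sub>p / ?d)" and ?rn = "real n powr - (s\<^sub>q / ?d)"
    let ?D = "\<lambda>x z w. nn_kernel p N k x z * nn_kernel q n l x w - gamma_kernel p N k x z * gamma_kernel q n l x w"
    have eqD: "?F t - ?G t = (case t of (x, z, w) \<Rightarrow> ?\<Phi> (svol N z) (svol n w) * (p x * ?D x z w))" for t
      by (cases t) (auto simp: kernel_integrand_def algebra_simps)
    have "(\<integral>\<^sup>+t. ennreal \<bar>?F t - ?G t\<bar> \<partial>leb3) \<le> (\<integral>\<^sup>+x. ennreal (C * p x) * (ep N x * ennreal Bq + ennreal Bp * eq n x) \<partial>lborel)"
      unfolding eqD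
    proof (rule bound, measurable, use ae in \<open>eventually_elim, intro impI\<close>)
      fix x assume ax: "p x \<le> C\<^sub>p \<and> q x \<le> C\<^sub>q \<and> (x \<notin> S\<^sub>p \<longrightarrow> p x = 0)" and x: "x \<in> S\<^sub>p"
      let ?\<Delta>p = "\<lambda>z. \<bar>nn_kernel p N k x z - gamma_kernel p N k x z\<bar>" and ?\<Delta>q = "\<lambda>w. \<bar>nn_kernel q n l x w - gamma_kernel q n l x w\<bar>"
      let ?h1 = "\<lambda>z. ennreal (?\<psi> N z * ?\<Delta>p z)" and ?h2 = "\<lambda>w. ennreal (?\<psi>' n w * nn_kernel q n l x w)"
      let ?h3 = "\<lambda>z. ennreal (?\<psi> N z * gamma_kernel p N k x z)" and ?h4 = "\<lambda>w. ennreal (?\<psi>' n w * ?\<Delta>q w)"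
      have "(\<integral>\<^sup>+(z, w). ennreal (?\<psi> N z * ?\<psi>' n w * \<bar>?D x z w\<bar>) \<partial>leb2)
        \<le> (\<integral>\<^sup>+y. (case y of (z, w) \<Rightarrow> ?h1 z * ?h2 w) + (case y of (z, w) \<Rightarrow> ?h3 z * ?h4 w) \<partial>leb2)"
      proof (intro nn_integral_mono, simp only: split_paired_all prod.case)
        fix z w :: 'a
        let ?a = "?\<psi> N z" and ?b = "?\<psi>' n w"
        have ab: "?a \<ge> 0" "?b \<ge> 0" by (auto simp: poly_envelope_nonneg)
        have "?a * ?b * \<bar>?D x z w\<bar> \<le> ?a * ?b * (?\<Delta>p z * nn_kernel q n l x w + gamma_kernel p N k x z * ?\<Delta>q w)"
          using ab by (intro mult_left_mono mult_diff_bound q.nn_kernel_nonneg p.gamma_kernel_nonneg) auto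
        also have "\<dots> = (?a * ?\<Delta>p z) * (?b * nn_kernel q n l x w) + (?a * gamma_kernel p N k x z) * (?b * ?\<Delta>q w)"
          by (simp add: algebra_simps)
        finally have "ennreal (?a * ?b * \<bar>?D x z w\<bar>)
            \<le> ennreal ((?a * ?\<Delta>p z) * (?b * nn_kernel q n l x w) + (?a * gamma_kernel p N k x z) * (?b * ?\<Delta>q w))"
          by (rule ennreal_leI)
        also have "\<dots> = ?h1 z * ?h2 w + ?h3 z * ?h4 w"
          using ab by (subst ennreal_plus) (auto simp: ennreal_mult q.nn_kernel_nonneg p.gamma_kernel_nonneg)
        finally show "ennreal (?a * ?b * \<bar>?D x z w\<bar>) \<le> ?h1 z * ?h2 w + ?h3 z * ?h4 w" .
      qed
      also have "\<dots> = (\<integral>\<^sup>+(z, w). ?h1 z * ?h2 w \<partial>leb2) + (\<integral>\<^sup>+(z, w). ?h3 z * ?h4 w \<partial>leb2)"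
        by (intro nn_integral_add) measurable
      also have "(\<integral>\<^sup>+(z, w). ?h1 z * ?h2 w \<partial>leb2) = ep N x * (\<integral>\<^sup>+w. ?h2 w \<partial>lborel)"
        unfolding ep_def by (rule nn_integral_pair_mult) measurable
      also have "(\<integral>\<^sup>+(z, w). ?h3 z * ?h4 w \<partial>leb2) = (\<integral>\<^sup>+z. ?h3 z \<partial>lborel) * eq n x"
        unfolding eq_def by (rule nn_integral_pair_mult) measurable
      also have "ep N x * (\<integral>\<^sup>+w. ?h2 w \<partial>lborel) + (\<integral>\<^sup>+z. ?h3 z \<partial>lborel) * eq n x \<le> ep N x * ennreal Bq + ennreal Bp * eq n x"
        using Bp(3)[OF N(1) x] Bq(2)[OF N(2)] x sub ax
        by (intro add_mono mult_left_mono mult_right_mono) auto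
      finally show "(\<integral>\<^sup>+(z, w). ennreal (?\<psi> N z * ?\<psi>' n w * \<bar>?D x z w\<bar>) \<partial>leb2) \<le> ep N x * ennreal Bq + ennreal Bp * eq n x" .
    qed
    also have "\<dots> \<le> (\<integral>\<^sup>+x. ennreal (C * C\<^sub>p * Bq) * (indicator S\<^sub>p x * ep N x) + ennreal (C * C\<^sub>p * Bp) * (indicator S\<^sub>q x * eq n x) \<partial>lborel)"
    proof (rule nn_integral_mono_AE, use ae in eventually_elim)
      case ax: (elim x)
      show ?case
      proof (cases "x \<in> S\<^sub>p")
        case True
        have "ennreal (C * p x) * (ep N x * ennreal Bq + ennreal Bp * eq n x) \<le> ennreal (C * C\<^sub>p) * (ep N x * ennreal Bq + ennreal Bp * eq n x)"
          using ax C0 by (intro mult_right_mono ennreal_leI mult_left_mono) auto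
        also have "\<dots> = ennreal (C * C\<^sub>p * Bq) * ep N x + ennreal (C * C\<^sub>p * Bp) * eq n x"
          using C0 p.C_pos Bp Bq by (simp add: ennreal_mult distrib_left ac_simps)
        finally show ?thesis using True sub by (simp add: indicator_def subset_iff)
      qed (use ax in simp)
    qed
    also have "\<dots> = ennreal (C * C\<^sub>p * Bq) * (\<integral>\<^sup>+x. indicator S\<^sub>p x * ep N x \<partial>lborel) + ennreal (C * C\<^sub>p * Bp) * (\<integral>\<^sup>+x. indicator S\<^sub>q x * eq n x \<partial>lborel)"
      by (simp add: nn_integral_add nn_integral_cmult)
    also have "\<dots> \<le> ennreal (C * C\<^sub>p * Bq) * ennreal (Ep * ?rN) + ennreal (C * C\<^sub>p * Bp) * ennreal (Eq * ?rn)"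
      by (intro add_mono mult_left_mono Ep(2)[OF N(1)] Eq(2)[OF N(2)]) auto
    also have "\<dots> = ennreal (B1 * ?rN + B2 * ?rn)"
    proof -
      have nn: "0 \<le> C * C\<^sub>p * Bq" "0 \<le> Ep * ?rN" "0 \<le> C * C\<^sub>p * Bp" "0 \<le> Eq * ?rn"
        using C0 p.C_pos Bp Bq Ep Eq by auto
      show ?thesis
        unfolding ennreal_mult[OF nn(1,2), symmetric] ennreal_mult[OF nn(3,4), symmetric]
          ennreal_plus[OF mult_nonneg_nonneg[OF nn(1,2)] mult_nonneg_nonneg[OF nn(3,4)], symmetric]
        by (simp add: B1_def B2_def mult.assoc)
    qed
    finally have le: "(\<integral>\<^sup>+t. ennreal \<bar>?F t - ?G t\<bar> \<partial>leb3) \<le> ennreal (B1 * ?rN + B2 * ?rn)" .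
    have iFG: "integrable leb3 (\<lambda>t. ?F t - ?G t)" using integ_nn[OF N] integ_g[OF N] by (rule Bochner_Integration.integrable_diff)
    have "\<bar>(\<integral>t. ?F t \<partial>leb3) - density_functional f p q\<bar> = \<bar>\<integral>t. ?F t - ?G t \<partial>leb3\<bar>"
      using integ_nn[OF N] integ_g[OF N] by (simp add: Tf[OF N, symmetric])
    also have "\<dots> \<le> (\<integral>t. \<bar>?F t - ?G t\<bar> \<partial>leb3)"
      by (rule integral_abs_bound)
    also have "\<dots> \<le> B1 * ?rN + B2 * ?rn"
    proof -
      have "ennreal (\<integral>t. \<bar>?F t - ?G t\<bar> \<partial>leb3) = (\<integral>\<^sup>+t. ennreal \<bar>?F t - ?G t\<bar> \<partial>leb3)"
        using iFG by (intro nn_integral_eq_integral[symmetric]) auto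
      then have "ennreal (\<integral>t. \<bar>?F t - ?G t\<bar> \<partial>leb3) \<le> ennreal (B1 * ?rN + B2 * ?rn)"
        using le by simp
      then show ?thesis using nnB by (subst (asm) ennreal_le_iff) auto
    qed
    also have "\<dots> \<le> (B1 + B2) * (?rN + ?rn)"
      using nnB by (simp add: algebra_simps)
    finally show ?thesis .
  qed
  show ?thesis by (rule that[of "B1 + B2", OF _ integ_nn diff]) (use nnB in auto)
qed

section \<open>Ranks among independent points\<close>

text \<open>Expanding by the set of indices at which \<open>Q\<close> holds turns a condition on a count into a sum of
  products, and a product measure integrates each product factor by factor.\<close>

lemma of_bool_count_eq_sum:
  assumes "finite A"
  shows "(of_bool ((\<Sum>a\<in>A. of_bool (Q a) :: nat) = k) :: ennreal)
    = (\<Sum>A'\<in>{A'. A' \<subseteq> A \<and> card A' = k}. \<Prod>a\<in>A. of_bool (Q a = (a \<in> A')))"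
proof -
  let ?T = "{a \<in> A. Q a}"
  have cnt: "(\<Sum>a\<in>A. of_bool (Q a) :: nat) = card ?T"
    using assms by (simp add: Int_def conj_commute)
  have fin: "finite {A'. A' \<subseteq> A \<and> card A' = k}" using assms by auto
  have "(\<Sum>A'\<in>{A'. A' \<subseteq> A \<and> card A' = k}. \<Prod>a\<in>A. of_bool (Q a = (a \<in> A')))
      = (\<Sum>A'\<in>{A'. A' \<subseteq> A \<and> card A' = k}. if ?T = A' then 1 else (0::ennreal))"
  proof (intro sum.cong refl)
    fix A' assume A': "A' \<in> {A'. A' \<subseteq> A \<and> card A' = k}"
    show "(\<Prod>a\<in>A. of_bool (Q a = (a \<in> A'))) = (if ?T = A' then 1 else (0::ennreal))"
    proof (cases "?T = A'")
      case True
      then have "\<And>a. a \<in> A \<Longrightarrow> Q a = (a \<in> A')" by auto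
      then show ?thesis using True by simp
    next
      case False
      then obtain a where "a \<in> A" "Q a \<noteq> (a \<in> A')" using A' by auto
      then show ?thesis using False assms by (intro trans[OF prod_zero]) auto
    qed
  qed
  also have "\<dots> = of_bool (card ?T = k)"
    using fin by (simp add: sum.delta)
  finally show ?thesis unfolding cnt by simp
qed

lemma prod_of_bool_power:
  fixes x y :: real
  assumes "finite A" "A' \<subseteq> A" "0 \<le> x" "0 \<le> y"
  shows "(\<Prod>a\<in>A. if a \<in> A' then ennreal x else ennreal y) = ennreal (x ^ card A' * y ^ (card A - card A'))"
proof -
  have "(\<Prod>a\<in>A. if a \<in> A' then ennreal x else ennreal y) = ennreal x ^ card A' * ennreal y ^ card (A - A')"
    using assms by (simp add: prod.If_cases Int_absorb1 Diff_eq Int_commute)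
  also have "card (A - A') = card A - card A'"
    using assms by (intro card_Diff_subset) (auto intro: finite_subset)
  finally show ?thesis using assms by (simp add: ennreal_power ennreal_mult)
qed

definition binom_prob :: "nat \<Rightarrow> nat \<Rightarrow> real \<Rightarrow> real" where
  "binom_prob n k x = real (n choose k) * x ^ k * (1 - x) ^ (n - k)"

lemma prod_nn_integral_membership:
  assumes "prob_space P" "\<And>a. a \<in> A \<Longrightarrow> D a = P" "E \<in> sets P" "finite A" "A' \<subseteq> A"
  shows "(\<Prod>a\<in>A. \<integral>\<^sup>+y. of_bool ((y \<in> E) = (a \<in> A')) \<partial>D a)
    = ennreal (measure P E ^ card A' * (1 - measure P E) ^ (card A - card A'))"
proof -
  interpret P: prob_space P by fact
  have "(\<integral>\<^sup>+y. of_bool ((y \<in> E) = (a \<in> A')) \<partial>D a) = (if a \<in> A' then ennreal (measure P E) else ennreal (1 - measure P E))"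
    if "a \<in> A" for a
  proof -
    have "(\<integral>\<^sup>+y. of_bool ((y \<in> E) = (a \<in> A')) \<partial>D a) = (\<integral>\<^sup>+y. indicator (if a \<in> A' then E else space P - E) y \<partial>P)"
      unfolding assms(2)[OF that] by (intro nn_integral_cong) (auto simp: indicator_def)
    also have "\<dots> = emeasure P (if a \<in> A' then E else space P - E)"
      using assms(3) by (intro nn_integral_indicator) auto
    finally show ?thesis
      using assms(3) by (simp add: P.emeasure_eq_measure P.prob_compl)
  qed
  then show ?thesis
    using assms(4,5) by (simp add: prod_of_bool_power)
qed

lemma nn_integral_PiM_counts:
  fixes D :: "'i \<Rightarrow> 'a measure"
  assumes D: "\<And>c. prob_space (D c)"
    and fin: "finite A" "finite B" "A \<inter> B = {}"
    and Pm: "prob_space P" "\<And>a. a \<in> A \<Longrightarrow> D a = P" "E \<in> sets P"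
    and Q: "prob_space Q" "\<And>b. b \<in> B \<Longrightarrow> D b = Q" "F \<in> sets Q"
  shows "(\<integral>\<^sup>+\<omega>. of_bool ((\<Sum>a\<in>A. of_bool (\<omega> a \<in> E) :: nat) = k) * of_bool ((\<Sum>b\<in>B. of_bool (\<omega> b \<in> F) :: nat) = l) \<partial>PiM (A \<union> B) D)
    = ennreal (binom_prob (card A) k (measure P E) * binom_prob (card B) l (measure Q F))"
proof -
  interpret product_prob_space D UNIV by (simp add: D product_prob_spaceI)
  interpret PP: prob_space P by (rule Pm)
  interpret QQ: prob_space Q by (rule Q)
  let ?SA = "{A'. A' \<subseteq> A \<and> card A' = k}" and ?SB = "{B'. B' \<subseteq> B \<and> card B' = l}"
  define h where "h A' B' c y = (if c \<in> A then (of_bool ((y \<in> E) = (c \<in> A')) :: ennreal) else of_bool ((y \<in> F) = (c \<in> B')))" for A' B' c and y :: 'a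
  have hm: "h A' B' c \<in> borel_measurable (D c)" if "c \<in> A \<union> B" for A' B' c
  proof -
    have "(\<lambda>y. y \<in> E) \<in> measurable (D c) (count_space UNIV)" if "c \<in> A" using that Pm by (simp add: pred_sets1)
    moreover have "(\<lambda>y. y \<in> F) \<in> measurable (D c) (count_space UNIV)" if "c \<in> B" using that Q by (simp add: pred_sets1)
    ultimately show ?thesis using that unfolding h_def by (cases "c \<in> A") (auto simp: of_bool_def intro!: measurable_If)
  qed
  have fS: "finite ?SA" "finite ?SB" using fin by auto
  have eq: "of_bool ((\<Sum>a\<in>A. of_bool (\<omega> a \<in> E) :: nat) = k) * of_bool ((\<Sum>b\<in>B. of_bool (\<omega> b \<in> F) :: nat) = l)
      = (\<Sum>A'\<in>?SA. \<Sum>B'\<in>?SB. \<Prod>c\<in>A \<union> B. h A' B' c (\<omega> c))" for \<omega>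
  proof -
    have "(\<Prod>c\<in>A \<union> B. h A' B' c (\<omega> c)) = (\<Prod>a\<in>A. of_bool ((\<omega> a \<in> E) = (a \<in> A'))) * (\<Prod>b\<in>B. of_bool ((\<omega> b \<in> F) = (b \<in> B')))" for A' B'
    proof -
      have "(\<Prod>c\<in>A \<union> B. h A' B' c (\<omega> c)) = (\<Prod>c\<in>A. h A' B' c (\<omega> c)) * (\<Prod>c\<in>B. h A' B' c (\<omega> c))"
        using fin by (intro prod.union_disjoint)
      moreover have "(\<Prod>c\<in>A. h A' B' c (\<omega> c)) = (\<Prod>a\<in>A. of_bool ((\<omega> a \<in> E) = (a \<in> A')))"
        by (intro prod.cong) (auto simp: h_def)
      moreover have "(\<Prod>c\<in>B. h A' B' c (\<omega> c)) = (\<Prod>b\<in>B. of_bool ((\<omega> b \<in> F) = (b \<in> B')))"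
        using fin by (intro prod.cong) (auto simp: h_def)
      ultimately show ?thesis by simp
    qed
    then show ?thesis
      unfolding of_bool_count_eq_sum[OF fin(1)] of_bool_count_eq_sum[OF fin(2)] by (simp add: sum_product)
  qed
  have each: "(\<integral>\<^sup>+\<omega>. (\<Prod>c\<in>A \<union> B. h A' B' c (\<omega> c)) \<partial>PiM (A \<union> B) D)
     = ennreal (measure P E ^ k * (1 - measure P E) ^ (card A - k) * (measure Q F ^ l * (1 - measure Q F) ^ (card B - l)))"
    if "A' \<in> ?SA" "B' \<in> ?SB" for A' B'
  proof -
    have "(\<integral>\<^sup>+\<omega>. (\<Prod>c\<in>A \<union> B. h A' B' c (\<omega> c)) \<partial>PiM (A \<union> B) D) = (\<Prod>c\<in>A \<union> B. \<integral>\<^sup>+y. h A' B' c y \<partial>D c)"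
      using fin hm by (intro product_nn_integral_prod) auto
    also have "\<dots> = (\<Prod>c\<in>A. \<integral>\<^sup>+y. h A' B' c y \<partial>D c) * (\<Prod>c\<in>B. \<integral>\<^sup>+y. h A' B' c y \<partial>D c)"
      using fin by (intro prod.union_disjoint)
    also have "(\<Prod>c\<in>A. \<integral>\<^sup>+y. h A' B' c y \<partial>D c) = (\<Prod>c\<in>A. \<integral>\<^sup>+y. of_bool ((y \<in> E) = (c \<in> A')) \<partial>D c)"
      by (intro prod.cong nn_integral_cong) (auto simp: h_def)
    also have "(\<Prod>c\<in>B. \<integral>\<^sup>+y. h A' B' c y \<partial>D c) = (\<Prod>c\<in>B. \<integral>\<^sup>+y. of_bool ((y \<in> F) = (c \<in> B')) \<partial>D c)"
      using fin by (intro prod.cong nn_integral_cong) (auto simp: h_def)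
    finally show ?thesis
      using that fin prod_nn_integral_membership[where D = D, OF Pm fin(1), of A'] prod_nn_integral_membership[where D = D, OF Q fin(2), of B']
      by (simp add: ennreal_mult[symmetric])
  qed
  have "(\<integral>\<^sup>+\<omega>. of_bool ((\<Sum>a\<in>A. of_bool (\<omega> a \<in> E) :: nat) = k) * of_bool ((\<Sum>b\<in>B. of_bool (\<omega> b \<in> F) :: nat) = l) \<partial>PiM (A \<union> B) D)
    = (\<Sum>A'\<in>?SA. \<Sum>B'\<in>?SB. \<integral>\<^sup>+\<omega>. (\<Prod>c\<in>A \<union> B. h A' B' c (\<omega> c)) \<partial>PiM (A \<union> B) D)"
  proof -
    have pm: "(\<lambda>\<omega>. \<Prod>c\<in>A \<union> B. h A' B' c (\<omega> c)) \<in> borel_measurable (PiM (A \<union> B) D)" for A' B'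
      using hm by (intro borel_measurable_prod_ennreal measurable_compose[OF measurable_component_singleton]) auto
    show ?thesis unfolding eq
      by (subst nn_integral_sum, (intro borel_measurable_sum pm), (intro sum.cong refl), subst nn_integral_sum, (intro pm), rule refl)
  qed
  also have "\<dots> = (\<Sum>A'\<in>?SA. \<Sum>B'\<in>?SB. ennreal (measure P E ^ k * (1 - measure P E) ^ (card A - k) * (measure Q F ^ l * (1 - measure Q F) ^ (card B - l))))"
    using each by (intro sum.cong refl) auto
  also have "\<dots> = ennreal (real (card ?SA) * (real (card ?SB) * (measure P E ^ k * (1 - measure P E) ^ (card A - k) * (measure Q F ^ l * (1 - measure Q F) ^ (card B - l)))))"
    by (simp add: ennreal_mult ennreal_of_nat_eq_real_of_nat)
  also have "\<dots> = ennreal (binom_prob (card A) k (measure P E) * binom_prob (card B) l (measure Q F))"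
    using fin by (simp add: n_subsets binom_prob_def ac_simps)
  finally show ?thesis .
qed

text \<open>A sum rather than a cardinality, so that measurability in \<open>\<omega>\<close> is evident.\<close>

definition closer_count :: "('i \<Rightarrow> 'a::metric_space) \<Rightarrow> 'i \<Rightarrow> 'i set \<Rightarrow> 'i \<Rightarrow> nat" where
  "closer_count \<omega> i A j = (\<Sum>a\<in>A. of_bool (dist (\<omega> i) (\<omega> a) < dist (\<omega> i) (\<omega> j)))"

text \<open>Integrating the coordinates \<open>i\<close>, \<open>j\<close>, \<open>j'\<close> last leaves for fixed values of these two
  independent counts of points in balls.\<close>

lemma nn_integral_PiM_neighbours:
  fixes D :: "'i \<Rightarrow> 'a::euclidean_space measure"
  assumes D: "\<And>c. prob_space (D c)" "\<And>c. sets (D c) = sets borel"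
    and fin: "finite A" "finite B" "A \<inter> B = {}"
    and Pm: "prob_space P" "\<And>a. a \<in> A \<Longrightarrow> D a = P" "sets P = sets borel"
    and Q: "prob_space Q" "\<And>b. b \<in> B \<Longrightarrow> D b = Q" "sets Q = sets borel"
    and dist: "i \<noteq> j" "i \<noteq> j'" "j \<noteq> j'" "{i, j, j'} \<inter> (A \<union> B) = {}"
    and h [measurable]: "(\<lambda>(x, y, w). h x y w) \<in> borel_measurable (borel \<Otimes>\<^sub>M (borel \<Otimes>\<^sub>M borel))"
  shows "(\<integral>\<^sup>+\<omega>. h (\<omega> i) (\<omega> j) (\<omega> j') * (of_bool (closer_count \<omega> i A j = k) * of_bool (closer_count \<omega> i B j' = l))
       \<partial>PiM (insert i (insert j (insert j' (A \<union> B)))) D)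
    = (\<integral>\<^sup>+x. \<integral>\<^sup>+y. \<integral>\<^sup>+w. h x y w * ennreal (binom_prob (card A) k (measure P (ball x (dist x y)))
          * binom_prob (card B) l (measure Q (ball x (dist x w)))) \<partial>D j' \<partial>D j \<partial>D i)"
proof -
  interpret product_prob_space D UNIV by (simp add: D product_prob_spaceI)
  have [measurable (raw)]: "(\<lambda>t. h (f1 t) (f2 t) (f3 t)) \<in> borel_measurable M'"
    if "f1 \<in> measurable M' borel" "f2 \<in> measurable M' borel" "f3 \<in> measurable M' borel" for M' f1 f2 f3
    using measurable_compose[OF measurable_Pair[OF that(1) measurable_Pair[OF that(2,3)]] h] by simp
  have comp: "(\<lambda>\<omega>. \<omega> c) \<in> measurable (PiM J D) borel" if "c \<in> J" for c J
    using measurable_component_singleton[OF that, of D] measurable_cong_sets[OF refl D(2)] by blast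
  let ?R = "A \<union> B"
  have ABne: "a \<noteq> i \<and> a \<noteq> j \<and> a \<noteq> j'" if "a \<in> ?R" for a using that dist(4) by auto
  have cnt_m: "(\<lambda>\<omega>. of_bool ((\<Sum>a\<in>A'. of_bool (dist (f \<omega>) (\<omega> a) < dist (f \<omega>) (g \<omega>)) :: nat) = m) :: ennreal) \<in> borel_measurable (PiM J D)"
    if f [measurable]: "f \<in> measurable (PiM J D) borel" and g [measurable]: "g \<in> measurable (PiM J D) borel" and AJ: "A' \<subseteq> J"
    for A' f g m J
  proof -
    have [measurable]: "(\<lambda>\<omega>. \<omega> a) \<in> measurable (PiM J D) borel" if "a \<in> A'" for a using that AJ by (intro comp) auto
    have [measurable]: "(\<lambda>\<omega>. of_bool (dist (f \<omega>) (\<omega> a) < dist (f \<omega>) (g \<omega>)) :: nat) \<in> measurable (PiM J D) (count_space UNIV)" if a: "a \<in> A'" for a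
    proof -
      have [measurable]: "(\<lambda>\<omega>. \<omega> a) \<in> measurable (PiM J D) borel" using a AJ by (intro comp) auto
      show ?thesis unfolding of_bool_def by measurable
    qed
    show ?thesis unfolding of_bool_def[of "_ = m"] by measurable
  qed
  define G where "G x y w \<omega> = h x y w * (of_bool ((\<Sum>a\<in>A. of_bool (dist x (\<omega> a) < dist x y) :: nat) = k)
      * of_bool ((\<Sum>b\<in>B. of_bool (dist x (\<omega> b) < dist x w) :: nat) = l))" for x y w and \<omega> :: "'i \<Rightarrow> 'a"
  have Gm: "(\<lambda>\<omega>. G (f1 \<omega>) (f2 \<omega>) (f3 \<omega>) \<omega>) \<in> borel_measurable (PiM J D)"
    if "f1 \<in> measurable (PiM J D) borel" "f2 \<in> measurable (PiM J D) borel" "f3 \<in> measurable (PiM J D) borel" "?R \<subseteq> J" for f1 f2 f3 J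
  proof -
    note [measurable] = that(1-3)
    have "(\<lambda>\<omega>. h (f1 \<omega>) (f2 \<omega>) (f3 \<omega>)) \<in> borel_measurable (PiM J D)" by measurable
    then show ?thesis unfolding G_def using that by (intro borel_measurable_times_ennreal cnt_m) auto
  qed
  have Gupd: "G x y w (fun_upd \<omega> c v) = G x y w \<omega>" if "c \<in> {i, j, j'}" for x y w \<omega> c v
  proof -
    have A: "(fun_upd \<omega> c v) a = \<omega> a" if "a \<in> A" for a using ABne[of a] that \<open>c \<in> {i, j, j'}\<close> by auto
    have B: "(fun_upd \<omega> c v) a = \<omega> a" if "a \<in> B" for a using ABne[of a] that \<open>c \<in> {i, j, j'}\<close> by auto
    have "(\<Sum>a\<in>A. of_bool (dist x ((fun_upd \<omega> c v) a) < dist x y) :: nat) = (\<Sum>a\<in>A. of_bool (dist x (\<omega> a) < dist x y))"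
      by (intro sum.cong refl) (simp only: A)
    moreover have "(\<Sum>a\<in>B. of_bool (dist x ((fun_upd \<omega> c v) a) < dist x w) :: nat) = (\<Sum>a\<in>B. of_bool (dist x (\<omega> a) < dist x w))"
      by (intro sum.cong refl) (simp only: B)
    ultimately show ?thesis by (simp only: G_def)
  qed
  have finR: "finite ?R" "finite (insert j' ?R)" "finite (insert j (insert j' ?R))" using fin by auto
  have notin: "j' \<notin> ?R" "j \<notin> insert j' ?R" "i \<notin> insert j (insert j' ?R)" using dist by auto
  have inner: "(\<integral>\<^sup>+\<omega>. G x y w \<omega> \<partial>PiM ?R D) = h x y w * ennreal (binom_prob (card A) k (measure P (ball x (dist x y)))
          * binom_prob (card B) l (measure Q (ball x (dist x w))))" for x y w
  proof -
    have "(\<integral>\<^sup>+\<omega>. G x y w \<omega> \<partial>PiM ?R D) = h x y w * (\<integral>\<^sup>+\<omega>. of_bool ((\<Sum>a\<in>A. of_bool (\<omega> a \<in> ball x (dist x y)) :: nat) = k)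
        * of_bool ((\<Sum>b\<in>B. of_bool (\<omega> b \<in> ball x (dist x w)) :: nat) = l) \<partial>PiM ?R D)"
      unfolding G_def mem_ball
      by (intro nn_integral_cmult borel_measurable_times_ennreal cnt_m) auto
    also have "(\<integral>\<^sup>+\<omega>. of_bool ((\<Sum>a\<in>A. of_bool (\<omega> a \<in> ball x (dist x y)) :: nat) = k)
        * of_bool ((\<Sum>b\<in>B. of_bool (\<omega> b \<in> ball x (dist x w)) :: nat) = l) \<partial>PiM ?R D)
       = ennreal (binom_prob (card A) k (measure P (ball x (dist x y)))
          * binom_prob (card B) l (measure Q (ball x (dist x w))))"
      using Pm Q by (intro nn_integral_PiM_counts D(1) fin) auto
    finally show ?thesis .
  qed
  have "(\<integral>\<^sup>+\<omega>. h (\<omega> i) (\<omega> j) (\<omega> j') * (of_bool (closer_count \<omega> i A j = k) * of_bool (closer_count \<omega> i B j' = l))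
       \<partial>PiM (insert i (insert j (insert j' ?R))) D)
     = (\<integral>\<^sup>+\<omega>. G (\<omega> i) (\<omega> j) (\<omega> j') \<omega> \<partial>PiM (insert i (insert j (insert j' ?R))) D)"
    by (simp add: G_def closer_count_def)
  also have "\<dots> = (\<integral>\<^sup>+x. \<integral>\<^sup>+\<omega>. G x (\<omega> j) (\<omega> j') \<omega> \<partial>PiM (insert j (insert j' ?R)) D \<partial>D i)"
    using dist Gupd[of i]
    by (subst product_nn_integral_insert_rev[OF finR(3) notin(3)]) (auto intro!: Gm comp)
  also have "\<dots> = (\<integral>\<^sup>+x. \<integral>\<^sup>+y. \<integral>\<^sup>+\<omega>. G x y (\<omega> j') \<omega> \<partial>PiM (insert j' ?R) D \<partial>D j \<partial>D i)"
    using dist Gupd[of j]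
    by (intro nn_integral_cong, subst product_nn_integral_insert_rev[OF finR(2) notin(2)]) (auto intro!: Gm comp)
  also have "\<dots> = (\<integral>\<^sup>+x. \<integral>\<^sup>+y. \<integral>\<^sup>+w. \<integral>\<^sup>+\<omega>. G x y w \<omega> \<partial>PiM ?R D \<partial>D j' \<partial>D j \<partial>D i)"
    using dist Gupd[of j']
    by (intro nn_integral_cong, subst product_nn_integral_insert_rev[OF finR(1) notin(1)]) (auto intro!: Gm comp)
  finally show ?thesis by (simp only: inner)
qed

lemma (in prob_space) nn_integral_neighbours:
  fixes Z :: "'i \<Rightarrow> 'a \<Rightarrow> 'b::euclidean_space"
  assumes indep: "indep_vars (\<lambda>_. borel) Z UNIV"
    and fin: "finite A" "finite B" "A \<inter> B = {}"
    and Pm: "prob_space P" "\<And>a. a \<in> A \<Longrightarrow> distr M borel (Z a) = P" "sets P = sets borel"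
    and Q: "prob_space Q" "\<And>b. b \<in> B \<Longrightarrow> distr M borel (Z b) = Q" "sets Q = sets borel"
    and dist: "i \<noteq> j" "i \<noteq> j'" "j \<noteq> j'" "{i, j, j'} \<inter> (A \<union> B) = {}"
    and h [measurable]: "(\<lambda>(x, y, w). h x y w) \<in> borel_measurable (borel \<Otimes>\<^sub>M (borel \<Otimes>\<^sub>M borel))"
  shows "(\<integral>\<^sup>+\<omega>. h (Z i \<omega>) (Z j \<omega>) (Z j' \<omega>) * (of_bool (closer_count (\<lambda>c. Z c \<omega>) i A j = k) * of_bool (closer_count (\<lambda>c. Z c \<omega>) i B j' = l)) \<partial>M)
    = (\<integral>\<^sup>+x. \<integral>\<^sup>+y. \<integral>\<^sup>+w. h x y w * ennreal (binom_prob (card A) k (measure P (ball x (dist x y)))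
          * binom_prob (card B) l (measure Q (ball x (dist x w)))) \<partial>distr M borel (Z j') \<partial>distr M borel (Z j) \<partial>distr M borel (Z i))"
proof -
  have rv: "random_variable borel (Z c)" for c using indep unfolding indep_vars_def by simp
  let ?J = "insert i (insert j (insert j' (A \<union> B)))"
  let ?D = "\<lambda>c. distr M borel (Z c)"
  have indJ: "indep_vars (\<lambda>_. borel) Z ?J" using indep by (rule indep_vars_subset) auto
  have dPi: "distr M (PiM ?J (\<lambda>_. borel)) (\<lambda>\<omega>. \<lambda>c\<in>?J. Z c \<omega>) = PiM ?J ?D"
    using indJ rv by (subst indep_vars_iff_distr_eq_PiM'[symmetric]) auto
  have T: "(\<lambda>\<omega>. \<lambda>c\<in>?J. Z c \<omega>) \<in> measurable M (PiM ?J (\<lambda>_. borel))"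
    using rv by (intro measurable_restrict) auto
  let ?f = "\<lambda>\<omega>. h (\<omega> i) (\<omega> j) (\<omega> j') * (of_bool (closer_count \<omega> i A j = k) * of_bool (closer_count \<omega> i B j' = l))"
  have [measurable (raw)]: "(\<lambda>t. h (f1 t) (f2 t) (f3 t)) \<in> borel_measurable M'"
    if "f1 \<in> measurable M' borel" "f2 \<in> measurable M' borel" "f3 \<in> measurable M' borel" for M' f1 f2 f3
    using measurable_compose[OF measurable_Pair[OF that(1) measurable_Pair[OF that(2,3)]] h] by simp
  have fm: "?f \<in> borel_measurable (PiM ?J (\<lambda>_. borel))"
    unfolding closer_count_def of_bool_def by measurable
  have cc: "closer_count (\<lambda>c\<in>?J. Z c \<omega>) i A j = closer_count (\<lambda>c. Z c \<omega>) i A j"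
    "closer_count (\<lambda>c\<in>?J. Z c \<omega>) i B j' = closer_count (\<lambda>c. Z c \<omega>) i B j'" for \<omega>
    unfolding closer_count_def by (intro sum.cong refl; simp)+
  have "(\<integral>\<^sup>+\<omega>. h (Z i \<omega>) (Z j \<omega>) (Z j' \<omega>) * (of_bool (closer_count (\<lambda>c. Z c \<omega>) i A j = k) * of_bool (closer_count (\<lambda>c. Z c \<omega>) i B j' = l)) \<partial>M)
    = (\<integral>\<^sup>+\<omega>. ?f (\<lambda>c\<in>?J. Z c \<omega>) \<partial>M)"
    unfolding cc by simp
  also have "\<dots> = (\<integral>\<^sup>+\<omega>. ?f \<omega> \<partial>distr M (PiM ?J (\<lambda>_. borel)) (\<lambda>\<omega>. \<lambda>c\<in>?J. Z c \<omega>))"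
    by (rule nn_integral_distr[OF T, symmetric]) (use fm in auto)
  also have "\<dots> = (\<integral>\<^sup>+\<omega>. ?f \<omega> \<partial>PiM ?J ?D)" unfolding dPi ..
  also have "\<dots> = (\<integral>\<^sup>+x. \<integral>\<^sup>+y. \<integral>\<^sup>+w. h x y w * ennreal (binom_prob (card A) k (measure P (ball x (dist x y)))
          * binom_prob (card B) l (measure Q (ball x (dist x w)))) \<partial>?D j' \<partial>?D j \<partial>?D i)"
    using prob_space_distr[OF rv] by (intro nn_integral_PiM_neighbours fin Pm Q dist h) auto
  finally show ?thesis .
qed

section \<open>Distances to nearest neighbours\<close>

lemma sorted_nth_le_iff:
  fixes xs :: "'a::linorder list"
  assumes "sorted xs" "j < length xs"
  shows "xs ! j \<le> t \<longleftrightarrow> j < length (filter (\<lambda>y. y \<le> t) xs)"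
  using assms
proof (induction xs arbitrary: j)
  case (Cons x xs)
  show ?case
  proof (cases "x \<le> t")
    case True
    show ?thesis
    proof (cases j)
      case (Suc i)
      then show ?thesis using Cons True by simp
    qed (use True in simp)
  next
    case False
    then have "filter (\<lambda>y. y \<le> t) (x # xs) = []"
      using Cons.prems(1) by (auto simp: filter_empty_conv)
    moreover have "x \<le> (x # xs) ! j"
      using Cons.prems by (cases j) auto
    ultimately show ?thesis using False by auto
  qed
qed simp

lemma sorted_list_of_multiset_nth_le_iff:
  fixes A :: "'a::linorder multiset"
  assumes "j < size A"
  shows "sorted_list_of_multiset A ! j \<le> t \<longleftrightarrow> j < size (filter_mset (\<lambda>y. y \<le> t) A)"
proof -
  let ?xs = "sorted_list_of_multiset A"
  have "size A = length ?xs" by (metis mset_sorted_list_of_multiset size_mset)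
  moreover have "size (filter_mset (\<lambda>y. y \<le> t) A) = length (filter (\<lambda>y. y \<le> t) ?xs)"
    by (metis mset_filter mset_sorted_list_of_multiset size_mset)
  ultimately show ?thesis using assms by (simp add: sorted_nth_le_iff)
qed

lemma nth_beyond: "xs ! (length xs + i) = [] ! i"
  by (induction xs) auto

text \<open>If \<open>A\<close> has fewer than \<open>k\<close> elements, the list is accessed beyond its end. The result is then an
  unspecified value, but by \<open>nth_beyond\<close> one which depends on the number of missing elements only.\<close>

lemma nn_dist_le_iff:
  assumes A: "finite A" and k: "k \<ge> 1"
  shows "nn_dist k x A \<le> t \<longleftrightarrow>
    (if k \<le> card A then k \<le> card {y \<in> A. dist x y \<le> t} else ([] :: real list) ! (k - 1 - card A) \<le> t)"
proof -
  let ?M = "image_mset (dist x) (mset_set A)"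
  have sz: "size ?M = card A" by simp
  show ?thesis
  proof (cases "k \<le> card A")
    case True
    have "size (filter_mset (\<lambda>y. y \<le> t) ?M) = card {y \<in> A. dist x y \<le> t}"
      using A by (simp add: filter_mset_image_mset)
    then show ?thesis
      using True k sorted_list_of_multiset_nth_le_iff[of "k - 1" ?M t] by (auto simp: nn_dist_def)
  next
    case False
    have len: "length (sorted_list_of_multiset ?M) = card A"
      by (metis mset_sorted_list_of_multiset size_mset sz)
    have "nn_dist k x A = sorted_list_of_multiset ?M ! (length (sorted_list_of_multiset ?M) + (k - 1 - card A))"
      unfolding nn_dist_def len using False by simp
    also have "\<dots> = [] ! (k - 1 - card A)" by (rule nth_beyond)
    finally show ?thesis using False by simp
  qed
qed

text \<open>Counting each value at its first index expresses the number of distinct values by equalities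
  between the \<open>Z a\<close>, which is a measurable condition.\<close>

lemma card_image_filter_first:
  fixes I :: "nat set"
  assumes "finite I"
  shows "card {y \<in> Z ` I. P y} = (\<Sum>a\<in>I. of_bool ((\<forall>b\<in>I. b < a \<longrightarrow> Z b \<noteq> Z a) \<and> P (Z a)))"
proof -
  let ?F = "{a \<in> I. (\<forall>b\<in>I. b < a \<longrightarrow> Z b \<noteq> Z a) \<and> P (Z a)}"
  have "{y \<in> Z ` I. P y} = Z ` ?F"
  proof (intro set_eqI iffI)
    fix y assume "y \<in> {y \<in> Z ` I. P y}"
    then obtain a where a: "a \<in> I" "y = Z a" "P y" by auto
    define b where "b = (LEAST b. b \<in> I \<and> Z b = y)"
    have b: "b \<in> I \<and> Z b = y" unfolding b_def by (rule LeastI[of _ a]) (use a in auto)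
    have "Z c \<noteq> Z b" if "c < b" "c \<in> I" for c using not_less_Least[of c "\<lambda>b. b \<in> I \<and> Z b = y"] that b by (auto simp: b_def)
    then have "b \<in> ?F" using b a by auto
    then show "y \<in> Z ` ?F" using b by blast
  qed auto
  moreover have "inj_on Z ?F"
  proof (rule inj_onI)
    fix a b assume "a \<in> ?F" "b \<in> ?F" "Z a = Z b"
    then show "a = b" by (cases a b rule: linorder_cases) auto
  qed
  ultimately have "card {y \<in> Z ` I. P y} = card ?F" by (simp add: card_image)
  then show ?thesis using assms by (simp add: Int_def conj_commute)
qed

text \<open>Sample points may coincide, so the number of elements of the image varies with \<open>\<omega>\<close>. The
  measurability of the estimator is needed, since the Bochner integral of a nonmeasurable function is
  \<open>0\<close> even if the function equals a measurable one almost everywhere.\<close>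

lemma nn_dist_measurable:
  fixes x :: "'w \<Rightarrow> 'a::euclidean_space" and I :: "nat set"
  assumes [measurable]: "x \<in> measurable M borel" "\<And>a. Z a \<in> measurable M borel" and fin: "finite I" and k: "k \<ge> 1"
  shows "(\<lambda>\<omega>. nn_dist k (x \<omega>) ((\<lambda>a. Z a \<omega>) ` I)) \<in> borel_measurable M"
proof -
  define cnt where "cnt t \<omega> = (\<Sum>a\<in>I. of_bool ((\<forall>b\<in>I. b < a \<longrightarrow> 0 < dist (Z b \<omega>) (Z a \<omega>)) \<and> dist (x \<omega>) (Z a \<omega>) \<le> t) :: nat)" for t \<omega>
  define r where "r \<omega> = (\<Sum>a\<in>I. of_bool (\<forall>b\<in>I. b < a \<longrightarrow> 0 < dist (Z b \<omega>) (Z a \<omega>)) :: nat)" for \<omega>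
  have cI: "countable I" using fin by (rule countable_finite)
  have [measurable]: "cnt t \<in> measurable M (count_space UNIV)" for t
    using fin cI unfolding cnt_def of_bool_def by measurable
  have [measurable]: "r \<in> measurable M (count_space UNIV)"
    using fin cI unfolding r_def of_bool_def by measurable
  have c: "card {y \<in> (\<lambda>a. Z a \<omega>) ` I. dist (x \<omega>) y \<le> t} = cnt t \<omega>" for t \<omega>
    using card_image_filter_first[OF fin, of "\<lambda>a. Z a \<omega>" "\<lambda>y. dist (x \<omega>) y \<le> t"] by (simp add: cnt_def)
  have rr: "card ((\<lambda>a. Z a \<omega>) ` I) = r \<omega>" for \<omega>
    using card_image_filter_first[OF fin, of "\<lambda>a. Z a \<omega>" "\<lambda>y. True"] by (simp add: r_def)
  show ?thesis
  proof (rule borel_measurable_iff_le[THEN iffD2], rule allI)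
    fix t :: real
    have "{\<omega> \<in> space M. nn_dist k (x \<omega>) ((\<lambda>a. Z a \<omega>) ` I) \<le> t}
      = {\<omega> \<in> space M. if k \<le> r \<omega> then k \<le> cnt t \<omega> else ([] :: real list) ! (k - 1 - r \<omega>) \<le> t}"
      using fin by (simp only: nn_dist_le_iff[OF finite_imageI[OF fin] k] c rr)
    also have "\<dots> \<in> sets M" by measurable
    finally show "{\<omega> \<in> space M. nn_dist k (x \<omega>) ((\<lambda>a. Z a \<omega>) ` I) \<le> t} \<in> sets M" .
  qed
qed

lemma measure_ball_measurable:
  fixes x :: "'w \<Rightarrow> 'a::euclidean_space"
  assumes [measurable]: "r \<in> borel_measurable M"
  shows "(\<lambda>\<omega>. measure lborel (ball (x \<omega>) (r \<omega>))) \<in> borel_measurable M"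
proof -
  have "(\<lambda>\<omega>. measure lborel (ball (x \<omega>) (r \<omega>)))
     = (\<lambda>\<omega>. if 0 \<le> r \<omega> then unit_ball_vol (real DIM('a)) * r \<omega> ^ DIM('a) else 0)"
    by (auto simp: content_ball ball_empty)
  also have "\<dots> \<in> borel_measurable M" by measurable
  finally show ?thesis .
qed

lemma nth_neighbour_unique:
  fixes d :: "'i \<Rightarrow> real"
  assumes fin: "finite I" and inj: "inj_on d I" and k: "k < card I"
  obtains j where "j \<in> I" "card {a \<in> I. d a < d j} = k"
    "\<And>i. i \<in> I \<Longrightarrow> card {a \<in> I. d a < d i} = k \<Longrightarrow> i = j"
    "sorted_list_of_set (d ` I) ! k = d j"
proof -
  let ?xs = "sorted_list_of_set (d ` I)"
  have len: "length ?xs = card I" using inj by (simp add: card_image)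
  have set: "set ?xs = d ` I" using fin by simp
  have srt: "sorted_wrt (<) ?xs" by simp
  have cnt: "card {a \<in> I. d a < ?xs ! i} = i" if i: "i < card I" for i
  proof -
    have "d ` {a \<in> I. d a < ?xs ! i} = {s \<in> d ` I. s < ?xs ! i}" by auto
    also have "\<dots> = (!) ?xs ` {..<i}"
    proof (intro set_eqI iffI)
      fix s assume "s \<in> {s \<in> d ` I. s < ?xs ! i}"
      then have s: "s \<in> set ?xs" "s < ?xs ! i" unfolding set by auto
      from s(1) obtain i' where i': "i' < length ?xs" "?xs ! i' = s" by (meson in_set_conv_nth)
      have "i' < i"
      proof (rule ccontr)
        assume "\<not> i' < i"
        then consider "i = i'" | "i < i'" by linarith
        then show False
        proof cases
          case 2
          then have "?xs ! i < ?xs ! i'" using i'(1) by (intro sorted_wrt_nth_less[OF srt])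
          then show False using s(2) i'(2) by simp
        qed (use s(2) i'(2) in simp)
      qed
      then show "s \<in> (!) ?xs ` {..<i}" using i'(2) by blast
    next
      fix s assume "s \<in> (!) ?xs ` {..<i}"
      then obtain i' where i': "i' < i" "s = ?xs ! i'" by auto
      then have "s < ?xs ! i" using sorted_wrt_nth_less[OF srt, of i' i] i len by auto
      moreover have "s \<in> set ?xs" using i' i len by auto
      ultimately show "s \<in> {s \<in> d ` I. s < ?xs ! i}" using set by auto
    qed
    finally have "d ` {a \<in> I. d a < ?xs ! i} = (!) ?xs ` {..<i}" .
    moreover have "inj_on d {a \<in> I. d a < ?xs ! i}" using inj by (rule inj_on_subset) auto
    moreover have "inj_on ((!) ?xs) {..<i}" using i len by (intro inj_on_nth) auto
    ultimately show ?thesis by (metis card_image card_lessThan)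
  qed
  have "?xs ! k \<in> d ` I" using k len set nth_mem by metis
  then obtain j where j: "j \<in> I" "?xs ! k = d j" by auto
  show ?thesis
  proof (rule that[OF j(1)])
    show "card {a \<in> I. d a < d j} = k" using cnt[OF k] j by simp
    show "?xs ! k = d j" by (rule j(2))
    fix i assume i: "i \<in> I" "card {a \<in> I. d a < d i} = k"
    have "d i \<in> set ?xs" using i set by simp
    then obtain i' where i': "i' < card I" "?xs ! i' = d i" using len by (auto simp: in_set_conv_nth)
    then have "i' = k" using cnt[OF i'(1)] i(2) by simp
    then have "d i = d j" using i' j by simp
    then show "i = j" using inj i j by (auto dest: inj_onD)
  qed
qed

text \<open>When the distances are distinct, exactly one index has \<open>k - 1\<close> indices before it, so the sum
  has exactly one nonzero term.\<close>

lemma nn_dist_sum: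
  fixes Z :: "'i \<Rightarrow> 'a::euclidean_space" and H :: "real \<Rightarrow> real"
  assumes fin: "finite I" and inj: "inj_on (\<lambda>a. dist x (Z a)) I" and k: "1 \<le> k" "k \<le> card I"
  shows "H (nn_dist k x (Z ` I)) = (\<Sum>j\<in>I. of_bool (card {a \<in> I. dist x (Z a) < dist x (Z j)} = k - 1) * H (dist x (Z j)))"
proof -
  let ?d = "\<lambda>a. dist x (Z a)"
  have kI: "k - 1 < card I" using k by simp
  obtain j where j: "j \<in> I" "card {a \<in> I. ?d a < ?d j} = k - 1"
    "\<And>i. i \<in> I \<Longrightarrow> card {a \<in> I. ?d a < ?d i} = k - 1 \<Longrightarrow> i = j"
    "sorted_list_of_set (?d ` I) ! (k - 1) = ?d j"
    by (rule nth_neighbour_unique[OF fin inj kI], rule that) assumption+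
  have injZ: "inj_on (dist x) (Z ` I)" using inj by (auto simp: inj_on_def)
  have "nn_dist k x (Z ` I) = ?d j"
    using j(4) by (simp add: nn_dist_def image_mset_mset_set[OF injZ] image_image)
  moreover have "(\<Sum>i\<in>I. of_bool (card {a \<in> I. ?d a < ?d i} = k - 1) * H (?d i)) = (\<Sum>i\<in>I. if i = j then H (?d j) else 0)"
  proof (intro sum.cong refl)
    fix i assume i: "i \<in> I"
    show "of_bool (card {a \<in> I. ?d a < ?d i} = k - 1) * H (?d i) = (if i = j then H (?d j) else 0)"
    proof (cases "i = j")
      case True
      show ?thesis unfolding True j(2) by simp
    next
      case False
      then have "card {a \<in> I. ?d a < ?d i} \<noteq> k - 1" using j(3)[OF i] by blast
      then show ?thesis using False by simp
    qed
  qed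
  ultimately show ?thesis using fin j(1) by simp
qed

lemma closer_count_image:
  assumes "finite I" "j \<in> I" "inj \<iota>"
  shows "closer_count Z i (\<iota> ` (I - {j})) (\<iota> j) = card {a \<in> I. dist (Z i) (Z (\<iota> a)) < dist (Z i) (Z (\<iota> j))}"
proof -
  have "closer_count Z i (\<iota> ` (I - {j})) (\<iota> j) = (\<Sum>a\<in>I - {j}. of_bool (dist (Z i) (Z (\<iota> a)) < dist (Z i) (Z (\<iota> j))))"
    unfolding closer_count_def using assms(3) by (subst sum.reindex) (auto intro: inj_on_subset)
  also have "\<dots> = card {a \<in> I - {j}. dist (Z i) (Z (\<iota> a)) < dist (Z i) (Z (\<iota> j))}"
    using assms by (simp add: Int_def conj_commute)
  also have "{a \<in> I - {j}. dist (Z i) (Z (\<iota> a)) < dist (Z i) (Z (\<iota> j))} = {a \<in> I. dist (Z i) (Z (\<iota> a)) < dist (Z i) (Z (\<iota> j))}"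
    by auto
  finally show ?thesis .
qed

lemma emeasure_prob_of_sphere:
  fixes x :: "'a::euclidean_space"
  assumes g: "prob_density g"
  shows "emeasure (prob_of g) {w. dist x w = r} = 0"
proof -
  have [measurable]: "g \<in> borel_measurable borel" using g by (simp add: prob_density_def)
  have s: "{w. dist x w = r} = sphere x r" by auto
  have [measurable]: "sphere x r \<in> sets borel" by (intro borel_closed closed_sphere)
  have "sphere x r \<in> null_sets lebesgue" using negligible_sphere negligible_iff_null_sets by blast
  then have "sphere x r \<in> null_sets lborel" by (subst (asm) null_sets_completion_iff) auto
  then have "AE w in lborel. ennreal (g w) * indicator (sphere x r) w = 0"
    by (auto dest!: AE_not_in elim: eventually_mono)
  then have "(\<integral>\<^sup>+w. ennreal (g w) * indicator (sphere x r) w \<partial>lborel) = 0"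
    by (subst nn_integral_0_iff_AE) auto
  then show ?thesis
    unfolding s by (subst emeasure_prob_of[OF g]) auto
qed

lemma binom_prob_eq_binom_nn: "1 \<le> k \<Longrightarrow> k \<le> N \<Longrightarrow> binom_prob (N - 1) (k - 1) x = binom_nn N k x"
  by (simp add: binom_prob_def binom_nn_def)

lemma (in prob_space) distr_distributed:
  assumes "distributed M lborel X (\<lambda>x. ennreal (g x))"
  shows "distr M borel X = prob_of g" "random_variable borel X"
proof -
  have "distr M lborel X = prob_of g" using assms by (simp add: distributed_def prob_of_def)
  then show "distr M borel X = prob_of g" by (metis distr_cong sets_lborel)
  show "random_variable borel X" using assms by (simp add: distributed_def)
qed

text \<open>Given the other two points, \<open>Z c\<close> lies almost surely off a fixed sphere.\<close>

lemma (in prob_space) AE_distances_distinct: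
  fixes Z :: "'i \<Rightarrow> 'a \<Rightarrow> 'b::euclidean_space"
  assumes indep: "indep_vars (\<lambda>_. borel) Z UNIV"
    and g: "prob_density g" and D: "distr M borel (Z c) = prob_of g"
    and dist: "a \<noteq> b" "a \<noteq> c" "b \<noteq> c"
  shows "AE \<omega> in M. dist (Z a \<omega>) (Z b \<omega>) \<noteq> dist (Z a \<omega>) (Z c \<omega>)"
proof -
  have rv: "random_variable borel (Z c)" for c using indep unfolding indep_vars_def by simp
  note [measurable] = rv
  let ?h = "\<lambda>x y w :: 'b. of_bool (dist x y = dist x w) :: ennreal"
  have hm: "(\<lambda>(x, y, w). ?h x y w) \<in> borel_measurable (borel \<Otimes>\<^sub>M (borel \<Otimes>\<^sub>M borel))"
    unfolding of_bool_def by measurable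
  have "(\<integral>\<^sup>+\<omega>. ?h (Z a \<omega>) (Z b \<omega>) (Z c \<omega>) \<partial>M)
    = (\<integral>\<^sup>+\<omega>. ?h (Z a \<omega>) (Z b \<omega>) (Z c \<omega>) * (of_bool (closer_count (\<lambda>c. Z c \<omega>) a {} b = 0) * of_bool (closer_count (\<lambda>c. Z c \<omega>) a {} c = 0)) \<partial>M)"
    by (simp add: closer_count_def)
  also have "\<dots> = (\<integral>\<^sup>+x. \<integral>\<^sup>+y. \<integral>\<^sup>+w. ?h x y w * ennreal (binom_prob (card ({} :: 'i set)) 0 (measure (prob_of g) (ball x (dist x y)))
          * binom_prob (card ({} :: 'i set)) 0 (measure (prob_of g) (ball x (dist x w)))) \<partial>distr M borel (Z c) \<partial>distr M borel (Z b) \<partial>distr M borel (Z a))"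
    by (rule nn_integral_neighbours[where h = ?h and P = "prob_of g" and Q = "prob_of g", OF indep])
      (use dist in \<open>auto intro: prob_space_prob_of[OF g] hm\<close>)
  also have "\<dots> = (\<integral>\<^sup>+x. \<integral>\<^sup>+y. 0 \<partial>distr M borel (Z b) \<partial>distr M borel (Z a))"
  proof (intro nn_integral_cong)
    fix x y :: 'b
    have "(\<integral>\<^sup>+w. ?h x y w * ennreal (binom_prob (card ({} :: 'i set)) 0 (measure (prob_of g) (ball x (dist x y)))
          * binom_prob (card ({} :: 'i set)) 0 (measure (prob_of g) (ball x (dist x w)))) \<partial>distr M borel (Z c))
       = (\<integral>\<^sup>+w. indicator {w. dist x w = dist x y} w \<partial>prob_of g)"
      unfolding D by (intro nn_integral_cong) (auto simp: binom_prob_def indicator_def)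
    also have "\<dots> = 0" using emeasure_prob_of_sphere[OF g] by (subst nn_integral_indicator) auto
    finally show "(\<integral>\<^sup>+w. ?h x y w * ennreal (binom_prob (card ({} :: 'i set)) 0 (measure (prob_of g) (ball x (dist x y)))
          * binom_prob (card ({} :: 'i set)) 0 (measure (prob_of g) (ball x (dist x w)))) \<partial>distr M borel (Z c)) = 0" .
  qed
  finally have "(\<integral>\<^sup>+\<omega>. ?h (Z a \<omega>) (Z b \<omega>) (Z c \<omega>) \<partial>M) = 0" by simp
  then have "AE \<omega> in M. ?h (Z a \<omega>) (Z b \<omega>) (Z c \<omega>) = 0"
    by (subst (asm) nn_integral_0_iff_AE) (auto simp: of_bool_def)
  then show ?thesis by eventually_elim (auto simp: of_bool_def split: if_splits)
qed

section \<open>The expectation of the estimator\<close>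

lemma nn_integral_prob_of:
  assumes "prob_density g" and [measurable]: "h \<in> borel_measurable borel"
  shows "(\<integral>\<^sup>+x. h x \<partial>prob_of g) = (\<integral>\<^sup>+x. ennreal (g x) * h x \<partial>lborel)"
  using assms(1) unfolding prob_of_def prob_density_def by (subst nn_integral_density) auto

text \<open>The value of \<open>\<phi>\<close> on the event that \<open>X j\<close> is the \<open>k\<close>-th nearest neighbour of \<open>X i\<close> in its own
  sample, and \<open>Y j'\<close> the \<open>l\<close>-th nearest one in the other sample.\<close>

definition neighbour_term ::
    "(real \<Rightarrow> real \<Rightarrow> real) \<Rightarrow> nat \<Rightarrow> nat \<Rightarrow> nat \<Rightarrow> nat \<Rightarrow> (nat \<Rightarrow> 'a::euclidean_space) \<Rightarrow> (nat \<Rightarrow> 'a) \<Rightarrow> nat \<Rightarrow> nat \<Rightarrow> nat \<Rightarrow> real" where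
  "neighbour_term \<phi> k l m n X Y i j j' =
     of_bool (card {a \<in> {1..m} - {i}. dist (X i) (X a) < dist (X i) (X j)} = k - 1)
      * (of_bool (card {b \<in> {1..n}. dist (X i) (Y b) < dist (X i) (Y j')} = l - 1)
        * on_quadrant \<phi> (svol (m - 1) (X j - X i)) (svol n (Y j' - X i)))"

lemma on_quadrant_neighbour_sum:
  fixes X Y :: "nat \<Rightarrow> 'a::euclidean_space"
  assumes injX: "inj_on (\<lambda>a. dist (X i) (X a)) ({1..m} - {i})" and injY: "inj_on (\<lambda>b. dist (X i) (Y b)) {1..n}"
    and k: "1 \<le> k" "k \<le> m - 1" and l: "1 \<le> l" "l \<le> n" and i: "i \<in> {1..m}"
  shows "on_quadrant \<phi> (nn_U k m X i) (nn_V l n X Y i)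
    = (\<Sum>j\<in>{1..m} - {i}. \<Sum>j'\<in>{1..n}. neighbour_term \<phi> k l m n X Y i j j')"
proof -
  have bv: "measure lborel (ball (X i) (dist (X i) y)) = bvol (y - X i)" for y
    using measure_ball_bvol[of "X i" "y - X i"] by (simp add: dist_norm norm_minus_commute)
  have m1: "real m - 1 = real (m - 1)" using i by simp
  have cI: "k \<le> card ({1..m} - {i})" "l \<le> card {1..n}" using k l i by auto
  have "on_quadrant \<phi> (nn_U k m X i) (nn_V l n X Y i)
    = (\<Sum>j\<in>{1..m} - {i}. of_bool (card {a \<in> {1..m} - {i}. dist (X i) (X a) < dist (X i) (X j)} = k - 1)
        * on_quadrant \<phi> (real (m - 1) * measure lborel (ball (X i) (dist (X i) (X j)))) (nn_V l n X Y i))"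
    unfolding nn_U_def m1
    by (rule nn_dist_sum[OF _ injX k(1) cI(1), where H="\<lambda>r. on_quadrant \<phi> (real (m - 1) * measure lborel (ball (X i) r)) (nn_V l n X Y i)"]) simp
  also have "\<dots> = (\<Sum>j\<in>{1..m} - {i}. of_bool (card {a \<in> {1..m} - {i}. dist (X i) (X a) < dist (X i) (X j)} = k - 1)
        * (\<Sum>j'\<in>{1..n}. of_bool (card {b \<in> {1..n}. dist (X i) (Y b) < dist (X i) (Y j')} = l - 1)
          * on_quadrant \<phi> (svol (m - 1) (X j - X i)) (real n * measure lborel (ball (X i) (dist (X i) (Y j'))))))"
  proof (intro sum.cong refl arg_cong2[where f="(*)"])
    fix j
    show "on_quadrant \<phi> (real (m - 1) * measure lborel (ball (X i) (dist (X i) (X j)))) (nn_V l n X Y i)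
      = (\<Sum>j'\<in>{1..n}. of_bool (card {b \<in> {1..n}. dist (X i) (Y b) < dist (X i) (Y j')} = l - 1)
          * on_quadrant \<phi> (svol (m - 1) (X j - X i)) (real n * measure lborel (ball (X i) (dist (X i) (Y j')))))"
      unfolding nn_V_def bv[of "X j"] svol_def[symmetric]
      by (rule nn_dist_sum[OF _ injY l(1) cI(2), where H="\<lambda>r. on_quadrant \<phi> (svol (m - 1) (X j - X i)) (real n * measure lborel (ball (X i) r))"]) simp
  qed
  finally show ?thesis by (simp only: neighbour_term_def bv sum_distrib_left svol_def)
qed

locale two_samples = prob_space M for M :: "'w measure" +
  fixes X Y :: "nat \<Rightarrow> 'w \<Rightarrow> 'a::euclidean_space" and p q :: "'a \<Rightarrow> real"
  assumes p: "prob_density p" and q: "prob_density q"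
    and X: "\<And>i. distr M borel (X i) = prob_of p" and Y: "\<And>j. distr M borel (Y j) = prob_of q"
    and indep: "indep_vars (\<lambda>_. borel) (case_sum X Y) UNIV"
begin

lemma samples_measurable [measurable]:
  "random_variable borel (case_sum X Y c)" "random_variable borel (X i)" "random_variable borel (Y i)"
proof -
  have rv: "random_variable borel (case_sum X Y c)" for c using indep unfolding indep_vars_def by simp
  show "random_variable borel (case_sum X Y c)" by (rule rv)
  show "random_variable borel (X i)" "random_variable borel (Y i)" using rv[of "Inl i"] rv[of "Inr i"] by simp_all
qed

lemma p_nonneg: "0 \<le> p x" and q_nonneg: "0 \<le> q x"
  using p q by (auto simp: prob_density_def)

lemma densities_measurable [measurable]: "p \<in> borel_measurable borel" "q \<in> borel_measurable borel"
  using p q by (auto simp: prob_density_def)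

lemmas ballmass_pq_measurable [measurable (raw)] = ballmass_measurable[OF p] ballmass_measurable[OF q]

text \<open>Restricted to the event that \<open>X j\<close> and \<open>Y j'\<close> are the two neighbours of \<open>X i\<close>, the point and
  the two offsets have a density, which is \<open>p x\<close> times both kernels up to the factors \<open>m - 1\<close> and \<open>n\<close>
  that count the pairs \<open>(j, j')\<close>.\<close>

lemma neighbour_law:
  assumes k: "1 \<le> k" "k \<le> m - 1" and l: "1 \<le> l" "l \<le> n"
    and ij: "i \<in> {1..m}" "j \<in> {1..m} - {i}" "j' \<in> {1..n}"
  defines "A \<equiv> Inl ` ({1..m} - {i} - {j})" and "B \<equiv> Inr ` ({1..n} - {j'})"
  shows "distr (density M (\<lambda>\<omega>. ennreal (of_bool (closer_count (\<lambda>c. case_sum X Y c \<omega>) (Inl i) A (Inl j) = k - 1)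
            * of_bool (closer_count (\<lambda>c. case_sum X Y c \<omega>) (Inl i) B (Inr j') = l - 1))))
       leb3 (\<lambda>\<omega>. (X i \<omega>, X j \<omega> - X i \<omega>, Y j' \<omega> - X i \<omega>))
    = density leb3 (\<lambda>(x, z, w). ennreal (p x * (p (x + z) * binom_nn (m - 1) k (ballmass p x (norm z))
          * (q (x + w) * binom_nn n l (ballmass q x (norm w))))))"
    (is "distr (density M ?R) leb3 ?T = density leb3 ?W")
proof -
  have [measurable]: "?R \<in> borel_measurable M"
    unfolding closer_count_def of_bool_def by measurable
  have T [measurable]: "?T \<in> measurable M leb3" by measurable
  have W [measurable]: "?W \<in> borel_measurable leb3" by measurable
  have L2: "sigma_finite_measure (leb2 :: ('a \<times> 'a) measure)"
    unfolding lborel_prod by standard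
  have cA: "card A = m - 1 - 1" "card B = n - 1"
    using ij by (auto simp: A_def B_def card_image card_Diff_subset)
  show ?thesis
  proof (rule measure_eqI)
    fix E assume "E \<in> sets (distr (density M ?R) leb3 ?T)"
    then have E [measurable]: "E \<in> sets leb3" by simp
    have E' [measurable]: "E \<in> sets (borel \<Otimes>\<^sub>M (borel \<Otimes>\<^sub>M borel))"
      using E by (simp cong: sets_pair_measure_cong)
    define h where "h x y w = (indicator E (x, y - x, w - x) :: ennreal)" for x y w
    have hm: "(\<lambda>(x, y, w). h x y w) \<in> borel_measurable (borel \<Otimes>\<^sub>M (borel \<Otimes>\<^sub>M borel))"
      unfolding h_def by measurable
    define \<Psi> where "\<Psi> x z w = (indicator E (x, z, w) :: ennreal) * ennreal (binom_nn (m - 1) k (ballmass p x (norm z)) * binom_nn n l (ballmass q x (norm w)))" for x z w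
    have \<Psi>m [measurable (raw)]: "(\<lambda>t. \<Psi> (f1 t) (f2 t) (f3 t)) \<in> borel_measurable M'"
      if [measurable]: "f1 \<in> measurable M' borel" "f2 \<in> measurable M' borel" "f3 \<in> measurable M' borel" for M' f1 f2 f3
      unfolding \<Psi>_def by measurable
    have "emeasure (distr (density M ?R) leb3 ?T) E = (\<integral>\<^sup>+t. indicator E t \<partial>distr (density M ?R) leb3 ?T)"
      by simp
    also have "\<dots> = (\<integral>\<^sup>+\<omega>. indicator E (?T \<omega>) \<partial>density M ?R)"
      by (subst nn_integral_distr) (auto simp del: nn_integral_indicator)
    also have "\<dots> = (\<integral>\<^sup>+\<omega>. ?R \<omega> * indicator E (?T \<omega>) \<partial>M)"
      by (rule nn_integral_density) measurable
    also have "\<dots> = (\<integral>\<^sup>+\<omega>. h (case_sum X Y (Inl i) \<omega>) (case_sum X Y (Inl j) \<omega>) (case_sum X Y (Inr j') \<omega>)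
        * (of_bool (closer_count (\<lambda>c. case_sum X Y c \<omega>) (Inl i) A (Inl j) = k - 1)
            * of_bool (closer_count (\<lambda>c. case_sum X Y c \<omega>) (Inl i) B (Inr j') = l - 1)) \<partial>M)"
      by (intro nn_integral_cong) (auto simp: h_def of_bool_def)
    also have "\<dots> = (\<integral>\<^sup>+x. \<integral>\<^sup>+y. \<integral>\<^sup>+w. h x y w * ennreal (binom_prob (card A) (k - 1) (measure (prob_of p) (ball x (dist x y)))
          * binom_prob (card B) (l - 1) (measure (prob_of q) (ball x (dist x w))))
          \<partial>distr M borel (case_sum X Y (Inr j')) \<partial>distr M borel (case_sum X Y (Inl j)) \<partial>distr M borel (case_sum X Y (Inl i)))"
      by (rule nn_integral_neighbours[OF indep])
        (use ij in \<open>auto simp: A_def B_def X Y intro: prob_space_prob_of[OF p] prob_space_prob_of[OF q] hm\<close>)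
    also have "\<dots> = (\<integral>\<^sup>+x. \<integral>\<^sup>+y. \<integral>\<^sup>+w. \<Psi> x (y - x) (w - x) \<partial>prob_of q \<partial>prob_of p \<partial>prob_of p)"
      unfolding cA binom_prob_eq_binom_nn[OF k] binom_prob_eq_binom_nn[OF l]
      by (simp add: X Y h_def \<Psi>_def ballmass_def dist_norm norm_minus_commute)
    also have "\<dots> = (\<integral>\<^sup>+x. ennreal (p x) * (\<integral>\<^sup>+y. ennreal (p y) * (\<integral>\<^sup>+w. ennreal (q w) * \<Psi> x (y - x) (w - x) \<partial>lborel) \<partial>lborel) \<partial>lborel)"
    proof -
      have 1: "(\<integral>\<^sup>+w. \<Psi> x (y - x) (w - x) \<partial>prob_of q) = (\<integral>\<^sup>+w. ennreal (q w) * \<Psi> x (y - x) (w - x) \<partial>lborel)" for x y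
        by (rule nn_integral_prob_of[OF q]) measurable
      have 2: "(\<integral>\<^sup>+y. (\<integral>\<^sup>+w. ennreal (q w) * \<Psi> x (y - x) (w - x) \<partial>lborel) \<partial>prob_of p)
          = (\<integral>\<^sup>+y. ennreal (p y) * (\<integral>\<^sup>+w. ennreal (q w) * \<Psi> x (y - x) (w - x) \<partial>lborel) \<partial>lborel)" for x
        by (rule nn_integral_prob_of[OF p]) measurable
      show ?thesis unfolding 1 2 by (rule nn_integral_prob_of[OF p]) measurable
    qed
    also have "\<dots> = (\<integral>\<^sup>+x. ennreal (p x) * (\<integral>\<^sup>+z. ennreal (p (x + z)) * (\<integral>\<^sup>+w. ennreal (q (x + w)) * \<Psi> x z w \<partial>lborel) \<partial>lborel) \<partial>lborel)"
    proof -
      have 1: "(\<integral>\<^sup>+w. ennreal (q w) * \<Psi> x (y - x) (w - x) \<partial>lborel) = (\<integral>\<^sup>+w. ennreal (q (x + w)) * \<Psi> x (y - x) w \<partial>lborel)" for x y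
        using nn_integral_lborel_translate[of "\<lambda>w. ennreal (q w) * \<Psi> x (y - x) (w - x)" x] by simp
      have 2: "(\<integral>\<^sup>+y. ennreal (p y) * (\<integral>\<^sup>+w. ennreal (q (x + w)) * \<Psi> x (y - x) w \<partial>lborel) \<partial>lborel)
          = (\<integral>\<^sup>+z. ennreal (p (x + z)) * (\<integral>\<^sup>+w. ennreal (q (x + w)) * \<Psi> x z w \<partial>lborel) \<partial>lborel)" for x
        using nn_integral_lborel_translate[of "\<lambda>y. ennreal (p y) * (\<integral>\<^sup>+w. ennreal (q (x + w)) * \<Psi> x (y - x) w \<partial>lborel)" x] by simp
      show ?thesis unfolding 1 2 ..
    qed
    also have "\<dots> = (\<integral>\<^sup>+x. \<integral>\<^sup>+z. \<integral>\<^sup>+w. ennreal (p x) * (ennreal (p (x + z)) * (ennreal (q (x + w)) * \<Psi> x z w)) \<partial>lborel \<partial>lborel \<partial>lborel)"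
      by (simp add: nn_integral_cmult)
    also have "\<dots> = (\<integral>\<^sup>+x. \<integral>\<^sup>+z. \<integral>\<^sup>+w. ?W (x, z, w) * indicator E (x, z, w) \<partial>lborel \<partial>lborel \<partial>lborel)"
    proof (intro nn_integral_cong)
      fix x z w :: 'a
      let ?b = "binom_nn (m - 1) k (ballmass p x (norm z))" and ?c = "binom_nn n l (ballmass q x (norm w))"
      have b0: "0 \<le> ?b" "0 \<le> ?c" by (auto intro!: binom_nn_nonneg ballmass_bounds p q)
      have "?W (x, z, w) = ennreal (p x) * (ennreal (p (x + z)) * (ennreal (q (x + w)) * ennreal (?b * ?c)))"
        using p_nonneg[of x] p_nonneg[of "x + z"] q_nonneg[of "x + w"] b0 by (simp add: ennreal_mult[symmetric] ac_simps)
      then show "ennreal (p x) * (ennreal (p (x + z)) * (ennreal (q (x + w)) * \<Psi> x z w)) = ?W (x, z, w) * indicator E (x, z, w)"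
        by (simp add: \<Psi>_def ac_simps)
    qed
    also have "\<dots> = (\<integral>\<^sup>+x. \<integral>\<^sup>+y. ?W (x, y) * indicator E (x, y) \<partial>leb2 \<partial>lborel)"
      by (intro nn_integral_cong, subst lborel.nn_integral_fst[symmetric]) auto
    also have "\<dots> = (\<integral>\<^sup>+t. ?W t * indicator E t \<partial>leb3)"
      by (subst sigma_finite_measure.nn_integral_fst[OF L2, symmetric]) auto
    also have "\<dots> = emeasure (density leb3 ?W) E"
      by (subst emeasure_density) auto
    finally show "emeasure (distr (density M ?R) leb3 ?T) E = emeasure (density leb3 ?W) E" .
  qed simp
qed

lemma expectation_neighbour_term:
  assumes k: "1 \<le> k" "k \<le> m - 1" and l: "1 \<le> l" "l \<le> n"
    and \<Phi>: "(\<lambda>(u, v). on_quadrant \<phi> u v) \<in> borel_measurable borel"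
    and int: "integrable leb3 (nn_integrand \<phi> k l (m - 1) n p q)"
    and ij: "i \<in> {1..m}" "j \<in> {1..m} - {i}" "j' \<in> {1..n}"
  defines "T \<equiv> \<lambda>\<omega>. neighbour_term \<phi> k l m n (\<lambda>i. X i \<omega>) (\<lambda>j. Y j \<omega>) i j j'"
  shows "integrable M T"
    and "(\<integral>\<omega>. T \<omega> \<partial>M) = (\<integral>t. nn_integrand \<phi> k l (m - 1) n p q t \<partial>leb3) / (real (m - 1) * real n)"
proof -
  let ?N = "m - 1"
  let ?A = "Inl ` ({1..m} - {i} - {j})" and ?B = "Inr ` ({1..n} - {j'})"
  have \<Phi>': "(\<lambda>(u, v). on_quadrant \<phi> u v) \<in> borel_measurable (borel \<Otimes>\<^sub>M borel)"
    using \<Phi> by (simp only: borel_prod)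
  have [measurable (raw)]: "(\<lambda>t. on_quadrant \<phi> (f1 t) (f2 t)) \<in> borel_measurable M'"
    if "f1 \<in> borel_measurable M'" "f2 \<in> borel_measurable M'" for M' and f1 f2 :: "'c \<Rightarrow> real"
    using measurable_compose[OF measurable_Pair[OF that] \<Phi>'] by simp
  define R where "R \<omega> = (of_bool (closer_count (\<lambda>c. case_sum X Y c \<omega>) (Inl i) ?A (Inl j) = k - 1)
      * of_bool (closer_count (\<lambda>c. case_sum X Y c \<omega>) (Inl i) ?B (Inr j') = l - 1) :: real)" for \<omega>
  define V where "V \<omega> = (X i \<omega>, X j \<omega> - X i \<omega>, Y j' \<omega> - X i \<omega>)" for \<omega>
  define W where "W = (\<lambda>(x, z, w). p x * (p (x + z) * binom_nn ?N k (ballmass p x (norm z))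
          * (q (x + w) * binom_nn n l (ballmass q x (norm w)))))"
  define F where "F = (\<lambda>(x::'a, z::'a, w::'a). on_quadrant \<phi> (svol ?N z) (svol n w))"
  have Rm [measurable]: "R \<in> borel_measurable M" unfolding R_def closer_count_def of_bool_def by measurable
  have Vm [measurable]: "V \<in> measurable M leb3" unfolding V_def by measurable
  have Wm [measurable]: "W \<in> borel_measurable leb3" unfolding W_def by measurable
  have Fm [measurable]: "F \<in> borel_measurable leb3" unfolding F_def by measurable
  have R0: "0 \<le> R \<omega>" for \<omega> by (simp add: R_def)
  have W0: "0 \<le> W t" for t
    unfolding W_def by (cases t) (auto intro!: mult_nonneg_nonneg p_nonneg q_nonneg binom_nn_nonneg ballmass_bounds p q)
  have law: "distr (density M (\<lambda>\<omega>. ennreal (R \<omega>))) leb3 V = density leb3 (\<lambda>t. ennreal (W t))"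
    using neighbour_law[OF k l ij] unfolding R_def V_def W_def by (simp add: case_prod_unfold)
  have T: "T = (\<lambda>\<omega>. R \<omega> *\<^sub>R F (V \<omega>))"
    unfolding T_def neighbour_term_def R_def V_def F_def using ij by (intro ext) (simp add: closer_count_image)
  have N0: "real ?N > 0" "real n > 0" using k l by auto
  have WF: "W t *\<^sub>R F t = nn_integrand \<phi> k l ?N n p q t / (real ?N * real n)" for t
  proof (cases t)
    case (fields x z w)
    have "nn_integrand \<phi> k l ?N n p q t = (real ?N * real n) * (W t * F t)"
      by (simp add: fields kernel_integrand_def nn_kernel_def W_def F_def ac_simps)
    then show ?thesis using N0 by simp
  qed
  have iWF: "integrable leb3 (\<lambda>t. W t *\<^sub>R F t)" unfolding WF using int by simp
  then have "integrable (density leb3 (\<lambda>t. ennreal (W t))) F" using W0 by (subst integrable_density) auto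
  then have "integrable (density M (\<lambda>\<omega>. ennreal (R \<omega>))) (\<lambda>\<omega>. F (V \<omega>))"
    unfolding law[symmetric] by (subst (asm) integrable_distr_eq) auto
  then show "integrable M T" unfolding T using R0 by (subst (asm) integrable_density) auto
  have "(\<integral>\<omega>. T \<omega> \<partial>M) = (\<integral>\<omega>. F (V \<omega>) \<partial>density M (\<lambda>\<omega>. ennreal (R \<omega>)))"
    unfolding T using R0 by (subst integral_density) auto
  also have "\<dots> = (\<integral>t. F t \<partial>density leb3 (\<lambda>t. ennreal (W t)))"
    unfolding law[symmetric] by (subst integral_distr) auto
  also have "\<dots> = (\<integral>t. W t *\<^sub>R F t \<partial>leb3)" using W0 by (subst integral_density) auto
  also have "\<dots> = (\<integral>t. nn_integrand \<phi> k l (m - 1) n p q t \<partial>leb3) / (real (m - 1) * real n)"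
    unfolding WF by simp
  finally show "(\<integral>\<omega>. T \<omega> \<partial>M) = (\<integral>t. nn_integrand \<phi> k l (m - 1) n p q t \<partial>leb3) / (real (m - 1) * real n)" .
qed

text \<open>Almost surely the estimator is the mean over \<open>i\<close> of the sums of the terms with indices \<open>j\<close> and
  \<open>j'\<close>, and all \<open>(m - 1) n\<close> terms have the same expectation.\<close>

lemma expectation_nn_estimator:
  assumes k: "1 \<le> k" "k \<le> m - 1" and l: "1 \<le> l" "l \<le> n"
    and \<Phi>: "(\<lambda>(u, v). on_quadrant \<phi> u v) \<in> borel_measurable borel"
    and int: "integrable leb3 (nn_integrand \<phi> k l (m - 1) n p q)"
  shows "(\<integral>\<omega>. nn_estimator \<phi> k l m n (\<lambda>i. X i \<omega>) (\<lambda>j. Y j \<omega>) \<partial>M)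
    = (\<integral>t. nn_integrand \<phi> k l (m - 1) n p q t \<partial>leb3)"
proof -
  let ?I = "\<integral>t. nn_integrand \<phi> k l (m - 1) n p q t \<partial>leb3"
  have \<Phi>': "(\<lambda>(u, v). on_quadrant \<phi> u v) \<in> borel_measurable (borel \<Otimes>\<^sub>M borel)"
    using \<Phi> by (simp only: borel_prod)
  let ?G = "\<lambda>i \<omega>. on_quadrant \<phi> (nn_U k m (\<lambda>i. X i \<omega>) i) (nn_V l n (\<lambda>i. X i \<omega>) (\<lambda>j. Y j \<omega>) i)"
  let ?\<tau> = "\<lambda>i j j' \<omega>. neighbour_term \<phi> k l m n (\<lambda>i. X i \<omega>) (\<lambda>j. Y j \<omega>) i j j'"
  let ?S = "\<lambda>i \<omega>. \<Sum>j\<in>{1..m} - {i}. \<Sum>j'\<in>{1..n}. ?\<tau> i j j' \<omega>"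
  have each: "integrable M (?G i) \<and> (\<integral>\<omega>. ?G i \<omega> \<partial>M) = ?I" if i: "i \<in> {1..m}" for i
  proof -
    note nbterm = expectation_neighbour_term[OF k l \<Phi> int i]
    have "AE \<omega> in M. \<forall>a\<in>{1..m} - {i}. \<forall>b\<in>{1..m} - {i} - {a}. dist (X i \<omega>) (X a \<omega>) \<noteq> dist (X i \<omega>) (X b \<omega>)"
    proof (intro AE_ball_countable[THEN iffD2] ballI countable_finite)
      fix a b assume "a \<in> {1..m} - {i}" "b \<in> {1..m} - {i} - {a}"
      then show "AE \<omega> in M. dist (X i \<omega>) (X a \<omega>) \<noteq> dist (X i \<omega>) (X b \<omega>)"
        using AE_distances_distinct[OF indep p, where a="Inl i" and b="Inl a" and c="Inl b"] X by simp
    qed auto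
    moreover have "AE \<omega> in M. \<forall>a\<in>{1..n}. \<forall>b\<in>{1..n} - {a}. dist (X i \<omega>) (Y a \<omega>) \<noteq> dist (X i \<omega>) (Y b \<omega>)"
    proof (intro AE_ball_countable[THEN iffD2] ballI countable_finite)
      fix a b assume "a \<in> {1..n}" "b \<in> {1..n} - {a}"
      then show "AE \<omega> in M. dist (X i \<omega>) (Y a \<omega>) \<noteq> dist (X i \<omega>) (Y b \<omega>)"
        using AE_distances_distinct[OF indep q, where a="Inl i" and b="Inr a" and c="Inr b"] Y by simp
    qed auto
    ultimately have ae: "AE \<omega> in M. ?G i \<omega> = ?S i \<omega>"
    proof eventually_elim
      fix \<omega>
      assume 1: "\<forall>a\<in>{1..m} - {i}. \<forall>b\<in>{1..m} - {i} - {a}. dist (X i \<omega>) (X a \<omega>) \<noteq> dist (X i \<omega>) (X b \<omega>)"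
        and 2: "\<forall>a\<in>{1..n}. \<forall>b\<in>{1..n} - {a}. dist (X i \<omega>) (Y a \<omega>) \<noteq> dist (X i \<omega>) (Y b \<omega>)"
      have "inj_on (\<lambda>a. dist (X i \<omega>) (X a \<omega>)) ({1..m} - {i})" unfolding inj_on_def using 1 by blast
      moreover have "inj_on (\<lambda>b. dist (X i \<omega>) (Y b \<omega>)) {1..n}" unfolding inj_on_def using 2 by blast
      ultimately show "?G i \<omega> = ?S i \<omega>"
        using k l i by (rule on_quadrant_neighbour_sum)
    qed
    have iS': "integrable M (\<lambda>\<omega>. \<Sum>j'\<in>{1..n}. ?\<tau> i j j' \<omega>)" if "j \<in> {1..m} - {i}" for j
      using nbterm(1)[OF that] by (rule Bochner_Integration.integrable_sum)
    have iS: "integrable M (?S i)"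
      using iS' by (rule Bochner_Integration.integrable_sum)
    have "nn_U k m (\<lambda>i. X i \<omega>) i = (real m - 1) * measure lborel (ball (X i \<omega>) (nn_dist k (X i \<omega>) ((\<lambda>a. X a \<omega>) ` ({1..m} - {i}))))"
      "nn_V l n (\<lambda>i. X i \<omega>) (\<lambda>j. Y j \<omega>) i = real n * measure lborel (ball (X i \<omega>) (nn_dist l (X i \<omega>) ((\<lambda>a. Y a \<omega>) ` {1..n})))" for \<omega>
      by (simp_all add: nn_U_def nn_V_def)
    moreover have "(\<lambda>\<omega>. (real m - 1) * measure lborel (ball (X i \<omega>) (nn_dist k (X i \<omega>) ((\<lambda>a. X a \<omega>) ` ({1..m} - {i}))))) \<in> borel_measurable M"
      by (intro borel_measurable_times borel_measurable_const measure_ball_measurable nn_dist_measurable k) auto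
    moreover have "(\<lambda>\<omega>. real n * measure lborel (ball (X i \<omega>) (nn_dist l (X i \<omega>) ((\<lambda>a. Y a \<omega>) ` {1..n})))) \<in> borel_measurable M"
      by (intro borel_measurable_times borel_measurable_const measure_ball_measurable nn_dist_measurable l) auto
    ultimately have U: "(\<lambda>\<omega>. nn_U k m (\<lambda>i. X i \<omega>) i) \<in> borel_measurable M"
      and V: "(\<lambda>\<omega>. nn_V l n (\<lambda>i. X i \<omega>) (\<lambda>j. Y j \<omega>) i) \<in> borel_measurable M" by simp_all
    have Gm: "?G i \<in> borel_measurable M"
      using measurable_compose[OF measurable_Pair[OF U V] \<Phi>'] by simp
    have "integrable M (?G i)"
      by (rule integrable_cong_AE_imp[OF iS Gm]) (use ae in \<open>auto elim: eventually_mono\<close>)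
    moreover have "(\<integral>\<omega>. ?G i \<omega> \<partial>M) = (\<integral>\<omega>. ?S i \<omega> \<partial>M)"
      using Gm borel_measurable_integrable[OF iS] ae by (rule integral_cong_AE)
    moreover have "(\<integral>\<omega>. ?S i \<omega> \<partial>M) = (\<Sum>j\<in>{1..m} - {i}. \<Sum>j'\<in>{1..n}. ?I / (real (m - 1) * real n))"
    proof -
      have "(\<integral>\<omega>. ?S i \<omega> \<partial>M) = (\<Sum>j\<in>{1..m} - {i}. \<integral>\<omega>. (\<Sum>j'\<in>{1..n}. ?\<tau> i j j' \<omega>) \<partial>M)"
        using iS' by (rule Bochner_Integration.integral_sum)
      also have "\<dots> = (\<Sum>j\<in>{1..m} - {i}. \<Sum>j'\<in>{1..n}. \<integral>\<omega>. ?\<tau> i j j' \<omega> \<partial>M)"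
        using nbterm(1) by (intro sum.cong refl Bochner_Integration.integral_sum)
      also have "\<dots> = (\<Sum>j\<in>{1..m} - {i}. \<Sum>j'\<in>{1..n}. ?I / (real (m - 1) * real n))"
        using nbterm(2) by (intro sum.cong refl)
      finally show ?thesis .
    qed
    moreover have "(\<Sum>j\<in>{1..m} - {i}. \<Sum>j'\<in>{1..n}. ?I / (real (m - 1) * real n)) = ?I"
      using i k l by simp
    ultimately show ?thesis by simp
  qed
  have "(\<integral>\<omega>. nn_estimator \<phi> k l m n (\<lambda>i. X i \<omega>) (\<lambda>j. Y j \<omega>) \<partial>M) = 1 / real m * (\<Sum>i=1..m. \<integral>\<omega>. ?G i \<omega> \<partial>M)"
    unfolding nn_estimator_def using each by (subst integral_mult_right_zero, subst Bochner_Integration.integral_sum) auto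
  also have "\<dots> = ?I" using each k by simp
  finally show ?thesis .
qed

end

section \<open>The rate\<close>

text \<open>When \<open>a \<le> - 1\<close>, the quotient \<open>(k + a) / (k - 1)\<close> lies between \<open>0\<close> and \<open>1\<close>.\<close>

lemma bias_exponent_bounds:
  fixes a \<sigma> :: real and d k :: nat
  assumes "d \<ge> 1" "0 < \<sigma>" "k \<ge> 1" "real k > - a"
  shows "0 < bias_exponent d \<sigma> a k" "bias_exponent d \<sigma> a k \<le> min \<sigma> 1 / real d"
proof -
  have d: "real d > 0" using assms by simp
  have r: "0 < (real k + a) / (real k - 1) \<and> (real k + a) / (real k - 1) \<le> 1" if "a \<le> - 1"
    using assms that by (auto simp: divide_le_eq)
  have a1: "a \<le> - 1" if "a \<le> - \<sigma> / real d - 1" using that assms d by (smt (verit) divide_pos_pos minus_divide_left)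
  show "0 < bias_exponent d \<sigma> a k"
    using assms d r a1 by (auto simp: bias_exponent_def)
  show "bias_exponent d \<sigma> a k \<le> min \<sigma> 1 / real d"
  proof -
    have "min \<sigma> 1 * ((real k + a) / (real k - 1)) \<le> min \<sigma> 1" if "a \<le> - 1"
      using r[OF that] assms by (intro mult_left_le) auto
    moreover have "min \<sigma> ((real k + a) / (real k - 1)) \<le> min \<sigma> 1" if "a \<le> - 1"
      using r[OF that] by auto
    ultimately have "bias_exponent d \<sigma> a k * real d \<le> min \<sigma> 1"
      unfolding bias_exponent_def using a1 d by auto
    then show ?thesis using d by (simp add: le_divide_eq)
  qed
qed

text \<open>The zeroth power of the logarithm is \<open>1\<close> unless the logarithm vanishes, which \<open>N \<ge> 2\<close>
  and \<open>r > 0\<close> exclude.\<close>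

lemma rate_le_with_polylog:
  fixes e r :: real and N :: nat
  assumes "0 < r" "r \<le> e" "2 \<le> N"
  shows "real N powr - e \<le> with_polylog 0 (real N powr - r)"
proof -
  have "ln (real N powr - r) \<noteq> 0" using assms by (simp add: ln_powr)
  then have "with_polylog 0 (real N powr - r) = real N powr - r" by (simp add: with_polylog_def)
  also have "real N powr - e \<le> real N powr - r" using assms by (intro powr_mono) auto
  finally show ?thesis .
qed

lemma pred_powr_le:
  fixes e :: real and m :: nat
  assumes "0 \<le> e" "e \<le> 1" "2 \<le> m"
  shows "real (m - 1) powr - e \<le> 2 * real m powr - e"
proof -
  have "real (m - 1) powr - e \<le> (real m / 2) powr - e"
    using assms by (intro powr_mono2') auto
  also have "\<dots> = 2 powr e * real m powr - e"
    using assms by (simp add: powr_divide powr_minus field_simps)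
  also have "\<dots> \<le> 2 powr 1 * real m powr - e"
    using assms by (intro mult_right_mono powr_mono) auto
  finally show ?thesis by simp
qed

theorem mainTheorem11:
  fixes M :: "'w measure"
    and X Y :: "nat \<Rightarrow> 'w \<Rightarrow> 'a::euclidean_space"
    and p q :: "'a \<Rightarrow> real"
    and f \<phi> :: "real \<Rightarrow> real \<Rightarrow> real"
    and a b a' b' C \<sigma>\<^sub>p \<sigma>\<^sub>q :: real
    and k l :: nat
  assumes "prob_density p" and "prob_density q"
    and "absolutely_continuous (prob_of q) (prob_of p)"
    and "prob_space M"
    and "\<And>i. distributed M lborel (X i) (\<lambda>x. ennreal (p x))"
    and "\<And>j. distributed M lborel (Y j) (\<lambda>x. ennreal (q x))"
    and "prob_space.indep_vars M (\<lambda>_. borel) (case_sum X Y) UNIV"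
    and "k \<ge> 1" and "l \<ge> 1"
    and "real k > - a" and "real l > - a'"
    and "is_estimator_function k l f \<phi>"
    and "\<And>u v. u > 0 \<Longrightarrow> v > 0 \<Longrightarrow>
           \<bar>\<phi> u v\<bar> \<le> C * poly_envelope a b u * poly_envelope a' b' v"
    and "regular_density \<sigma>\<^sub>p p" and "regular_density \<sigma>\<^sub>q q"
  shows "\<exists>c c'. (\<lambda>(m, n). \<bar>(\<integral>\<omega>. nn_estimator \<phi> k l m n (\<lambda>i. X i \<omega>) (\<lambda>j. Y j \<omega>) \<partial>M)
                              - density_functional f p q\<bar>)
           \<in> O[at_top \<times>\<^sub>F at_top](\<lambda>(m, n).
                with_polylog c (real m powr - bias_exponent DIM('a) \<sigma>\<^sub>p a k)
              + with_polylog c' (real n powr - bias_exponent DIM('a) \<sigma>\<^sub>q a' l))"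
proof (intro exI)
  interpret prob_space M by fact
  interpret two_samples M X Y p q
    using assms(1,2,7) distr_distributed(1)[OF assms(5)] distr_distributed(1)[OF assms(6)] by unfold_locales
  let ?d = "real DIM('a)"
  let ?ep = "min \<sigma>\<^sub>p 1 / ?d" and ?eq = "min \<sigma>\<^sub>q 1 / ?d"
  let ?wp = "\<lambda>m. with_polylog 0 (real m powr - bias_exponent DIM('a) \<sigma>\<^sub>p a k)"
    and ?wq = "\<lambda>n. with_polylog 0 (real n powr - bias_exponent DIM('a) \<sigma>\<^sub>q a' l)"
  let ?err = "\<lambda>m n. \<bar>(\<integral>\<omega>. nn_estimator \<phi> k l m n (\<lambda>i. X i \<omega>) (\<lambda>j. Y j \<omega>) \<partial>M) - density_functional f p q\<bar>"
  have \<sigma>: "0 < \<sigma>\<^sub>p" "0 < \<sigma>\<^sub>q" using assms(14,15) by (auto simp: regular_density_def)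
  have d1: "DIM('a) \<ge> 1" by (simp add: Suc_leI)
  obtain cp Cp Kp where P: "tame_density p (supp p) cp Cp Kp (min \<sigma>\<^sub>p 1)"
    using regular_imp_tame[OF assms(1,14)] by blast
  obtain cq Cq Kq where Q: "tame_density q (supp q) cq Cq Kq (min \<sigma>\<^sub>q 1)"
    using regular_imp_tame[OF assms(2,15)] by blast
  have sub: "supp p \<subseteq> supp q" by (rule supp_mono_absolutely_continuous[OF assms(3)])
  obtain B where B: "B \<ge> 0"
    and int: "\<And>N n. k \<le> N \<Longrightarrow> l \<le> n \<Longrightarrow> integrable leb3 (nn_integrand \<phi> k l N n p q)"
    and diff: "\<And>N n. k \<le> N \<Longrightarrow> l \<le> n \<Longrightarrow>
        \<bar>(\<integral>t. nn_integrand \<phi> k l N n p q t \<partial>leb3) - density_functional f p q\<bar>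
        \<le> B * (real N powr - ?ep + real n powr - ?eq)"
    by (rule kernel_functional_difference[OF P Q sub assms(8-12)], erule (1) assms(13), rule that) assumption+
  have e1: "0 \<le> ?ep" "?ep \<le> 1" using \<sigma> d1 by (auto simp: divide_le_eq min_le_iff_disj)
  note bp = bias_exponent_bounds[OF d1 \<sigma>(1) assms(8,10)]
  note bq = bias_exponent_bounds[OF d1 \<sigma>(2) assms(9,11)]
  have bound: "?err m n
      \<le> 2 * B * (?wp m + ?wq n)"
    if m: "m \<ge> k + 1" and n: "n \<ge> l + 1" for m n
  proof -
    have km: "k \<le> m - 1" "l \<le> n" "2 \<le> m" "2 \<le> n" using m n assms(8,9) by auto
    have "?err m n
      = \<bar>(\<integral>t. nn_integrand \<phi> k l (m - 1) n p q t \<partial>leb3) - density_functional f p q\<bar>"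
      by (subst expectation_nn_estimator[OF assms(8) km(1) assms(9) km(2)
            estimator_function_measurable[OF assms(12)] int[OF km(1,2)]]) (rule refl)
    also have "\<dots> \<le> B * (real (m - 1) powr - ?ep + real n powr - ?eq)" by (rule diff[OF km(1,2)])
    also have "\<dots> \<le> B * (2 * real m powr - ?ep + 2 * real n powr - ?eq)"
      using B pred_powr_le[OF e1 km(3)] by (intro mult_left_mono add_mono) auto
    also have "\<dots> = 2 * B * (real m powr - ?ep + real n powr - ?eq)" by (simp add: algebra_simps)
    also have "\<dots> \<le> 2 * B * (?wp m + ?wq n)"
      using B rate_le_with_polylog[OF bp km(3)] rate_le_with_polylog[OF bq km(4)]
      by (intro mult_left_mono add_mono) auto
    finally show ?thesis .
  qed
  have wp0: "0 \<le> with_polylog 0 (x powr y)" for x y by (simp add: with_polylog_def)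
  show "(\<lambda>(m, n). ?err m n)
       \<in> O[at_top \<times>\<^sub>F at_top](\<lambda>(m, n). ?wp m + ?wq n)"
  proof (rule bigoI[where c = "2 * B"])
    have "\<forall>\<^sub>F t in (at_top :: nat filter) \<times>\<^sub>F (at_top :: nat filter). k + 1 \<le> fst t \<and> l + 1 \<le> snd t"
      by (intro eventually_prodI eventually_ge_at_top)
    then show "\<forall>\<^sub>F t in at_top \<times>\<^sub>F at_top.
        norm (case t of (m, n) \<Rightarrow> ?err m n)
        \<le> 2 * B * norm (case t of (m, n) \<Rightarrow> ?wp m + ?wq n)"
    proof eventually_elim
      case (elim t)
      obtain m n where t: "t = (m, n)" by fastforce
      show ?case using bound[of m n] elim wp0 unfolding t by simp
    qed
  qed
qed

end
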